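(* Let $\|\cdot\|_\phi$ be a rotund symmetric norm, let $u\in\mathcal U_\phi$, and let $z$ be a Hermitian element of $\mathcal I_\phi$ with $\|z\|<\pi$. Then $\delta(t)=ue^{itz}$, $t\in[0,1]$, is, up to reparametrization, the unique piecewise $C^1$ curve in $\mathcal U_\phi$ joining $u$ to $v=ue^{iz}$ with length equal to $d_\phi(u,v)=\|z\|_\phi$. That is, $L_\phi(\delta)=d_\phi(u,v)=\|z\|_\phi$, and if $\gamma:[0,1]\to\mathcal U_\phi$ is a piecewise $C^1$ curve with $\gamma(0)=u$, $\gamma(1)=v$ and $L_\phi(\gamma)=\|z\|_\phi$, then there is a nondecreasing continuous surjection $s:[0,1]\to[0,1]$ with $\gamma(t)=ue^{is(t)z}$ for all $t\in[0,1]$.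
   Context: $\mathcal H$ is a complex separable infinite dimensional Hilbert space, $\mathcal B(\mathcal H)$ its bounded operators, $\|\cdot\|$ the uniform (operator) norm, and Hermitian means self-adjoint. A symmetric norm is a norm $\|\cdot\|_\phi:\mathcal B(\mathcal H)\to\mathbb R\cup\{\infty\}$ with $\|xyz\|_\phi\le\|x\|\,\|y\|_\phi\,\|z\|$ for all $x,y,z\in\mathcal B(\mathcal H)$. Put $\mathcal I_\phi=\{x\in\mathcal B(\mathcal H):\|x\|_\phi<\infty\}$, a two-sided ideal. As in the classical theory (Gohberg–Krein, Simon), $\mathcal I_\phi$ is the maximal ideal of the norm: there is a symmetric gauge function $\phi$ on finitely supported sequences with $\|x\|_\phi=\sup_n\phi(s_1(x),\dots,s_n(x),0,0,\dots)$ for compact $x$ with singular values $s_j(x)$; in particular finite rank operators have finite norm. Standing assumption: $\|\cdot\|_\phi$ is inequivalent to the uniform norm, so $\mathcal I_\phi$ is a proper ideal consisting of compact operators. The norm $\|\cdot\|_\phi$ is rotund (strictly convex) if for all nonzero $x,y\in\mathcal I_\phi$, $\|x+y\|_\phi=\|x\|_\phi+\|y\|_\phi$ implies $x=\lambda y$ for some scalar $\lambda$. $\mathcal U_\phi=\{u\text{ unitary in }\mathcal H: u-1\in\mathcal I_\phi\}$, with the topology given by the metric $\|u-v\|_\phi$. Smooth curves are $C^1$ (with respect to $\|\cdot\|_\phi$) with non-vanishing derivative. For a piecewise $C^1$ curve $\gamma:[0,1]\to\mathcal U_\phi$, $L_\phi(\gamma)=\int_0^1\|\dot\gamma(t)\|_\phi\,dt$,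 and $d_\phi(u,v)$ is the infimum of $L_\phi(\gamma)$ over piecewise smooth $\gamma:[0,1]\to\mathcal U_\phi$ joining $u$ to $v$. *)

theory Defs
  imports "HOL-Analysis.Analysis"
begin

class scaleC =
  fixes scaleC :: "complex \<Rightarrow> 'a \<Rightarrow> 'a" (infixr "*\<^sub>C" 75)

text \<open>The inner product is linear in the first and conjugate linear in the second argument.\<close>

class complex_hilbert = banach + scaleC +
  fixes cinner :: "'a \<Rightarrow> 'a \<Rightarrow> complex"
  assumes scaleC_add_right: "a *\<^sub>C (x + y) = a *\<^sub>C x + a *\<^sub>C y"
    and scaleC_add_left: "(a + b) *\<^sub>C x = a *\<^sub>C x + b *\<^sub>C x"
    and scaleC_scaleC: "a *\<^sub>C b *\<^sub>C x = (a * b) *\<^sub>C x"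
    and scaleC_of_real: "complex_of_real r *\<^sub>C x = r *\<^sub>R x"
    and cinner_commute: "cinner x y = cnj (cinner y x)"
    and cinner_add_left: "cinner (x + y) w = cinner x w + cinner y w"
    and cinner_scaleC_left: "cinner (a *\<^sub>C x) y = a * cinner x y"
    and cinner_self: "cinner x x = complex_of_real ((norm x)\<^sup>2)"

interpretation complex_vector: vector_space "scaleC :: complex \<Rightarrow> 'a \<Rightarrow> 'a::complex_hilbert"
proof
  show "1 *\<^sub>C x = x" for x :: 'a
    using scaleC_of_real[of 1 x] by simp
qed (simp_all add: scaleC_add_right scaleC_add_left scaleC_scaleC)

class separable_infinite_hilbert = complex_hilbert +
  assumes separable: "\<exists>D. countable D \<and> (\<forall>x. \<forall>e>0. \<exists>d\<in>D. dist d x < e)"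
    and infinite_dimensional: "finite B \<Longrightarrow> \<exists>x. \<forall>c. x \<noteq> (\<Sum>b\<in>B. c b *\<^sub>C b)"

lemma exists_nonzero_hilbert: "\<exists>x :: 'a::separable_infinite_hilbert. x \<noteq> 0"
  using infinite_dimensional[of "{}"] by simp

typedef (overloaded) 'a bop =
  "{f :: 'a \<Rightarrow>\<^sub>L 'a::complex_hilbert. \<forall>c v. blinfun_apply f (c *\<^sub>C v) = c *\<^sub>C blinfun_apply f v}"
  morphisms blinfun_of_bop Bop
proof
  show "0 \<in> {f :: 'a \<Rightarrow>\<^sub>L 'a. \<forall>c v. blinfun_apply f (c *\<^sub>C v) = c *\<^sub>C blinfun_apply f v}"
    by (simp add: complex_vector.scale_zero_right)
qed

setup_lifting type_definition_bop

lift_definition bop_apply :: "'a::complex_hilbert bop \<Rightarrow> 'a \<Rightarrow> 'a" (infixr "\<cdot>" 80)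
  is blinfun_apply .

lemma bop_eqI: "(\<And>v. x \<cdot> v = y \<cdot> v) \<Longrightarrow> x = y"
  by transfer (rule blinfun_eqI)

lemma bounded_linear_scaleC: "bounded_linear (\<lambda>v :: 'a::complex_hilbert. c *\<^sub>C v)"
proof (rule bounded_linear_intro)
  fix x y :: 'a and r :: real
  show "c *\<^sub>C (x + y) = c *\<^sub>C x + c *\<^sub>C y"
    by (rule scaleC_add_right)
  show "c *\<^sub>C r *\<^sub>R x = r *\<^sub>R c *\<^sub>C x"
    by (simp add: scaleC_of_real[symmetric] scaleC_scaleC mult.commute)
  have "complex_of_real ((norm (c *\<^sub>C x))\<^sup>2) = c * cinner x (c *\<^sub>C x)"
    by (simp only: cinner_self[symmetric] cinner_scaleC_left)
  also have "cinner x (c *\<^sub>C x) = cnj c * cinner x x"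
    by (metis cinner_commute cinner_scaleC_left complex_cnj_mult)
  also have "c * (cnj c * cinner x x) = complex_of_real ((cmod c * norm x)\<^sup>2)"
    by (simp add: cinner_self complex_mult_cnj cmod_power2 power_mult_distrib
        mult.assoc[symmetric] del: of_real_power)
  finally have "(norm (c *\<^sub>C x))\<^sup>2 = (cmod c * norm x)\<^sup>2"
    using of_real_eq_iff by blast
  then have "norm (c *\<^sub>C x) = cmod c * norm x"
    by (simp add: power2_eq_iff_nonneg)
  then show "norm (c *\<^sub>C x) \<le> norm x * cmod c"
    by simp
qed

instantiation bop :: (complex_hilbert) "{real_normed_vector, scaleC}"
begin

lift_definition zero_bop :: "'a bop" is 0
  by (simp add: complex_vector.scale_zero_right)
lift_definition plus_bop :: "'a bop \<Rightarrow> 'a bop \<Rightarrow> 'a bop" is "(+)"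
  by (simp add: blinfun.add_left scaleC_add_right)
lift_definition uminus_bop :: "'a bop \<Rightarrow> 'a bop" is uminus
  by (simp add: blinfun.minus_left complex_vector.scale_minus_right)
lift_definition minus_bop :: "'a bop \<Rightarrow> 'a bop \<Rightarrow> 'a bop" is "(-)"
  by (simp add: blinfun.diff_left complex_vector.scale_right_diff_distrib)
lift_definition scaleC_bop :: "complex \<Rightarrow> 'a bop \<Rightarrow> 'a bop"
  is "\<lambda>c f. Blinfun (\<lambda>v. c *\<^sub>C v) o\<^sub>L f"
  by (simp add: bounded_linear_Blinfun_apply[OF bounded_linear_scaleC] scaleC_scaleC mult.commute)
lift_definition scaleR_bop :: "real \<Rightarrow> 'a bop \<Rightarrow> 'a bop" is scaleR
  by (simp add: blinfun.scaleR_left scaleC_of_real[symmetric] scaleC_scaleC mult.commute)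
lift_definition norm_bop :: "'a bop \<Rightarrow> real" is norm .

definition dist_bop :: "'a bop \<Rightarrow> 'a bop \<Rightarrow> real" where
  "dist_bop x y = norm (x - y)"
definition sgn_bop :: "'a bop \<Rightarrow> 'a bop" where
  "sgn_bop x = inverse (norm x) *\<^sub>R x"
definition uniformity_bop :: "('a bop \<times> 'a bop) filter" where
  "uniformity_bop = (INF e\<in>{0 <..}. principal {(x, y). dist x y < e})"
definition open_bop :: "'a bop set \<Rightarrow> bool" where
  "open_bop S = (\<forall>x\<in>S. \<forall>\<^sub>F (x', y) in uniformity. x' = x \<longrightarrow> y \<in> S)"

instance
proof
  fix x y w :: "'a bop" and r s :: real
  show "x + y + w = x + (y + w)" by transfer simp
  show "x + y = y + x" by transfer simp
  show "0 + x = x" by transfer simp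
  show "- x + x = 0" by transfer simp
  show "x - y = x + - y" by transfer simp
  show "r *\<^sub>R (x + y) = r *\<^sub>R x + r *\<^sub>R y" by transfer (simp add: scaleR_add_right)
  show "(r + s) *\<^sub>R x = r *\<^sub>R x + s *\<^sub>R x" by transfer (simp add: scaleR_add_left)
  show "r *\<^sub>R s *\<^sub>R x = (r * s) *\<^sub>R x" by transfer simp
  show "1 *\<^sub>R x = x" by transfer simp
  show "(norm x = 0) = (x = 0)" by transfer simp
  show "norm (x + y) \<le> norm x + norm y" by transfer (rule norm_triangle_ineq)
  show "norm (r *\<^sub>R x) = \<bar>r\<bar> * norm x" by transfer simp
qed (simp_all add: dist_bop_def sgn_bop_def uniformity_bop_def open_bop_def)

end

lemma scaleC_bop_apply: "(c *\<^sub>C x) \<cdot> v = c *\<^sub>C (x \<cdot> v)"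
  by transfer (simp add: bounded_linear_Blinfun_apply[OF bounded_linear_scaleC])

instantiation bop :: (separable_infinite_hilbert) real_normed_algebra_1
begin

lift_definition one_bop :: "'a bop" is id_blinfun
  by simp
lift_definition times_bop :: "'a bop \<Rightarrow> 'a bop \<Rightarrow> 'a bop" is "(o\<^sub>L)"
  by simp

instance
proof
  fix x y w :: "'a bop" and r :: real
  show "x * y * w = x * (y * w)" by transfer (rule blinfun_eqI, simp)
  show "1 * x = x" by transfer (rule blinfun_eqI, simp)
  show "x * 1 = x" by transfer (rule blinfun_eqI, simp)
  show "(x + y) * w = x * w + y * w" by transfer (rule blinfun_eqI, simp add: blinfun.bilinear_simps)
  show "x * (y + w) = x * y + x * w" by transfer (rule blinfun_eqI, simp add: blinfun.bilinear_simps)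
  show "r *\<^sub>R x * y = r *\<^sub>R (x * y)" by transfer (rule blinfun_eqI, simp add: blinfun.bilinear_simps)
  show "x * r *\<^sub>R y = r *\<^sub>R (x * y)" by transfer (rule blinfun_eqI, simp add: blinfun.bilinear_simps)
  show "norm (x * y) \<le> norm x * norm y" by transfer (rule norm_blinfun_compose)
  obtain v :: 'a where v: "v \<noteq> 0"
    using exists_nonzero_hilbert by blast
  show "norm (1 :: 'a bop) = 1"
  proof transfer
    have "norm v \<le> norm (id_blinfun :: 'a \<Rightarrow>\<^sub>L 'a) * norm v"
      using norm_blinfun[of "id_blinfun :: 'a \<Rightarrow>\<^sub>L 'a" v] by simp
    then have "1 \<le> norm (id_blinfun :: 'a \<Rightarrow>\<^sub>L 'a)"
      using v by simp
    then show "norm (id_blinfun :: 'a \<Rightarrow>\<^sub>L 'a) = 1"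
      using norm_blinfun_id_le[where 'a='a] by linarith
  qed
  have "(1 :: 'a bop) \<cdot> v \<noteq> 0 \<cdot> v"
    using v by transfer simp
  then show "(0 :: 'a bop) \<noteq> 1" by metis
qed

end

instance bop :: (complex_hilbert) banach
proof
  fix X :: "nat \<Rightarrow> 'a bop"
  assume "Cauchy X"
  then have "Cauchy (\<lambda>n. blinfun_of_bop (X n))"
    by (simp add: Cauchy_def dist_norm norm_bop.rep_eq minus_bop.rep_eq)
  then obtain L where L: "(\<lambda>n. blinfun_of_bop (X n)) \<longlonglongrightarrow> L"
    using Cauchy_convergent convergent_def by blast
  have app: "(\<lambda>n. blinfun_of_bop (X n) v) \<longlonglongrightarrow> L v" for v
    using L by (intro tendsto_intros)
  have "L (c *\<^sub>C v) = c *\<^sub>C L v" for c v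
  proof (rule LIMSEQ_unique)
    show "(\<lambda>n. blinfun_of_bop (X n) (c *\<^sub>C v)) \<longlonglongrightarrow> L (c *\<^sub>C v)"
      by (rule app)
    have "(\<lambda>n. c *\<^sub>C blinfun_of_bop (X n) v) \<longlonglongrightarrow> c *\<^sub>C L v"
      by (rule bounded_linear.tendsto[OF bounded_linear_scaleC app])
    moreover have "blinfun_of_bop (X n) (c *\<^sub>C v) = c *\<^sub>C blinfun_of_bop (X n) v" for n
      using blinfun_of_bop[of "X n"] by blast
    ultimately show "(\<lambda>n. blinfun_of_bop (X n) (c *\<^sub>C v)) \<longlonglongrightarrow> c *\<^sub>C L v"
      by presburger
  qed
  then have "blinfun_of_bop (Bop L) = L"
    by (simp add: Bop_inverse)
  then have "X \<longlonglongrightarrow> Bop L"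
    using L by (simp add: tendsto_iff dist_norm norm_bop.rep_eq minus_bop.rep_eq)
  then show "convergent X"
    by (rule convergentI)
qed

lemma times_bop_apply: "(x * y) \<cdot> v = x \<cdot> y \<cdot> v"
  by transfer simp

lemma one_bop_apply: "1 \<cdot> v = v"
  by transfer simp

definition adj :: "'a::complex_hilbert bop \<Rightarrow> 'a bop" where
  "adj x = (THE y. \<forall>v w. cinner (x \<cdot> v) w = cinner v (y \<cdot> w))"

definition hermitian :: "'a::complex_hilbert bop \<Rightarrow> bool" where
  "hermitian x \<longleftrightarrow> adj x = x"

definition unitary :: "'a::separable_infinite_hilbert bop \<Rightarrow> bool" where
  "unitary u \<longleftrightarrow> adj u * u = 1 \<and> u * adj u = 1"

definition compact_op :: "'a::complex_hilbert bop \<Rightarrow> bool" where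
  "compact_op x \<longleftrightarrow> compact (closure (bop_apply x ` cball 0 1))"

text \<open>
  The singular values of a compact operator \<open>x\<close> are the square roots of the eigenvalues of
  \<open>x\<^sup>* x\<close> (the eigenvalues of the modulus of \<open>x\<close>), in nonincreasing order, each positive one
  repeated according to its multiplicity, followed by zeros if there are only finitely many
  positive ones.  Indices start at 0.  For compact \<open>x\<close> exactly one sequence satisfies the
  description; convergence to zero rules out infinitely repeated positive values, which
  \<open>card\<close> would not see.
\<close>
definition singular_values :: "'a::separable_infinite_hilbert bop \<Rightarrow> nat \<Rightarrow> real" where
  "singular_values x = (THE s. decseq s \<and> s \<longlonglongrightarrow> 0 \<and>
     (\<forall>r>0. card {j. s j = r} =
        complex_vector.dim {v. (adj x * x) \<cdot> v = complex_of_real (r\<^sup>2) *\<^sub>C v}))"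

locale symmetric_norm =
  fixes N :: "'h::separable_infinite_hilbert bop \<Rightarrow> ennreal"
  assumes zero_iff: "N x = 0 \<longleftrightarrow> x = 0"
    and scaleC: "N (c *\<^sub>C x) = ennreal (cmod c) * N x"
    and triangle: "N (x + y) \<le> N x + N y"
    and ideal: "N (x * y * w) \<le> ennreal (norm x) * N y * ennreal (norm w)"

definition norm_ideal :: "('h::separable_infinite_hilbert bop \<Rightarrow> ennreal) \<Rightarrow> 'h bop set" where
  "norm_ideal N = {x. N x < \<infinity>}"

text \<open>
  Symmetric gauge functions on finitely supported real sequences.  Only values at such sequences
  matter.  The customary normalization \<open>\<phi> (1, 0, 0, \<dots>) = 1\<close> is not imposed.
\<close>
locale symmetric_gauge =
  fixes \<phi> :: "(nat \<Rightarrow> real) \<Rightarrow> real"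
  assumes nonneg: "finite {j. a j \<noteq> 0} \<Longrightarrow> 0 \<le> \<phi> a"
    and zero_iff: "finite {j. a j \<noteq> 0} \<Longrightarrow> \<phi> a = 0 \<longleftrightarrow> (\<forall>j. a j = 0)"
    and scale: "finite {j. a j \<noteq> 0} \<Longrightarrow> \<phi> (\<lambda>j. r * a j) = \<bar>r\<bar> * \<phi> a"
    and triangle: "finite {j. a j \<noteq> 0} \<Longrightarrow> finite {j. b j \<noteq> 0} \<Longrightarrow>
      \<phi> (\<lambda>j. a j + b j) \<le> \<phi> a + \<phi> b"
    and permute: "finite {j. a j \<noteq> 0} \<Longrightarrow> bij p \<Longrightarrow> \<phi> (\<lambda>j. a (p j)) = \<phi> a"
    and abs: "finite {j. a j \<noteq> 0} \<Longrightarrow> \<phi> (\<lambda>j. \<bar>a j\<bar>) = \<phi> a"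

definition given_by_gauge :: "('h::separable_infinite_hilbert bop \<Rightarrow> ennreal) \<Rightarrow> bool" where
  "given_by_gauge N \<longleftrightarrow> (\<exists>\<phi>. symmetric_gauge \<phi> \<and>
     (\<forall>x. compact_op x \<longrightarrow>
        N x = (SUP n. ennreal (\<phi> (\<lambda>j. if j < n then singular_values x j else 0)))))"

definition equivalent_to_uniform ::
    "('h::separable_infinite_hilbert bop \<Rightarrow> ennreal) \<Rightarrow> bool" where
  "equivalent_to_uniform N \<longleftrightarrow>
     (\<exists>c C. 0 < c \<and> 0 < C \<and> (\<forall>x. ennreal (c * norm x) \<le> N x \<and> N x \<le> ennreal (C * norm x)))"

definition rotund :: "('h::separable_infinite_hilbert bop \<Rightarrow> ennreal) \<Rightarrow> bool" where
  "rotund N \<longleftrightarrow> (\<forall>x\<in>norm_ideal N. \<forall>y\<in>norm_ideal N. x \<noteq> 0 \<longrightarrow> y \<noteq> 0 \<longrightarrow>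
     N (x + y) = N x + N y \<longrightarrow> (\<exists>c. x = c *\<^sub>C y))"

definition unitaries :: "('h::separable_infinite_hilbert bop \<Rightarrow> ennreal) \<Rightarrow> 'h bop set" where
  "unitaries N = {u. unitary u \<and> u - 1 \<in> norm_ideal N}"

text \<open>
  Derivative of an operator valued curve with respect to \<open>N\<close>.  If \<open>\<gamma>\<close> takes values in
  \<^term>\<open>unitaries N\<close>, then its increments, and hence its derivatives, lie in \<^term>\<open>norm_ideal N\<close>.
\<close>
definition has_deriv_wrt ::
    "('h::separable_infinite_hilbert bop \<Rightarrow> ennreal) \<Rightarrow> (real \<Rightarrow> 'h bop) \<Rightarrow> 'h bop \<Rightarrow>
     real \<Rightarrow> real set \<Rightarrow> bool" where
  "has_deriv_wrt N \<gamma> D t A \<longleftrightarrow>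
     ((\<lambda>s. N ((1 / (s - t)) *\<^sub>R (\<gamma> s - \<gamma> t) - D)) \<longlongrightarrow> 0) (at t within A)"

definition has_C1_deriv_on ::
    "('h::separable_infinite_hilbert bop \<Rightarrow> ennreal) \<Rightarrow> (real \<Rightarrow> 'h bop) \<Rightarrow> (real \<Rightarrow> 'h bop) \<Rightarrow>
     real set \<Rightarrow> bool" where
  "has_C1_deriv_on N \<gamma> \<gamma>' A \<longleftrightarrow>
     (\<forall>t\<in>A. has_deriv_wrt N \<gamma> (\<gamma>' t) t A \<and> ((\<lambda>s. N (\<gamma>' s - \<gamma>' t)) \<longlongrightarrow> 0) (at t within A))"

definition C1_on ::
    "('h::separable_infinite_hilbert bop \<Rightarrow> ennreal) \<Rightarrow> (real \<Rightarrow> 'h bop) \<Rightarrow> real set \<Rightarrow> bool" where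
  "C1_on N \<gamma> A \<longleftrightarrow> (\<exists>\<gamma>'. has_C1_deriv_on N \<gamma> \<gamma>' A)"

definition smooth_on ::
    "('h::separable_infinite_hilbert bop \<Rightarrow> ennreal) \<Rightarrow> (real \<Rightarrow> 'h bop) \<Rightarrow> real set \<Rightarrow> bool" where
  "smooth_on N \<gamma> A \<longleftrightarrow> (\<exists>\<gamma>'. has_C1_deriv_on N \<gamma> \<gamma>' A \<and> (\<forall>t\<in>A. \<gamma>' t \<noteq> 0))"

text \<open>
  \<open>P\<close> holds on each of the closed intervals of a partition of \<open>[0,1]\<close>.  For \<^const>\<open>C1_on\<close> the
  closed intervals (with one-sided derivatives at the break points) make the curve continuous.
\<close>
definition piecewise :: "(real set \<Rightarrow> bool) \<Rightarrow> bool" where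
  "piecewise P \<longleftrightarrow> (\<exists>(n::nat) \<tau>. \<tau> 0 = 0 \<and> \<tau> n = 1 \<and>
     (\<forall>i<n. \<tau> i < \<tau> (Suc i) \<and> P {\<tau> i..\<tau> (Suc i)}))"

definition piecewise_C1_curves ::
    "('h::separable_infinite_hilbert bop \<Rightarrow> ennreal) \<Rightarrow> 'h bop \<Rightarrow> 'h bop \<Rightarrow> (real \<Rightarrow> 'h bop) set" where
  "piecewise_C1_curves N u v = {\<gamma>. (\<forall>t\<in>{0..1}. \<gamma> t \<in> unitaries N) \<and> \<gamma> 0 = u \<and> \<gamma> 1 = v \<and>
     piecewise (C1_on N \<gamma>)}"

definition piecewise_smooth_curves ::
    "('h::separable_infinite_hilbert bop \<Rightarrow> ennreal) \<Rightarrow> 'h bop \<Rightarrow> 'h bop \<Rightarrow> (real \<Rightarrow> 'h bop) set" where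
  "piecewise_smooth_curves N u v = {\<gamma>. (\<forall>t\<in>{0..1}. \<gamma> t \<in> unitaries N) \<and> \<gamma> 0 = u \<and> \<gamma> 1 = v \<and>
     piecewise (smooth_on N \<gamma>)}"

text \<open>At the finitely many break points of a piecewise $C^1$ curve the derivative may fail to exist; the
  value chosen there does not affect the length.\<close>
definition velocity ::
    "('h::separable_infinite_hilbert bop \<Rightarrow> ennreal) \<Rightarrow> (real \<Rightarrow> 'h bop) \<Rightarrow> real \<Rightarrow> 'h bop" where
  "velocity N \<gamma> t = (THE D. has_deriv_wrt N \<gamma> D t {0..1})"

definition curve_length ::
    "('h::separable_infinite_hilbert bop \<Rightarrow> ennreal) \<Rightarrow> (real \<Rightarrow> 'h bop) \<Rightarrow> ennreal" where
  "curve_length N \<gamma> = (\<integral>\<^sup>+t\<in>{0..1}. N (velocity N \<gamma> t) \<partial>lborel)"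

definition curve_dist ::
    "('h::separable_infinite_hilbert bop \<Rightarrow> ennreal) \<Rightarrow> 'h bop \<Rightarrow> 'h bop \<Rightarrow> ennreal" where
  "curve_dist N u v = (INF \<gamma>\<in>piecewise_smooth_curves N u v. curve_length N \<gamma>)"

end

theory Submission
  imports Defs
begin

text \<open>
  After a translation the curve \<open>\<gamma>\<close> starts at 1; write \<open>\<gamma>' = \<i> \<gamma> a\<close> with \<open>a t\<close> compact and Hermitian.
  For a Taylor polynomial \<open>P\<close> of \<open>arcsin\<close>, the function \<open>P 1 - P (cos \<theta>)\<close> approximates \<open>\<bar>\<theta>\<bar>\<close> and is
  1-Lipschitz.  Since it is a polynomial in \<open>cos \<theta>\<close>, it can be applied to the unitary \<open>\<gamma> t\<close> without any
  functional calculus, and the sum of its \<open>k\<close> largest eigenvalues at \<open>\<gamma> t\<close> grows at most at the rate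
  given by the sum of the \<open>k\<close> largest singular values of \<open>a t\<close>: at a fixed \<open>t\<close> the eigenvectors of \<open>\<gamma> t\<close>
  give a lower bound at all other times, so no differentiability of eigenvalues is needed, and it does
  not matter whether the spectrum of \<open>\<gamma> t\<close> meets \<open>-1\<close>.  Hence the singular values of \<open>z\<close> are weakly
  majorized by \<open>\<integral> s\<^sub>j (a t) dt\<close>, and \<open>N z \<le> \<integral> N (a t) dt\<close> by duality for the gauge function.

  If equality holds, rotundity applied to diagonal operators forces the integrals of \<open>s\<^sub>j (a)\<close> over \<open>[0, t]\<close>
  to be \<open>r t * s\<^sub>j (z)\<close>, where \<open>r t\<close> is the normalized length of \<open>\<gamma>\<close> on \<open>[0, t]\<close>.  By induction on \<open>j\<close>, the curve
  \<open>\<gamma> t e\<^sub>j\<close> on the unit sphere (with \<open>e\<^sub>j\<close> the eigenvectors of \<open>z\<close>) then has the length of the great circle arc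
  between its end points, so it is that arc.
\<close>

text \<open>Singular values are integrated index by index, and the results are placed on the
  diagonal of one fixed orthonormal family. Duality and rotundity are thus applied to sequences of
  numbers only; no integral of operators and no measurable choice of eigenvectors occurs. Rotundity
  by itself yields proportionality. That the factor between the integrated singular values and those
  of \<open>z\<close> is 1 comes from weak majorization, which makes the sum of the two sequences at
  least as large in norm as twice the smaller one. The induction over the eigenvectors works because
  knowing the motion of the earlier ones makes them eigenvectors of \<open>a t\<close> that use up
  its largest singular values; a vector orthogonal to them then moves no faster than the next
  singular value. The bound \<open>pi\<close> enters twice: it gives arccos (cos l) = |l| for the
  eigenvalues l of \<open>z\<close>, and it makes the great circle arc between the end points
  unique. For z = 0 the geodesic is constant, hence not smooth, and the distance 0 arises as an
  infimum over short loops.\<close>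

section \<open>Inner product and norm\<close>

lemma cinner_zero_left [simp]: "cinner 0 y = 0"
  using cinner_add_left[of 0 0 y] by simp
lemma cinner_zero_right [simp]: "cinner y 0 = 0"
  using cinner_commute[of y 0] by simp
lemma cinner_add_right: "cinner x (y + w) = cinner x y + cinner x w"
  by (metis cinner_commute cinner_add_left complex_cnj_add)
lemma cinner_scaleC_right: "cinner x (a *\<^sub>C y) = cnj a * cinner x y"
  by (metis cinner_commute cinner_scaleC_left complex_cnj_mult)
lemma cinner_minus_left: "cinner (- x) y = - cinner x y"
  using cinner_add_left[of x "-x" y] by (simp add: eq_neg_iff_add_eq_0 add.commute)
lemma cinner_minus_right: "cinner x (- y) = - cinner x y"
  by (metis cinner_commute cinner_minus_left complex_cnj_minus)
lemma cinner_diff_left: "cinner (x - y) w = cinner x w - cinner y w"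
  using cinner_add_left[of x "-y" w] by (simp add: cinner_minus_left)
lemma cinner_diff_right: "cinner w (x - y) = cinner w x - cinner w y"
  using cinner_add_right[of w x "-y"] by (simp add: cinner_minus_right)
lemma cinner_sum_left: "cinner (\<Sum>i\<in>I. f i) y = (\<Sum>i\<in>I. cinner (f i) y)"
  by (induction I rule: infinite_finite_induct) (simp_all add: cinner_add_left)
lemma cinner_sum_right: "cinner y (\<Sum>i\<in>I. f i) = (\<Sum>i\<in>I. cinner y (f i))"
  by (induction I rule: infinite_finite_induct) (simp_all add: cinner_add_right)
lemma cinner_scaleR_left: "cinner (r *\<^sub>R x) y = of_real r * cinner x y"
  by (simp add: scaleC_of_real[symmetric] cinner_scaleC_left)
lemma cinner_scaleR_right: "cinner y (r *\<^sub>R x) = of_real r * cinner y x"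
  by (simp add: scaleC_of_real[symmetric] cinner_scaleC_right)

lemmas cinner_simps = cinner_add_left cinner_add_right cinner_diff_left cinner_diff_right
  cinner_minus_left cinner_minus_right cinner_scaleC_left cinner_scaleC_right
  cinner_scaleR_left cinner_scaleR_right

lemma cinner_eq_0_commute: "cinner x y = 0 \<longleftrightarrow> cinner y x = 0"
  by (metis cinner_commute complex_cnj_zero)

lemma cmod_cinner_commute: "cmod (cinner x y) = cmod (cinner y x)"
  by (metis cinner_commute complex_mod_cnj)

lemma complex_mult_cnj_cmod: "z * cnj z = complex_of_real ((cmod z)\<^sup>2)"
  by (rule complex_norm_square[symmetric])

lemma norm_scaleC: "norm (c *\<^sub>C (x::'a::complex_hilbert)) = cmod c * norm x"
proof -
  have "complex_of_real ((norm (c *\<^sub>C x))\<^sup>2) = complex_of_real ((cmod c * norm x)\<^sup>2)"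
    by (simp only: cinner_self[symmetric] cinner_scaleC_left cinner_scaleC_right mult.assoc[symmetric]
        complex_mult_cnj_cmod) (simp add: cinner_self power_mult_distrib complex_norm_square[of c, simplified] mult.commute)
  then show ?thesis
    using of_real_eq_iff power2_eq_iff_nonneg by (metis mult_nonneg_nonneg norm_ge_zero)
qed

lemma norm_eq_Re_cinner: "(norm x)\<^sup>2 = Re (cinner x x)"
  by (simp only: cinner_self) simp

lemma Cauchy_Schwarz: "cmod (cinner x y) \<le> norm x * norm (y::'a::complex_hilbert)"
proof (cases "y = 0")
  case False
  define n where "n = (norm y)\<^sup>2"
  have n: "n > 0" using False by (simp add: n_def)
  define c where "c = cinner x y / of_real n"
  have yy: "cinner y y = of_real n" by (simp add: cinner_self n_def)
  have "cinner (x - c *\<^sub>C y) (x - c *\<^sub>C y) =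
      cinner x x - cnj c * cinner x y - c * cinner y x + c * cnj c * of_real n"
    by (simp add: cinner_simps yy algebra_simps)
  also have "c * cnj c * of_real n = c * cinner y x"
    using n by (simp add: c_def cinner_commute[of y x])
  finally have "cinner (x - c *\<^sub>C y) (x - c *\<^sub>C y) = cinner x x - cnj c * cinner x y" by simp
  also have "cnj c * cinner x y = of_real ((cmod (cinner x y))\<^sup>2 / n)"
    using complex_norm_square[of "cinner x y"] by (simp add: c_def mult.commute)
  finally have "(norm (x - c *\<^sub>C y))\<^sup>2 = (norm x)\<^sup>2 - (cmod (cinner x y))\<^sup>2 / n"
    by (metis cinner_self of_real_diff of_real_eq_iff)
  then have "(cmod (cinner x y))\<^sup>2 / n \<le> (norm x)\<^sup>2"
    using zero_le_power2[of "norm (x - c *\<^sub>C y)"] by linarith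
  then have "(cmod (cinner x y))\<^sup>2 \<le> (norm x * norm y)\<^sup>2"
    using n by (simp add: n_def field_simps power_mult_distrib)
  then show ?thesis by (rule power2_le_imp_le) simp
qed simp

lemma bounded_linear_cinner_left: "bounded_linear (\<lambda>x. cinner x (y::'a::complex_hilbert))"
  by (rule bounded_linear_intro[where K="norm y"])
    (simp_all add: cinner_simps scaleR_conv_of_real Cauchy_Schwarz)
lemma bounded_linear_cinner_right: "bounded_linear (\<lambda>x. cinner (y::'a::complex_hilbert) x)"
  by (rule bounded_linear_intro[where K="norm y"])
    (simp_all add: cinner_simps scaleR_conv_of_real mult.commute[of _ "norm y"] Cauchy_Schwarz)

lemma bounded_bilinear_cinner: "bounded_bilinear (cinner :: 'a::complex_hilbert \<Rightarrow> 'a \<Rightarrow> complex)"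
  by unfold_locales
    (auto simp: cinner_simps scaleR_conv_of_real intro!: exI[of _ 1] Cauchy_Schwarz)

lemma bounded_linear_scaleC_left: "bounded_linear (\<lambda>c. c *\<^sub>C (w::'a::complex_hilbert))"
  by (rule bounded_linear_intro[where K="norm w"])
    (simp_all add: scaleC_add_left norm_scaleC scaleC_of_real[symmetric] scaleC_scaleC scaleR_conv_of_real)

subsection \<open>Orthogonal families and Bessel's inequality\<close>

definition orthonormal_on :: "'i set \<Rightarrow> ('i \<Rightarrow> 'a::complex_hilbert) \<Rightarrow> bool" where
  "orthonormal_on I e \<longleftrightarrow> (\<forall>i\<in>I. \<forall>j\<in>I. cinner (e i) (e j) = (if i = j then 1 else 0))"

definition suborthonormal_on :: "'i set \<Rightarrow> ('i \<Rightarrow> 'a::complex_hilbert) \<Rightarrow> bool" where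
  "suborthonormal_on I e \<longleftrightarrow>
     (\<forall>i\<in>I. norm (e i) \<le> 1) \<and> (\<forall>i\<in>I. \<forall>j\<in>I. i \<noteq> j \<longrightarrow> cinner (e i) (e j) = 0)"

lemma orthonormal_on_subset: "orthonormal_on I e \<Longrightarrow> J \<subseteq> I \<Longrightarrow> orthonormal_on J e"
  unfolding orthonormal_on_def by blast

lemma orthonormal_on_norm: "orthonormal_on I e \<Longrightarrow> i \<in> I \<Longrightarrow> norm (e i) = 1"
  using norm_eq_Re_cinner[of "e i"] by (simp add: orthonormal_on_def power2_eq_1_iff)
    (smt (verit) norm_ge_zero)

lemma orthonormal_on_imp_suborthonormal_on: "orthonormal_on I e \<Longrightarrow> suborthonormal_on I e"
  using orthonormal_on_norm[of I e] by (force simp: orthonormal_on_def suborthonormal_on_def)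

lemma norm_sum_orthogonal:
  assumes "finite I" "\<And>i j. i \<in> I \<Longrightarrow> j \<in> I \<Longrightarrow> i \<noteq> j \<Longrightarrow> cinner (h i) (h j) = 0"
  shows "(norm (\<Sum>i\<in>I. c i *\<^sub>C h i))\<^sup>2 = (\<Sum>i\<in>I. (cmod (c i))\<^sup>2 * (norm (h i))\<^sup>2)"
proof -
  have "cinner (\<Sum>i\<in>I. c i *\<^sub>C h i) (\<Sum>i\<in>I. c i *\<^sub>C h i)
      = (\<Sum>i\<in>I. \<Sum>j\<in>I. c i * cnj (c j) * cinner (h i) (h j))"
    by (simp add: cinner_sum_left cinner_sum_right cinner_simps mult.assoc)
       (simp add: sum_distrib_left mult.left_commute, rule sum.swap)
  also have "\<dots> = (\<Sum>i\<in>I. \<Sum>j\<in>I. if j = i then c i * cnj (c i) * cinner (h i) (h i) else 0)"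
    using assms(2) by (intro sum.cong refl) auto
  also have "\<dots> = (\<Sum>i\<in>I. c i * cnj (c i) * cinner (h i) (h i))"
    using assms(1) by simp
  also have "\<dots> = of_real (\<Sum>i\<in>I. (cmod (c i))\<^sup>2 * (norm (h i))\<^sup>2)"
    by (simp add: cinner_self complex_mult_cnj_cmod)
  finally show ?thesis by (metis cinner_self of_real_eq_iff)
qed

text \<open>For w = sum of <v, h i> h i one has <v, w> = T, and norm w squared is at most T because
  the \<open>h i\<close> have norm at most 1. Cauchy-Schwarz then bounds T squared by norm v squared
  times T.\<close>

lemma Bessel:
  assumes "finite I" "suborthonormal_on I h"
  shows "(\<Sum>i\<in>I. (cmod (cinner v (h i)))\<^sup>2) \<le> (norm v)\<^sup>2"
proof -
  define w where "w = (\<Sum>i\<in>I. cinner v (h i) *\<^sub>C h i)"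
  define T where "T = (\<Sum>i\<in>I. (cmod (cinner v (h i)))\<^sup>2)"
  have T0: "T \<ge> 0" by (simp add: T_def sum_nonneg)
  have "(norm w)\<^sup>2 = (\<Sum>i\<in>I. (cmod (cinner v (h i)))\<^sup>2 * (norm (h i))\<^sup>2)"
    unfolding w_def using assms by (intro norm_sum_orthogonal) (auto simp: suborthonormal_on_def)
  also have "\<dots> \<le> T" unfolding T_def
    using assms(2) by (intro sum_mono) (auto simp: suborthonormal_on_def intro!: mult_left_le power_le_one)
  finally have wT: "(norm w)\<^sup>2 \<le> T" .
  have "cinner v w = of_real T"
    by (simp add: w_def T_def cinner_sum_right cinner_simps complex_mult_cnj_cmod mult.commute[of "cnj _"])
  then have "T \<le> norm v * norm w"
    using Cauchy_Schwarz[of v w] T0 by simp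
  then have "T\<^sup>2 \<le> (norm v * norm w)\<^sup>2" using T0 by (rule power_mono)
  also have "\<dots> \<le> (norm v)\<^sup>2 * T" using wT by (simp add: power_mult_distrib mult_left_mono)
  finally have "T * T \<le> (norm v)\<^sup>2 * T" by (simp add: power2_eq_square)
  then show ?thesis using T0 unfolding T_def[symmetric]
    by (metis mult_le_cancel_right_pos order_le_less zero_le_power2)
qed

lemma orthonormal_series_summable:
  fixes e :: "nat \<Rightarrow> 'a::complex_hilbert"
  assumes e: "orthonormal_on UNIV e" and s: "summable (\<lambda>n. (cmod (c n))\<^sup>2)"
  shows "summable (\<lambda>n. c n *\<^sub>C e n)"
  unfolding summable_Cauchy
proof (intro allI impI)
  fix \<epsilon> :: real assume \<epsilon>: "0 < \<epsilon>"
  obtain M where M: "\<And>m n. m \<ge> M \<Longrightarrow> norm (\<Sum>k=m..<n. (cmod (c k))\<^sup>2) < \<epsilon>\<^sup>2"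
    using s \<epsilon> unfolding summable_Cauchy by (meson zero_less_power)
  have "norm (\<Sum>k=m..<n. c k *\<^sub>C e k) < \<epsilon>" if "m \<ge> M" for m n
  proof -
    have "(norm (\<Sum>k=m..<n. c k *\<^sub>C e k))\<^sup>2 = (\<Sum>k=m..<n. (cmod (c k))\<^sup>2 * (norm (e k))\<^sup>2)"
      using e by (intro norm_sum_orthogonal) (auto simp: orthonormal_on_def)
    also have "\<dots> = (\<Sum>k=m..<n. (cmod (c k))\<^sup>2)"
      using orthonormal_on_norm[OF e] by simp
    also have "\<dots> < \<epsilon>\<^sup>2" using M[OF that, of n] by simp
    finally show ?thesis using \<epsilon> by (simp add: power_less_imp_less_base)
  qed
  then show "\<exists>M. \<forall>m\<ge>M. \<forall>n. norm (\<Sum>k=m..<n. c k *\<^sub>C e k) < \<epsilon>" by blast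
qed

lemma Bessel_summable:
  fixes e :: "nat \<Rightarrow> 'a::complex_hilbert"
  assumes e: "orthonormal_on UNIV e"
  shows "summable (\<lambda>n. (cmod (cinner v (e n)))\<^sup>2)"
proof (rule bounded_imp_summable)
  show "(\<Sum>k\<le>n. (cmod (cinner v (e k)))\<^sup>2) \<le> (norm v)\<^sup>2" for n
    by (intro Bessel orthonormal_on_imp_suborthonormal_on orthonormal_on_subset[OF e]) auto
qed simp

lemma cinner_suminf_orthonormal:
  fixes e :: "nat \<Rightarrow> 'a::complex_hilbert"
  assumes e: "orthonormal_on UNIV e" and s: "summable (\<lambda>n. c n *\<^sub>C e n)"
  shows "cinner (\<Sum>n. c n *\<^sub>C e n) (e m) = c m"
proof -
  have "cinner (\<Sum>n. c n *\<^sub>C e n) (e m) = (\<Sum>n. cinner (c n *\<^sub>C e n) (e m))"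
    by (rule bounded_linear.suminf[OF bounded_linear_cinner_left s])
  also have "\<dots> = (\<Sum>n. if n = m then c m else 0)"
    using e by (intro suminf_cong) (simp add: orthonormal_on_def cinner_simps)
  also have "\<dots> = c m" using suminf_finite[of "{m}" "\<lambda>n. if n = m then c m else 0"] by simp
  finally show ?thesis .
qed

text \<open>Takes the place of the orthogonal projection onto the closed span of \<open>e\<close>:
  the series of Fourier terms converges by Bessel, and \<open>w\<close> is the remainder.\<close>

lemma orthonormal_decomposition:
  fixes e :: "nat \<Rightarrow> 'a::complex_hilbert"
  assumes e: "orthonormal_on UNIV e"
  obtains w where "(\<lambda>n. cinner v (e n) *\<^sub>C e n) sums (v - w)" "\<And>n. cinner w (e n) = 0"
proof -
  let ?s = "\<Sum>n. cinner v (e n) *\<^sub>C e n"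
  have s: "summable (\<lambda>n. cinner v (e n) *\<^sub>C e n)"
    by (intro orthonormal_series_summable e Bessel_summable)
  have "cinner (v - ?s) (e n) = 0" for n
    by (simp add: cinner_diff_left cinner_suminf_orthonormal[OF e s])
  moreover have "(\<lambda>n. cinner v (e n) *\<^sub>C e n) sums (v - (v - ?s))"
    using s by (simp add: summable_sums)
  ultimately show ?thesis using that by blast
qed

subsection \<open>Orthonormal bases\<close>

definition orthonormal_basis :: "(nat \<Rightarrow> 'a::complex_hilbert) \<Rightarrow> bool" where
  "orthonormal_basis b \<longleftrightarrow> orthonormal_on UNIV b \<and> (\<forall>v. (\<forall>n. cinner v (b n) = 0) \<longrightarrow> v = 0)"

lemma finite_projection_orthogonal:
  fixes F :: "'a::complex_hilbert set"
  assumes "finite F" "orthonormal_on F id" "f \<in> F"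
  shows "cinner (v - (\<Sum>b\<in>F. cinner v b *\<^sub>C b)) f = 0"
proof -
  have "cinner (\<Sum>b\<in>F. cinner v b *\<^sub>C b) f = (\<Sum>b\<in>F. if b = f then cinner v f else 0)"
    unfolding cinner_sum_left using assms by (intro sum.cong refl) (auto simp: cinner_simps orthonormal_on_def)
  then show ?thesis using assms by (simp add: cinner_diff_left)
qed

lemma orthonormal_dist:
  assumes "orthonormal_on F id" "f \<in> F" "g \<in> F" "f \<noteq> g"
  shows "dist f g > 1"
proof -
  have "(norm (f - g))\<^sup>2 = 2"
    using assms by (simp add: norm_eq_Re_cinner cinner_simps orthonormal_on_def)
  then show ?thesis
    by (smt (verit, best) dist_norm norm_ge_zero one_power2 power_mono)
qed

text \<open>A maximal orthonormal set exists by Zorn's lemma. Its members have mutual distance above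
  1, so approximating each within 1/2 by a countable dense set is injective and the set is
  countable; infinite dimension makes it infinite. The basis is needed to construct
  adjoints.\<close>

lemma exists_orthonormal_basis:
  obtains b :: "nat \<Rightarrow> 'a::separable_infinite_hilbert" where "orthonormal_basis b"
proof -
  have "\<exists>M\<in>{F :: 'a set. orthonormal_on F id}. \<forall>X\<in>{F. orthonormal_on F id}. M \<subseteq> X \<longrightarrow> X = M"
  proof (rule subset_Zorn')
    fix \<C> assume "subset.chain {F :: 'a set. orthonormal_on F id} \<C>"
    then have sub: "\<And>F. F \<in> \<C> \<Longrightarrow> orthonormal_on F id" and ch: "\<And>F G. F \<in> \<C> \<Longrightarrow> G \<in> \<C> \<Longrightarrow> F \<subseteq> G \<or> G \<subseteq> F"
      by (auto simp: subset_chain_def)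
    have "orthonormal_on (\<Union>\<C>) id" unfolding orthonormal_on_def
    proof (intro ballI)
      fix i j assume "i \<in> \<Union>\<C>" "j \<in> \<Union>\<C>"
      then obtain F where "F \<in> \<C>" "i \<in> F" "j \<in> F" using ch by blast
      then show "cinner (id i) (id j) = (if i = j then 1 else 0)"
        using sub[of F] by (auto simp: orthonormal_on_def)
    qed
    then show "\<Union>\<C> \<in> {F. orthonormal_on F id}" by simp
  qed
  then obtain M :: "'a set" where M: "orthonormal_on M id"
    and max: "\<And>X. orthonormal_on X id \<Longrightarrow> M \<subseteq> X \<Longrightarrow> X = M" by auto
  have comp: "v = 0" if v: "\<And>b. b \<in> M \<Longrightarrow> cinner v b = 0" for v
  proof (rule ccontr)
    assume "v \<noteq> 0"
    define w where "w = complex_of_real (1 / norm v) *\<^sub>C v"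
    have ww: "cinner w w = 1" using \<open>v \<noteq> 0\<close>
      by (simp only: cinner_self w_def norm_scaleC) (simp add: norm_divide)
    have wM: "cinner w b = 0" "cinner b w = 0" if "b \<in> M" for b
      using v[OF that] by (simp_all add: w_def cinner_simps cinner_commute[of b v])
    have "orthonormal_on (insert w M) id"
      using M ww wM by (auto simp: orthonormal_on_def)
    then have "w \<in> M" using max by blast
    then show False using wM(1) ww by auto
  qed
  obtain D :: "'a set" where D: "countable D" "\<And>x e. e > 0 \<Longrightarrow> \<exists>d\<in>D. dist d x < e"
    using separable by blast
  obtain g where g: "\<And>x. g x \<in> D" "\<And>x. dist (g x) x < 1/2"
    using D(2)[of "1/2"] by (metis zero_less_divide_1_iff zero_less_numeral)
  have "inj_on g M"
  proof (rule inj_onI, rule ccontr)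
    fix x y assume "x \<in> M" "y \<in> M" "g x = g y" "x \<noteq> y"
    then show False using orthonormal_dist[OF M, of x y] g(2)[of x] g(2)[of y]
        dist_triangle3[of x y "g x"] by auto
  qed
  moreover have "countable (g ` M)"
    using D(1) g(1) by (meson countable_subset image_subsetI)
  ultimately have cM: "countable M"
    by (metis countable_image_inj_on)
  have iM: "infinite M"
  proof
    assume f: "finite M"
    obtain x :: 'a where x: "\<And>c. x \<noteq> (\<Sum>b\<in>M. c b *\<^sub>C b)"
      using infinite_dimensional[OF f] by blast
    have "x - (\<Sum>b\<in>M. cinner x b *\<^sub>C b) = 0"
      by (intro comp finite_projection_orthogonal f M)
    then show False using x by auto
  qed
  let ?b = "from_nat_into M"
  have bij: "bij_betw ?b UNIV M" using cM iM by (rule bij_betw_from_nat_into)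
  have "orthonormal_on UNIV ?b"
    using M bij_betwE[OF bij] bij_betw_imp_inj_on[OF bij] by (simp add: orthonormal_on_def inj_eq)
  moreover have "v = 0" if "\<forall>n. cinner v (?b n) = 0" for v
  proof (rule comp)
    fix b assume "b \<in> M"
    then obtain n where "b = ?b n" using bij by (metis bij_betw_imp_surj_on imageE)
    then show "cinner v b = 0" using that by simp
  qed
  ultimately show ?thesis using that by (auto simp: orthonormal_basis_def)
qed

lemma orthonormal_basis_sums:
  assumes "orthonormal_basis b"
  shows "(\<lambda>n. cinner v (b n) *\<^sub>C b n) sums v"
proof -
  obtain w where "(\<lambda>n. cinner v (b n) *\<^sub>C b n) sums (v - w)" "\<And>n. cinner w (b n) = 0"
    using assms orthonormal_decomposition[of b v] unfolding orthonormal_basis_def by blast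
  moreover from this(2) have "w = 0" using assms by (auto simp: orthonormal_basis_def)
  ultimately show ?thesis by simp
qed

subsection \<open>Bounded operators and adjoints\<close>

lemma bounded_linear_bop_apply: "bounded_linear (bop_apply x)"
  by transfer (rule blinfun.bounded_linear_right)

lemma norm_bop_apply: "norm (x \<cdot> v) \<le> norm x * norm v"
  by transfer (rule norm_blinfun)

lemma bop_apply_add: "x \<cdot> (v + w) = x \<cdot> v + x \<cdot> w"
  by transfer (rule blinfun.add_right)
lemma bop_apply_diff: "x \<cdot> (v - w) = x \<cdot> v - x \<cdot> w"
  by transfer (rule blinfun.diff_right)
lemma bop_apply_minus: "x \<cdot> (- v) = - (x \<cdot> v)"
  by transfer (rule blinfun.minus_right)
lemma bop_apply_zero [simp]: "x \<cdot> 0 = 0"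
  by transfer (rule blinfun.zero_right)
lemma bop_apply_scaleC: "x \<cdot> (c *\<^sub>C v) = c *\<^sub>C (x \<cdot> v)"
  by transfer simp
lemma bop_apply_scaleR: "x \<cdot> (r *\<^sub>R v) = r *\<^sub>R (x \<cdot> v)"
  by transfer (rule blinfun.scaleR_right)
lemma bop_apply_sum: "x \<cdot> (\<Sum>i\<in>I. f i) = (\<Sum>i\<in>I. x \<cdot> f i)"
  by (induction I rule: infinite_finite_induct) (simp_all add: bop_apply_add)
lemma plus_bop_apply: "(x + y) \<cdot> v = x \<cdot> v + y \<cdot> v"
  by transfer (simp add: blinfun.add_left)
lemma minus_bop_apply: "(x - y) \<cdot> v = x \<cdot> v - y \<cdot> v"
  by transfer (simp add: blinfun.diff_left)
lemma uminus_bop_apply: "(- x) \<cdot> v = - (x \<cdot> v)"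
  by transfer (simp add: blinfun.minus_left)
lemma zero_bop_apply [simp]: "0 \<cdot> v = 0"
  by transfer simp
lemma scaleR_bop_apply: "(r *\<^sub>R x) \<cdot> v = r *\<^sub>R (x \<cdot> v)"
  by transfer (simp add: blinfun.scaleR_left)
lemmas bop_simps = bop_apply_add bop_apply_diff bop_apply_scaleC bop_apply_scaleR plus_bop_apply
  minus_bop_apply uminus_bop_apply scaleR_bop_apply scaleC_bop_apply times_bop_apply one_bop_apply

lemma bounded_linear_eval: "bounded_linear (\<lambda>x. x \<cdot> v)"
  by (rule bounded_linear_intro[where K="norm v"])
    (simp_all add: bop_simps norm_bop_apply)

lemma norm_bop_bound: "0 \<le> B \<Longrightarrow> (\<And>v. norm (x \<cdot> v) \<le> B * norm v) \<Longrightarrow> norm x \<le> B"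
  by transfer (rule norm_blinfun_bound)

lemma exists_bop:
  fixes f :: "'a::complex_hilbert \<Rightarrow> 'a"
  assumes "\<And>v w. f (v + w) = f v + f w" "\<And>c v. f (c *\<^sub>C v) = c *\<^sub>C f v" "\<And>v. norm (f v) \<le> B * norm v"
  obtains x where "\<And>v. x \<cdot> v = f v"
proof -
  have bl: "bounded_linear f"
    by (rule bounded_linear_intro[where K=B])
      (use assms in \<open>auto simp: scaleC_of_real[symmetric] mult.commute\<close>)
  have "Bop (Blinfun f) \<cdot> v = f v" for v
    by (simp add: bop_apply.rep_eq Bop_inverse bounded_linear_Blinfun_apply[OF bl] assms(2))
  then show ?thesis using that by blast
qed

lemma scaleC_zero_bop: "c *\<^sub>C (0::'a::complex_hilbert bop) = 0"
  by (rule bop_eqI) (simp add: scaleC_bop_apply complex_vector.scale_zero_right)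

lemma cinner_ext: "(\<And>w. cinner x w = cinner y w) \<Longrightarrow> x = (y::'a::complex_hilbert)"
proof -
  assume "\<And>w. cinner x w = cinner y w"
  then have "cinner (x - y) (x - y) = 0" by (simp add: cinner_diff_left)
  then show ?thesis by (simp add: cinner_self)
qed

text \<open>The adjoint at \<open>w\<close> is the series of <w, x b n> b n. Its coefficients are
  square summable: for a partial sum p, with T the sum of squared moduli, <w, x p> = T while norm p
  squared is T, so T is bounded by the square of norm x times norm w.\<close>

lemma exists_adj:
  fixes x :: "'a::separable_infinite_hilbert bop"
  obtains y where "\<And>v w. cinner (x \<cdot> v) w = cinner v (y \<cdot> w)"
proof -
  obtain b :: "nat \<Rightarrow> 'a" where b: "orthonormal_basis b" by (rule exists_orthonormal_basis)
  then have on: "orthonormal_on UNIV b" by (simp add: orthonormal_basis_def)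
  define f where "f w = (\<Sum>n. cinner w (x \<cdot> b n) *\<^sub>C b n)" for w
  have s: "summable (\<lambda>n. cinner w (x \<cdot> b n) *\<^sub>C b n)" for w
  proof (intro orthonormal_series_summable on bounded_imp_summable[where B="(norm x * norm w)\<^sup>2"])
    fix n
    define T where "T = (\<Sum>k\<le>n. (cmod (cinner w (x \<cdot> b k)))\<^sup>2)"
    define p where "p = (\<Sum>k\<le>n. cinner w (x \<cdot> b k) *\<^sub>C b k)"
    have T0: "T \<ge> 0" by (simp add: T_def sum_nonneg)
    have p: "(norm p)\<^sup>2 = T" unfolding p_def T_def
      by (subst norm_sum_orthogonal) (use on orthonormal_on_norm[OF on] in \<open>auto simp: orthonormal_on_def\<close>)
    have "cinner w (x \<cdot> p) = of_real T"
      by (simp add: p_def T_def bop_apply_sum cinner_sum_right cinner_simps bop_simps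
          complex_mult_cnj_cmod mult.commute[of "cnj _"])
    then have "T \<le> norm w * norm (x \<cdot> p)" using Cauchy_Schwarz[of w "x \<cdot> p"] T0 by simp
    also have "\<dots> \<le> norm w * (norm x * norm p)" by (intro mult_left_mono norm_bop_apply) auto
    finally have "T\<^sup>2 \<le> (norm x * norm w * norm p)\<^sup>2" using T0 by (intro power_mono) (simp add: ac_simps)
    then have "T * T \<le> (norm x * norm w)\<^sup>2 * T" using p by (simp add: power2_eq_square[of T] power_mult_distrib)
    then show "(\<Sum>k\<le>n. (cmod (cinner w (x \<cdot> b k)))\<^sup>2) \<le> (norm x * norm w)\<^sup>2"
      using T0 unfolding T_def[symmetric] by (metis mult_le_cancel_right_pos order_le_less zero_le_power2)
  qed simp
  have f: "cinner v (f w) = cinner (x \<cdot> v) w" for v w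
  proof -
    have "(\<lambda>n. cinner v (cinner w (x \<cdot> b n) *\<^sub>C b n)) sums cinner v (f w)"
      unfolding f_def by (rule bounded_linear.sums[OF bounded_linear_cinner_right summable_sums[OF s]])
    moreover have "(\<lambda>n. cinner (x \<cdot> (cinner v (b n) *\<^sub>C b n)) w) sums cinner (x \<cdot> v) w"
      by (intro bounded_linear.sums[OF bounded_linear_cinner_left]
          bounded_linear.sums[OF bounded_linear_bop_apply] orthonormal_basis_sums b)
    ultimately show ?thesis
      by (simp add: cinner_simps bop_simps cinner_commute[of "x \<cdot> b _" w] mult.commute sums_unique2)
  qed
  have ext: "p = q" if "\<And>v. cinner v p = cinner v q" for p q :: 'a
    by (rule cinner_ext) (metis cinner_commute that)
  obtain y where y: "\<And>v. y \<cdot> v = f v"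
  proof (rule exists_bop[of f "norm x"])
    show "f (v + w) = f v + f w" for v w by (rule ext) (simp add: f cinner_simps)
    show "f (c *\<^sub>C v) = c *\<^sub>C f v" for c v by (rule ext) (simp add: f cinner_simps)
    show "norm (f v) \<le> norm x * norm v" for v
    proof -
      have "(norm (f v))\<^sup>2 = cmod (cinner (x \<cdot> f v) v)" 
        by (simp add: f[symmetric] cinner_self norm_power del: of_real_power)
      also have "\<dots> \<le> norm (x \<cdot> f v) * norm v" by (rule Cauchy_Schwarz)
      also have "\<dots> \<le> norm x * norm (f v) * norm v" by (intro mult_right_mono norm_bop_apply) auto
      finally have "norm (f v) * norm (f v) \<le> (norm x * norm v) * norm (f v)" 
        by (simp add: power2_eq_square ac_simps)
      then show ?thesis by (cases "norm (f v) = 0") auto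
    qed
  qed blast
  show ?thesis by (rule that[of y]) (simp add: y f)
qed

lemma cinner_adj_right:
  fixes x :: "'a::separable_infinite_hilbert bop"
  shows "cinner v (adj x \<cdot> w) = cinner (x \<cdot> v) w"
proof -
  obtain y where y: "\<And>v w. cinner (x \<cdot> v) w = cinner v (y \<cdot> w)" using exists_adj[of x] by blast
  have "adj x = y" unfolding adj_def
  proof (rule the_equality)
    show "\<forall>v w. cinner (x \<cdot> v) w = cinner v (y \<cdot> w)" using y by blast
    fix y' assume y': "\<forall>v w. cinner (x \<cdot> v) w = cinner v (y' \<cdot> w)"
    show "y' = y"
      by (rule bop_eqI, rule cinner_ext) (metis y y' cinner_commute)
  qed
  then show ?thesis using y by simp
qed

lemma cinner_adj_left: "cinner (adj x \<cdot> v) w = cinner v ((x::'a::separable_infinite_hilbert bop) \<cdot> w)"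
  by (metis cinner_adj_right cinner_commute)

lemma adj_eqI:
  fixes x :: "'a::separable_infinite_hilbert bop"
  assumes "\<And>v w. cinner (y \<cdot> v) w = cinner v (x \<cdot> w)"
  shows "adj x = y"
  by (rule bop_eqI, rule cinner_ext) (simp add: cinner_adj_left assms)

lemma adj_adj [simp]: "adj (adj x) = (x::'a::separable_infinite_hilbert bop)"
  by (rule adj_eqI) (simp add: cinner_adj_right)
lemma adj_plus: "adj (x + y) = adj x + adj (y::'a::separable_infinite_hilbert bop)"
  by (rule adj_eqI) (simp add: cinner_simps bop_simps cinner_adj_left)
lemma adj_minus: "adj (x - y) = adj x - adj (y::'a::separable_infinite_hilbert bop)"
  by (rule adj_eqI) (simp add: cinner_simps bop_simps cinner_adj_left)
lemma adj_uminus: "adj (- x) = - adj (x::'a::separable_infinite_hilbert bop)"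
  by (rule adj_eqI) (simp add: cinner_simps bop_simps cinner_adj_left)
lemma adj_times: "adj (x * y) = adj y * adj (x::'a::separable_infinite_hilbert bop)"
  by (rule adj_eqI) (simp add: bop_simps cinner_adj_left)
lemma adj_scaleC: "adj (c *\<^sub>C x) = cnj c *\<^sub>C adj (x::'a::separable_infinite_hilbert bop)"
  by (rule adj_eqI) (simp add: cinner_simps bop_simps cinner_adj_left)
lemma adj_scaleR: "adj (r *\<^sub>R x) = r *\<^sub>R adj (x::'a::separable_infinite_hilbert bop)"
  by (rule adj_eqI) (simp add: cinner_simps bop_simps cinner_adj_left)
lemma adj_one [simp]: "adj (1::'a::separable_infinite_hilbert bop) = 1"
  by (rule adj_eqI) (simp add: bop_simps)
lemmas adj_simps = adj_plus adj_minus adj_uminus adj_times adj_scaleC adj_scaleR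

lemma norm_adj: "norm (adj x) = norm (x::'a::separable_infinite_hilbert bop)"
proof -
  have le: "norm (adj x) \<le> norm x" for x :: "'a bop"
  proof (rule norm_bop_bound)
    fix v
    have "(norm (adj x \<cdot> v))\<^sup>2 = cmod (cinner (x \<cdot> adj x \<cdot> v) v)"
      by (simp add: cinner_adj_right[symmetric] cinner_self norm_power del: of_real_power)
    also have "\<dots> \<le> norm (x \<cdot> adj x \<cdot> v) * norm v" by (rule Cauchy_Schwarz)
    also have "\<dots> \<le> norm x * norm (adj x \<cdot> v) * norm v" by (intro mult_right_mono norm_bop_apply) auto
    finally have "norm (adj x \<cdot> v) * norm (adj x \<cdot> v) \<le> (norm x * norm v) * norm (adj x \<cdot> v)"
      by (simp add: power2_eq_square ac_simps)
    then show "norm (adj x \<cdot> v) \<le> norm x * norm v" by (cases "norm (adj x \<cdot> v) = 0") auto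
  qed simp
  from le[of x] le[of "adj x"] show ?thesis by simp
qed

lemma bounded_linear_adj: "bounded_linear (adj :: 'a::separable_infinite_hilbert bop \<Rightarrow> 'a bop)"
  by (rule bounded_linear_intro[where K=1]) (simp_all add: adj_simps norm_adj)

lemma hermitian_cinner:
  "hermitian x \<longleftrightarrow> (\<forall>v w. cinner (x \<cdot> v) w = cinner v ((x::'a::separable_infinite_hilbert bop) \<cdot> w))"
  by (metis adj_eqI cinner_adj_right hermitian_def)

lemma hermitian_cinner_real: "hermitian x \<Longrightarrow> Im (cinner ((x::'a::separable_infinite_hilbert bop) \<cdot> v) v) = 0"
  by (metis cinner_commute hermitian_cinner complex_cnj_cancel_iff Reals_cnj_iff complex_is_Real_iff)

subsection \<open>The spectral theorem for compact Hermitian operators\<close>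

text \<open>Gram-Schmidt, stated through orthogonal complements instead of spans: all later uses
  only need that a vector orthogonal to \<open>E\<close> is orthogonal to \<open>F\<close>.\<close>

lemma finite_orthonormalize:
  fixes F :: "'a::complex_hilbert set"
  assumes "finite F"
  obtains E where "finite E" "orthonormal_on E id"
    "\<And>v f. \<forall>e\<in>E. cinner v e = 0 \<Longrightarrow> f \<in> F \<Longrightarrow> cinner v f = 0"
  using assms
proof (induction F arbitrary: thesis rule: finite_induct)
  case empty
  show ?case by (rule empty[of "{}"]) (auto simp: orthonormal_on_def)
next
  case (insert g F)
  obtain E where E: "finite E" "orthonormal_on E id"
    "\<And>v f. \<forall>e\<in>E. cinner v e = 0 \<Longrightarrow> f \<in> F \<Longrightarrow> cinner v f = 0" using insert.IH by blast
  define p where "p = (\<Sum>b\<in>E. cinner g b *\<^sub>C b)"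
  define w where "w = g - p"
  have vp: "cinner v p = 0" if "\<forall>e\<in>E. cinner v e = 0" for v
    using that by (simp add: p_def cinner_sum_right cinner_simps)
  show ?case
  proof (cases "w = 0")
    case True
    then show ?thesis using E vp by (intro insert.prems[of E]) (auto simp: w_def id_def)
  next
    case False
    define q where "q = complex_of_real (1 / norm w) *\<^sub>C w"
    have qq: "cinner q q = 1" using False
      by (simp only: cinner_self q_def norm_scaleC) (simp add: norm_divide)
    have qe: "cinner q e = 0" "cinner e q = 0" if "e \<in> E" for e
      using finite_projection_orthogonal[OF E(1,2) that, of g]
      by (simp_all add: q_def w_def p_def cinner_simps cinner_commute[of e])
    have gq: "g = p + complex_of_real (norm w) *\<^sub>C q"
      using False by (simp add: q_def scaleC_scaleC w_def)
    show ?thesis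
    proof (rule insert.prems[of "insert q E"])
      show "orthonormal_on (insert q E) id" using E(2) qq qe by (auto simp: orthonormal_on_def)
      fix v f assume "\<forall>e\<in>insert q E. cinner v e = 0" "f \<in> insert g F"
      then show "cinner v f = 0" using E(3)[of v f] vp[of v]
        by (auto simp: cinner_simps) (subst gq, simp add: cinner_simps)
    qed (use E(1) in simp)
  qed
qed

lemma exists_unit_orthogonal:
  assumes "finite (F :: 'a::separable_infinite_hilbert set)"
  obtains v where "norm v = 1" "\<And>f. f \<in> F \<Longrightarrow> cinner v f = 0"
proof -
  obtain E where E: "finite E" "orthonormal_on E id"
    "\<And>v f. \<forall>e\<in>E. cinner v e = 0 \<Longrightarrow> f \<in> F \<Longrightarrow> cinner v f = 0"
    using finite_orthonormalize[OF assms] by blast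
  obtain x :: 'a where x: "\<And>c. x \<noteq> (\<Sum>b\<in>E. c b *\<^sub>C b)"
    using infinite_dimensional[OF E(1)] by blast
  define w where "w = x - (\<Sum>b\<in>E. cinner x b *\<^sub>C b)"
  have "w \<noteq> 0" using x by (auto simp: w_def)
  have "cinner w e = 0" if "e \<in> E" for e
    unfolding w_def by (rule finite_projection_orthogonal[OF E(1,2) that])
  then have "cinner w f = 0" if "f \<in> F" for f using E(3) that by blast
  then show ?thesis using \<open>w \<noteq> 0\<close>
    by (intro that[of "complex_of_real (1 / norm w) *\<^sub>C w"])
       (simp_all only: norm_scaleC cinner_simps, simp_all add: norm_divide)
qed

lemma compact_op_subseq:
  assumes "compact_op x" "\<And>n. norm (v n) \<le> 1"
  obtains r y where "strict_mono (r::nat\<Rightarrow>nat)" "(\<lambda>n. x \<cdot> v (r n)) \<longlonglongrightarrow> y"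
proof -
  have "seq_compact (closure (bop_apply x ` cball 0 1))"
    using assms(1) by (simp add: compact_op_def compact_imp_seq_compact)
  moreover have "\<forall>n. x \<cdot> v n \<in> closure (bop_apply x ` cball 0 1)"
    using assms(2) by (auto intro!: subsetD[OF closure_subset])
  ultimately obtain y r where "strict_mono (r::nat\<Rightarrow>nat)" "((\<lambda>n. x \<cdot> v n) \<circ> r) \<longlonglongrightarrow> y"
    by (rule seq_compactE) auto
  then show ?thesis using that by (simp add: o_def)
qed

text \<open>Take unit vectors f n in K whose images approach the supremum m of norms. Expanding the
  square gives the bound \<open>sq\<close>, because x f n stays in K, so x x f n - m^2 f n tends to
  0. Compactness makes a subsequence of x f n converge, hence also f itself along it, to an
  eigenvector of the square of x for m^2.\<close>

lemma exists_maximal_eigenvector: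
  fixes x :: "'a::separable_infinite_hilbert bop" and F :: "'a set"
  defines "K \<equiv> {v. \<forall>f\<in>F. cinner v f = 0}"
  assumes x: "compact_op x" "hermitian x" and F: "finite F" and K: "\<And>v. v \<in> K \<Longrightarrow> x \<cdot> v \<in> K"
  obtains v l where "v \<in> K" "norm v = 1" "x \<cdot> v = complex_of_real l *\<^sub>C v"
    "\<And>w. w \<in> K \<Longrightarrow> norm (x \<cdot> w) \<le> \<bar>l\<bar> * norm w"
proof -
  have K_scale: "c *\<^sub>C v \<in> K" if "v \<in> K" for c v using that by (simp add: K_def cinner_simps)
  have K_add: "v + w \<in> K" if "v \<in> K" "w \<in> K" for v w using that by (simp add: K_def cinner_simps)
  have K_lim: "y \<in> K" if "\<And>n. f n \<in> K" "f \<longlonglongrightarrow> y" for f :: "nat \<Rightarrow> 'a" and y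
    unfolding K_def
  proof (intro CollectI ballI)
    fix g assume "g \<in> F"
    then have "(\<lambda>n. cinner (f n) g) = (\<lambda>n. 0)" using that(1) by (auto simp: K_def)
    moreover have "(\<lambda>n. cinner (f n) g) \<longlonglongrightarrow> cinner y g"
      by (rule bounded_linear.tendsto[OF bounded_linear_cinner_left that(2)])
    ultimately show "cinner y g = 0" by (metis LIMSEQ_const_iff)
  qed
  define U where "U = {v\<in>K. norm v = 1}"
  obtain v0 :: 'a where v0: "v0 \<in> U"
  proof (rule exists_unit_orthogonal[OF F])
    fix v assume "norm v = 1" "\<And>f. f \<in> F \<Longrightarrow> cinner v f = 0"
    then show thesis by (intro that[of v]) (simp add: U_def K_def)
  qed
  define m where "m = (SUP v\<in>U. norm (x \<cdot> v))"
  have bdd: "bdd_above ((\<lambda>v. norm (x \<cdot> v)) ` U)"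
  proof (rule bdd_aboveI2)
    fix v assume "v \<in> U"
    then show "norm (x \<cdot> v) \<le> norm x" using norm_bop_apply[of x v] by (simp add: U_def)
  qed
  have m_unit: "norm (x \<cdot> v) \<le> m" if "v \<in> U" for v
    unfolding m_def by (rule cSUP_upper[OF that bdd])
  have m0: "m \<ge> 0" using m_unit[OF v0] order_trans[OF norm_ge_zero] by fast
  have mK: "norm (x \<cdot> w) \<le> m * norm w" if "w \<in> K" for w
  proof (cases "w = 0")
    case False
    then have "complex_of_real (1 / norm w) *\<^sub>C w \<in> U"
      using K_scale[OF that] by (simp add: U_def norm_scaleC norm_divide)
    from m_unit[OF this] have "norm (x \<cdot> w) / norm w \<le> m"
      by (simp add: bop_simps norm_scaleC norm_divide)
    then show ?thesis using False by (simp add: field_simps)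
  qed simp
  show ?thesis
  proof (cases "m = 0")
    case True
    have "x \<cdot> v0 = complex_of_real 0 *\<^sub>C v0"
      using m_unit[OF v0] True by (simp add: complex_vector.scale_zero_left)
    then show ?thesis using v0 mK True by (intro that[of v0 0]) (auto simp: U_def)
  next
    case False
    then have m: "m > 0" using m0 by simp
    have "\<exists>v\<in>U. m - 1 / Suc n < norm (x \<cdot> v)" for n
    proof -
      have "m - 1 / Suc n < m" by simp
      then show ?thesis unfolding m_def by (subst (asm) less_cSUP_iff[OF _ bdd]) (use v0 in auto)
    qed
    then obtain f where f: "\<And>n. f n \<in> U" "\<And>n. m - 1 / Suc n < norm (x \<cdot> f n)" by metis
    have fK: "f n \<in> K" "norm (f n) = 1" for n using f(1)[of n] by (auto simp: U_def)
    have lim: "(\<lambda>n. norm (x \<cdot> f n)) \<longlonglongrightarrow> m"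
    proof (rule tendsto_sandwich)
      show "\<forall>\<^sub>F n in sequentially. m - 1 / Suc n \<le> norm (x \<cdot> f n)"
        using f(2) by (auto intro!: always_eventually less_imp_le)
      show "\<forall>\<^sub>F n in sequentially. norm (x \<cdot> f n) \<le> m"
        using m_unit f(1) by (auto intro!: always_eventually)
      have "(\<lambda>n. m - 1 / real (Suc n)) \<longlonglongrightarrow> m - 0"
        by (intro tendsto_intros LIMSEQ_Suc[OF lim_1_over_n])
      then show "(\<lambda>n. m - 1 / real (Suc n)) \<longlonglongrightarrow> m" by simp
    qed simp
    have sq: "(norm (x \<cdot> x \<cdot> f n - complex_of_real (m\<^sup>2) *\<^sub>C f n))\<^sup>2 \<le> m\<^sup>2 * (m\<^sup>2 - (norm (x \<cdot> f n))\<^sup>2)" for n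
    proof -
      let ?v = "f n" let ?y = "x \<cdot> f n"
      have c: "cinner (x \<cdot> ?y) ?v = of_real ((norm ?y)\<^sup>2)"
        using x(2) by (simp add: hermitian_cinner cinner_self)
      then have c': "cinner ?v (x \<cdot> ?y) = of_real ((norm ?y)\<^sup>2)"
        using cinner_commute[of ?v "x \<cdot> ?y"] by simp
      have "(norm (x \<cdot> ?y - complex_of_real (m\<^sup>2) *\<^sub>C ?v))\<^sup>2 =
        (norm (x \<cdot> ?y))\<^sup>2 - 2 * m\<^sup>2 * (norm ?y)\<^sup>2 + m\<^sup>2 * m\<^sup>2 * (norm ?v)\<^sup>2"
        unfolding norm_eq_Re_cinner[of "_ - _"]
        by (simp add: cinner_simps c c' norm_eq_Re_cinner[symmetric] del: of_real_power of_real_mult)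
          (simp add: algebra_simps)
      moreover have "(norm (x \<cdot> ?y))\<^sup>2 \<le> (m * norm ?y)\<^sup>2"
        by (intro power_mono mK K fK) simp
      ultimately show ?thesis using fK(2)[of n] by (simp add: power_mult_distrib algebra_simps power4_eq_xxxx power2_eq_square)
    qed
    have z: "(\<lambda>n. x \<cdot> x \<cdot> f n - complex_of_real (m\<^sup>2) *\<^sub>C f n) \<longlonglongrightarrow> 0"
    proof -
      have "(\<lambda>n. m\<^sup>2 * (m\<^sup>2 - (norm (x \<cdot> f n))\<^sup>2)) \<longlonglongrightarrow> m\<^sup>2 * (m\<^sup>2 - m\<^sup>2)"
        by (intro tendsto_intros lim)
      then have lz: "(\<lambda>n. m\<^sup>2 * (m\<^sup>2 - (norm (x \<cdot> f n))\<^sup>2)) \<longlonglongrightarrow> 0" by simp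
      have "(\<lambda>n. (norm (x \<cdot> x \<cdot> f n - complex_of_real (m\<^sup>2) *\<^sub>C f n))\<^sup>2) \<longlonglongrightarrow> 0"
        by (rule tendsto_sandwich[OF _ _ tendsto_const lz]) (simp_all add: sq always_eventually del: of_real_power)
      then show ?thesis by (simp add: tendsto_norm_zero_iff del: of_real_power)
    qed
    obtain r y where r: "strict_mono (r::nat\<Rightarrow>nat)" "(\<lambda>n. x \<cdot> f (r n)) \<longlonglongrightarrow> y"
      using compact_op_subseq[OF x(1), of f] fK(2) by auto
    define v where "v = complex_of_real (1 / m\<^sup>2) *\<^sub>C (x \<cdot> y)"
    have fv: "(\<lambda>n. f (r n)) \<longlonglongrightarrow> v"
    proof -
      have "(\<lambda>n. x \<cdot> x \<cdot> f (r n)) \<longlonglongrightarrow> x \<cdot> y"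
        by (rule bounded_linear.tendsto[OF bounded_linear_bop_apply r(2)])
      from tendsto_diff[OF this LIMSEQ_subseq_LIMSEQ[OF z r(1), unfolded o_def]]
      have "(\<lambda>n. complex_of_real (m\<^sup>2) *\<^sub>C f (r n)) \<longlonglongrightarrow> x \<cdot> y" by simp
      from bounded_linear.tendsto[OF bounded_linear_scaleC this, of "complex_of_real (1 / m\<^sup>2)"]
      show ?thesis using m by (simp add: scaleC_scaleC v_def)
    qed
    have vK: "v \<in> K" using K_lim[OF _ fv] fK by blast
    have v1: "norm v = 1" using tendsto_norm[OF fv] fK(2) by (simp add: LIMSEQ_const_iff)
    have xv: "y = x \<cdot> v"
      using LIMSEQ_unique[OF r(2) bounded_linear.tendsto[OF bounded_linear_bop_apply fv]] .
    have xxv: "x \<cdot> x \<cdot> v = complex_of_real (m\<^sup>2) *\<^sub>C v"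
      unfolding xv[symmetric] using m by (simp add: v_def scaleC_scaleC)
    \<comment> \<open>Here (x - m)(x + m) v = 0. Either (x + m) v vanishes and v belongs to -m, or
      it is an eigenvector for m.\<close>
    define w where "w = x \<cdot> v + complex_of_real m *\<^sub>C v"
    show ?thesis
    proof (cases "w = 0")
      case True
      then have "x \<cdot> v = complex_of_real (- m) *\<^sub>C v"
        by (simp add: w_def eq_neg_iff_add_eq_0 complex_vector.scale_minus_left)
      then show ?thesis using vK v1 mK m by (intro that[of v "-m"]) auto
    next
      case False
      have xw: "x \<cdot> w = complex_of_real m *\<^sub>C w"
        by (simp add: w_def bop_simps xxv scaleC_add_right scaleC_scaleC power2_eq_square add.commute)
      have wK: "w \<in> K" unfolding w_def by (intro K_add K_scale K vK)
      show ?thesis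
        using False xw wK mK m K_scale[OF wK, of "complex_of_real (1 / norm w)"]
        by (intro that[of "complex_of_real (1 / norm w) *\<^sub>C w" m])
          (auto simp: norm_scaleC norm_divide bop_simps scaleC_scaleC mult.commute)
    qed
  qed
qed

text \<open>The family may be incomplete: when x has infinitely many nonzero eigenvalues, a
  decreasing enumeration leaves no room for the kernel. Instead x has to vanish on the orthogonal
  complement. Eigenvalues keep their sign, only their moduli are ordered.\<close>

definition eigsys :: "'a::complex_hilbert bop \<Rightarrow> (nat \<Rightarrow> 'a) \<Rightarrow> (nat \<Rightarrow> real) \<Rightarrow> bool" where
  "eigsys x e l \<longleftrightarrow> orthonormal_on UNIV e \<and> (\<forall>n. x \<cdot> e n = complex_of_real (l n) *\<^sub>C e n) \<and>
     (\<forall>v. (\<forall>n. cinner v (e n) = 0) \<longrightarrow> x \<cdot> v = 0) \<and> decseq (\<lambda>n. \<bar>l n\<bar>) \<and> l \<longlonglongrightarrow> 0"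

theorem spectral_theorem:
  fixes x :: "'a::separable_infinite_hilbert bop"
  assumes x: "compact_op x" "hermitian x"
  obtains e l where "eigsys x e l"
proof -
  define K where "K F = {v. \<forall>f\<in>F. cinner v f = 0}" for F :: "'a set"
  \<comment> \<open>The clause for \<open>n = 0\<close> fixes the empty starting set, so that
    \<open>f n\<close> is exactly the set of the first n chosen eigenvectors.\<close>
  define P where "P n F \<longleftrightarrow> finite F \<and> (\<forall>f\<in>F. \<exists>c. x \<cdot> f = c *\<^sub>C f) \<and> (n = 0 \<longrightarrow> F = {})" for n :: nat and F
  define R where "R F v \<longleftrightarrow> v \<in> K F \<and> norm v = 1 \<and> (\<exists>l. x \<cdot> v = complex_of_real l *\<^sub>C v \<and>
    (\<forall>w\<in>K F. norm (x \<cdot> w) \<le> \<bar>l\<bar> * norm w))" for F v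
  have "\<exists>f. \<forall>n. P n (f n) \<and> (\<exists>v. R (f n) v \<and> f (Suc n) = insert v (f n))"
  proof (rule dependent_nat_choice)
    show "\<exists>F. P 0 F" by (auto simp: P_def)
    fix F n assume "P n F"
    have inv: "x \<cdot> v \<in> {v. \<forall>f\<in>F. cinner v f = 0}" if "v \<in> {v. \<forall>f\<in>F. cinner v f = 0}" for v
    proof (intro CollectI ballI)
      fix f assume "f \<in> F"
      then obtain c where "x \<cdot> f = c *\<^sub>C f" using \<open>P n F\<close> by (auto simp: P_def)
      then show "cinner (x \<cdot> v) f = 0"
        using that x(2) \<open>f \<in> F\<close> by (simp add: hermitian_cinner cinner_simps)
    qed
    obtain v l where "v \<in> K F" "norm v = 1" "x \<cdot> v = complex_of_real l *\<^sub>C v"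
      "\<And>w. w \<in> K F \<Longrightarrow> norm (x \<cdot> w) \<le> \<bar>l\<bar> * norm w"
      unfolding K_def using exists_maximal_eigenvector[OF x _ inv, of thesis] \<open>P n F\<close> by (auto simp: P_def)
    then show "\<exists>G. P (Suc n) G \<and> (\<exists>v. R F v \<and> G = insert v F)"
      using \<open>P n F\<close> by (intro exI[of _ "insert v F"]) (auto simp: P_def R_def)
  qed
  then obtain f e where f: "\<And>n. P n (f n)" "\<And>n. R (f n) (e n)" "\<And>n. f (Suc n) = insert (e n) (f n)"
    by metis
  obtain l where l: "\<And>n. x \<cdot> e n = complex_of_real (l n) *\<^sub>C e n"
     "\<And>n w. w \<in> K (f n) \<Longrightarrow> norm (x \<cdot> w) \<le> \<bar>l n\<bar> * norm w"
    using f(2) unfolding R_def by metis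
  have eK: "e n \<in> K (f n)" and e1: "norm (e n) = 1" for n using f(2)[of n] by (auto simp: R_def)
  have fe: "f n = e ` {..<n}" for n
    by (induction n) (use f in \<open>auto simp: P_def lessThan_Suc\<close>)
  have ort: "cinner (e n) (e m) = 0" if "m < n" for m n
    using eK[of n] that by (auto simp: K_def fe)
  have on: "orthonormal_on UNIV e" unfolding orthonormal_on_def
  proof (intro ballI)
    fix i j
    have "cinner (e i) (e j) = 0" if "i \<noteq> j"
      using that ort by (metis cinner_eq_0_commute nat_neq_iff)
    then show "cinner (e i) (e j) = (if i = j then 1 else 0)" by (simp add: cinner_self e1)
  qed
  have nl: "norm (x \<cdot> e n) = \<bar>l n\<bar>" for n by (simp add: l(1) norm_scaleC e1)
  have dec: "decseq (\<lambda>n. \<bar>l n\<bar>)"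
  proof (rule decseq_SucI)
    fix n
    have "e (Suc n) \<in> K (f n)" using eK[of "Suc n"] f(3)[of n] by (auto simp: K_def)
    from l(2)[OF this] show "\<bar>l (Suc n)\<bar> \<le> \<bar>l n\<bar>" by (simp add: nl e1)
  qed
  obtain c where c: "(\<lambda>n. \<bar>l n\<bar>) \<longlonglongrightarrow> c" "\<And>n. c \<le> \<bar>l n\<bar>"
    using decseq_convergent[OF dec, of 0] by auto
  have c0: "c \<ge> 0" using LIMSEQ_le_const[OF c(1)] by auto
  \<comment> \<open>If the moduli stayed above c > 0, the images x e n would be pairwise orthogonal
    of norm at least c, so no subsequence of them could be Cauchy.\<close>
  have "c = 0"
  proof (rule ccontr)
    assume "c \<noteq> 0"
    then have cp: "c > 0" using c0 by simp
    obtain r y where r: "strict_mono (r::nat\<Rightarrow>nat)" "(\<lambda>n. x \<cdot> e (r n)) \<longlonglongrightarrow> y"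
      using compact_op_subseq[OF x(1), of e] e1 by auto
    then have "Cauchy (\<lambda>n. x \<cdot> e (r n))" by (simp add: LIMSEQ_imp_Cauchy)
    then obtain M where M: "\<And>m n. m \<ge> M \<Longrightarrow> n \<ge> M \<Longrightarrow> norm (x \<cdot> e (r m) - x \<cdot> e (r n)) < c"
      using cp unfolding Cauchy_def dist_norm by meson
    define i j where "i = r M" and "j = r (Suc M)"
    have "i \<noteq> j" using r(1) by (simp add: i_def j_def strict_mono_eq)
    have "(norm (x \<cdot> e i - x \<cdot> e j))\<^sup>2 = (l i)\<^sup>2 + (l j)\<^sup>2"
      unfolding norm_eq_Re_cinner[of "_ - _"] using on \<open>i \<noteq> j\<close>
      by (simp add: l(1) cinner_simps orthonormal_on_def) (simp add: power2_eq_square)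
    also have "\<dots> \<ge> c\<^sup>2" using c(2)[of i] cp power_mono[of c "\<bar>l i\<bar>" 2] by (simp add: add_increasing2)
    finally have "norm (x \<cdot> e i - x \<cdot> e j) \<ge> c" by (rule power2_le_imp_le) simp
    then show False using M[of M "Suc M"] by (simp add: i_def j_def)
  qed
  then have l0: "l \<longlonglongrightarrow> 0" using c(1) by (simp add: tendsto_rabs_zero_iff)
  have "x \<cdot> v = 0" if "\<forall>n. cinner v (e n) = 0" for v
  proof -
    have "norm (x \<cdot> v) \<le> \<bar>l n\<bar> * norm v" for n
      by (rule l(2)) (use that in \<open>auto simp: K_def fe\<close>)
    moreover have "(\<lambda>n. \<bar>l n\<bar> * norm v) \<longlonglongrightarrow> 0 * norm v"
      using c(1) \<open>c = 0\<close> by (intro tendsto_intros) simp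
    ultimately have "norm (x \<cdot> v) \<le> 0 * norm v" by (intro LIMSEQ_le_const) auto
    then show ?thesis by simp
  qed
  then show ?thesis using on l(1) dec l0 by (intro that) (auto simp: eigsys_def)
qed

subsection \<open>Singular values\<close>

lemma eigsysD:
  assumes "eigsys x e l"
  shows "orthonormal_on UNIV e" "x \<cdot> e n = complex_of_real (l n) *\<^sub>C e n"
    "(\<And>n. cinner v (e n) = 0) \<Longrightarrow> x \<cdot> v = 0" "decseq (\<lambda>n. \<bar>l n\<bar>)" "l \<longlonglongrightarrow> 0" "(\<lambda>n. \<bar>l n\<bar>) \<longlonglongrightarrow> 0"
    "cinner (e i) (e j) = (if i = j then 1 else 0)" "norm (e n) = 1"
  using assms orthonormal_on_norm[of UNIV e n] tendsto_rabs_zero_iff[of l sequentially]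
  by (auto simp: eigsys_def orthonormal_on_def)

lemma eigsys_expansion:
  assumes "eigsys x e l"
  shows "(\<lambda>n. (cinner v (e n) * complex_of_real (l n)) *\<^sub>C e n) sums (x \<cdot> v)"
proof -
  obtain w where w: "(\<lambda>n. cinner v (e n) *\<^sub>C e n) sums (v - w)" "\<And>n. cinner w (e n) = 0"
    using orthonormal_decomposition[OF eigsysD(1)[OF assms]] by blast
  from bounded_linear.sums[OF bounded_linear_bop_apply[of x] w(1)] eigsysD(3)[OF assms w(2)]
  show ?thesis by (simp add: bop_simps eigsysD(2)[OF assms] scaleC_scaleC)
qed

text \<open>Justifies the definite description of singular values. At the first index j where the
  sequences differ, let r be the larger value. Every index at which the other sequence equals r lies
  before j, where both agree, and j itself is extra for the first sequence. Convergence to 0 makes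
  the counts finite.\<close>

lemma decseq_eq_of_multiplicities:
  fixes s s' :: "nat \<Rightarrow> real"
  assumes s: "decseq s" "s \<longlonglongrightarrow> 0" and s': "decseq s'" "s' \<longlonglongrightarrow> 0"
    and c: "\<And>r. r > 0 \<Longrightarrow> card {j. s j = r} = card {j. s' j = r}"
  shows "s = s'"
proof (rule ccontr)
  assume "s \<noteq> s'"
  then have ex: "\<exists>j. s j \<noteq> s' j" by auto
  define j where "j = (LEAST j. s j \<noteq> s' j)"
  have j: "s j \<noteq> s' j" unfolding j_def by (rule LeastI_ex[OF ex])
  have le: "s i = s' i" if "i < j" for i using not_less_Least[of i] that unfolding j_def by blast
  have False if "s j > s' j" "decseq s" "s \<longlonglongrightarrow> 0" "decseq s'" "s' \<longlonglongrightarrow> 0"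
    "\<And>r. r > 0 \<Longrightarrow> card {j. s j = r} = card {j. s' j = r}" "\<And>i. i < j \<Longrightarrow> s i = s' i" for s s' :: "nat \<Rightarrow> real"
  proof -
    define r where "r = s j"
    have "s' j \<ge> 0" using decseq_ge[OF that(4,5)] .
    then have r: "r > 0" using that(1) by (simp add: r_def)
    have fin: "finite {i. s i = r}"
    proof -
      have "\<forall>\<^sub>F i in sequentially. s i < r" by (rule order_tendstoD(2)[OF that(3) r])
      then obtain M where "\<And>i. i \<ge> M \<Longrightarrow> s i < r" unfolding eventually_sequentially by blast
      then have "{i. s i = r} \<subseteq> {..<M}" by (metis (mono_tags, lifting) lessThan_iff less_irrefl mem_Collect_eq not_le subsetI)
      then show ?thesis by (rule finite_subset) simp
    qed
    have "{i. s' i = r} \<subset> {i. s i = r}"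
    proof
      show "{i. s' i = r} \<subseteq> {i. s i = r}"
      proof
        fix i assume i: "i \<in> {i. s' i = r}"
        have "i < j"
        proof (rule ccontr)
          assume "\<not> i < j"
          then have "s' i \<le> s' j" using that(4) by (simp add: decseqD)
          then show False using i that(1) by (simp add: r_def)
        qed
        then show "i \<in> {i. s i = r}" using i that(7) by simp
      qed
      show "{i. s' i = r} \<noteq> {i. s i = r}" using that(1) unfolding r_def by (metis (mono_tags) less_irrefl mem_Collect_eq)
    qed
    then have "card {i. s' i = r} < card {i. s i = r}" by (rule psubset_card_mono[OF fin])
    then show False using that(6)[OF r] by simp
  qed
  then have gt: "\<not> s' j < s j" "\<not> s j < s' j"
    using s s' c le by metis+
  then show False using j by linarith
qed

text \<open>The vectors \<open>e j\<close> with |l j| = r are a basis of the eigenspace. Subtracting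
  from an eigenvector its part along them leaves some w orthogonal to every \<open>e i\<close>, so x
  w = 0, while x x w is r^2 times w.\<close>

lemma eigsys_dim:
  fixes x :: "'a::separable_infinite_hilbert bop"
  assumes x: "hermitian x" and es: "eigsys x e l" and r: "r > 0"
  shows "complex_vector.dim {v. (adj x * x) \<cdot> v = complex_of_real (r\<^sup>2) *\<^sub>C v} = card {j. \<bar>l j\<bar> = r}"
proof -
  define J where "J = {j. \<bar>l j\<bar> = r}"
  have fin: "finite J"
  proof -
    have "\<forall>\<^sub>F i in sequentially. \<bar>l i\<bar> < r" by (rule order_tendstoD(2)[OF eigsysD(6)[OF es] r])
    then obtain M where "\<And>i. i \<ge> M \<Longrightarrow> \<bar>l i\<bar> < r" unfolding eventually_sequentially by blast
    then have "J \<subseteq> {..<M}" unfolding J_def by (metis (mono_tags, lifting) lessThan_iff less_irrefl mem_Collect_eq not_le subsetI)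
    then show ?thesis by (rule finite_subset) simp
  qed
  note e = eigsysD(7)[OF es]
  have inj: "inj_on e J"
    by (rule inj_onI, rule ccontr) (use e zero_neq_one in metis)
  have xx: "(adj x * x) \<cdot> v = x \<cdot> x \<cdot> v" for v using x by (simp add: hermitian_def bop_simps)
  let ?V = "{v. (adj x * x) \<cdot> v = complex_of_real (r\<^sup>2) *\<^sub>C v}"
  have "complex_vector.dim ?V = card J"
  proof (rule complex_vector.dim_unique[of "e ` J"])
    show "e ` J \<subseteq> ?V"
    proof (intro subsetI CollectI, elim imageE)
      fix v j assume "v = e j" "j \<in> J"
      moreover have "l j * l j = r\<^sup>2" if "j \<in> J" using that by (auto simp: J_def power2_eq_square)
      ultimately show "(adj x * x) \<cdot> v = complex_of_real (r\<^sup>2) *\<^sub>C v"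
        by (simp only: xx eigsysD(2)[OF es] bop_apply_scaleC scaleC_scaleC of_real_mult[symmetric])
    qed
    show "?V \<subseteq> complex_vector.span (e ` J)"
    proof
      fix v assume v: "v \<in> ?V"
      define w where "w = v - (\<Sum>j\<in>J. cinner v (e j) *\<^sub>C e j)"
      have "cinner w (e i) = 0" for i
      proof (cases "i \<in> J")
        case True
        have "cinner (\<Sum>j\<in>J. cinner v (e j) *\<^sub>C e j) (e i) = (\<Sum>j\<in>J. if j = i then cinner v (e i) else 0)"
          unfolding cinner_sum_left by (intro sum.cong refl) (auto simp: cinner_simps e)
        then show ?thesis using True fin by (simp add: w_def cinner_simps)
      next
        case False
        have "complex_of_real (r\<^sup>2) * cinner v (e i) = cinner (x \<cdot> x \<cdot> v) (e i)"
          using v by (simp add: xx[symmetric] cinner_simps del: of_real_power)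
        also have "\<dots> = complex_of_real ((l i)\<^sup>2) * cinner v (e i)"
          using x by (simp add: hermitian_cinner eigsysD(2)[OF es] cinner_simps bop_simps power2_eq_square)
        finally have "r\<^sup>2 = (l i)\<^sup>2 \<or> cinner v (e i) = 0" by (metis mult_right_cancel of_real_eq_iff)
        moreover have "r\<^sup>2 \<noteq> (l i)\<^sup>2" using False r by (auto simp: J_def power2_eq_iff)
        ultimately have "cinner v (e i) = 0" by blast
        moreover have "cinner (\<Sum>j\<in>J. cinner v (e j) *\<^sub>C e j) (e i) = 0"
          unfolding cinner_sum_left using False by (intro sum.neutral) (auto simp: cinner_simps e)
        ultimately show ?thesis by (simp add: w_def cinner_simps)
      qed
      then have "x \<cdot> w = 0" by (rule eigsysD(3)[OF es])
      moreover have "x \<cdot> x \<cdot> w = complex_of_real (r\<^sup>2) *\<^sub>C w"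
      proof -
        have "(\<Sum>j\<in>J. cinner v (e j) *\<^sub>C e j) \<in> ?V" 
        proof -
          have "x \<cdot> x \<cdot> (cinner v (e j) *\<^sub>C e j) = complex_of_real (r\<^sup>2) *\<^sub>C cinner v (e j) *\<^sub>C e j" if "j \<in> J" for j
          proof -
            have "l j * l j = r\<^sup>2" using that by (auto simp: J_def power2_eq_square)
            then show ?thesis
              by (simp add: eigsysD(2)[OF es] bop_simps scaleC_scaleC mult.commute[of "cinner _ _"] mult.assoc[symmetric] of_real_mult[symmetric] del: of_real_mult of_real_power)
          qed
          then show ?thesis by (simp add: xx bop_apply_sum complex_vector.scale_sum_right)
        qed
        then show ?thesis using v x by (simp add: w_def bop_simps hermitian_def complex_vector.scale_right_diff_distrib)
      qed
      ultimately have "w = 0" using r by (simp add: complex_vector.scale_eq_0_iff)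
      then have "v = (\<Sum>j\<in>J. cinner v (e j) *\<^sub>C e j)" by (simp add: w_def)
      also have "\<dots> \<in> complex_vector.span (e ` J)"
        by (intro complex_vector.span_sum complex_vector.span_scale complex_vector.span_base) auto
      finally show "v \<in> complex_vector.span (e ` J)" .
    qed
    show "complex_vector.independent (e ` J)"
      unfolding complex_vector.dependent_finite[OF finite_imageI[OF fin]]
    proof (intro notI, elim exE conjE bexE imageE)
      fix u v i assume "(\<Sum>v\<in>e ` J. u v *\<^sub>C v) = 0" "u v \<noteq> 0" "v = e i" "i \<in> J"
      then have "0 = cinner (\<Sum>j\<in>J. u (e j) *\<^sub>C e j) (e i)" by (simp add: sum.reindex[OF inj])
      also have "\<dots> = (\<Sum>j\<in>J. if j = i then u (e i) else 0)"
        unfolding cinner_sum_left by (intro sum.cong refl) (auto simp: cinner_simps e)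
      finally show False using \<open>i \<in> J\<close> fin \<open>u v \<noteq> 0\<close> \<open>v = e i\<close> by simp
    qed
    show "card (e ` J) = card J" by (rule card_image[OF inj])
  qed
  then show ?thesis by (simp add: J_def)
qed

lemma singular_values_eigsys:
  fixes x :: "'a::separable_infinite_hilbert bop"
  assumes x: "hermitian x" and es: "eigsys x e l"
  shows "singular_values x = (\<lambda>j. \<bar>l j\<bar>)"
  unfolding singular_values_def
proof (rule the_equality)
  show "decseq (\<lambda>j. \<bar>l j\<bar>) \<and> (\<lambda>j. \<bar>l j\<bar>) \<longlonglongrightarrow> 0 \<and> (\<forall>r>0. card {j. \<bar>l j\<bar> = r} =
        complex_vector.dim {v. (adj x * x) \<cdot> v = complex_of_real (r\<^sup>2) *\<^sub>C v})"
    using eigsysD(4,6)[OF es] eigsys_dim[OF assms] by simp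
  fix s assume s: "decseq s \<and> s \<longlonglongrightarrow> 0 \<and> (\<forall>r>0. card {j. s j = r} =
        complex_vector.dim {v. (adj x * x) \<cdot> v = complex_of_real (r\<^sup>2) *\<^sub>C v})"
  show "s = (\<lambda>j. \<bar>l j\<bar>)"
  proof (rule decseq_eq_of_multiplicities)
    show "card {j. s j = r} = card {j. \<bar>l j\<bar> = r}" if "r > 0" for r
      by (rule trans[OF s[THEN conjunct2, THEN conjunct2, rule_format, OF that] eigsys_dim[OF assms that]])
  qed (simp_all only: s eigsysD(4,6)[OF es])
qed

subsection \<open>Compactness by finite-codimensional estimates\<close>

lemma compact_scaleC_cball: "compact ((\<lambda>c. c *\<^sub>C (w::'a::complex_hilbert)) ` cball 0 1)"
  by (intro compact_continuous_image linear_continuous_on bounded_linear_scaleC_left) simp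

text \<open>The image of the ball lies within a small distance of the image of a polydisc in
  finitely many dimensions, so it is totally bounded. The criterion serves diagonal operators, and
  its failure produces the orthogonal sequence on which a noncompact operator is bounded
  below.\<close>

lemma compact_op_approx:
  fixes x :: "'a::complex_hilbert bop"
  assumes "\<And>\<epsilon>. \<epsilon> > 0 \<Longrightarrow> \<exists>F. finite F \<and> (\<forall>v. (\<forall>f\<in>F. cinner v f = 0) \<longrightarrow> norm (x \<cdot> v) \<le> \<epsilon> * norm v)"
  shows "compact_op x"
  unfolding compact_op_def compact_eq_totally_bounded
proof (intro conjI allI impI)
  show "complete (closure ((\<cdot>) x ` cball 0 1))" by (simp add: complete_eq_closed)
  fix e :: real assume e: "e > 0"
  obtain F where "finite F" and F': "\<And>v. (\<forall>f\<in>F. cinner v f = 0) \<Longrightarrow> norm (x \<cdot> v) \<le> e/4 * norm v"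
    using assms[of "e/4"] e by auto
  then obtain E where E: "finite E" "orthonormal_on E id"
    "\<And>v f. \<forall>e\<in>E. cinner v e = 0 \<Longrightarrow> f \<in> F \<Longrightarrow> cinner v f = 0"
    using finite_orthonormalize[of F] by blast
  \<comment> \<open>\<open>C A\<close> is the image of the polydisc with coefficients of modulus at
    most 1; it contains the images of all projections of unit ball vectors to the span of A.\<close>
  define C where "C A = {s. \<exists>c. (\<forall>b\<in>A. cmod (c b) \<le> 1) \<and> s = (\<Sum>b\<in>A. c b *\<^sub>C (x \<cdot> b))}" for A
  have "compact (C A)" if "finite A" for A
    using that
  proof (induction A rule: finite_induct)
    case empty
    have "C {} = {0}" by (auto simp: C_def)
    then show ?case by simp
  next
    case (insert a A)
    have "C (insert a A) = {p + q | p q. p \<in> (\<lambda>c. c *\<^sub>C (x \<cdot> a)) ` cball 0 1 \<and> q \<in> C A}" (is "_ = ?R")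
    proof (intro subset_antisym subsetI)
      fix s assume "s \<in> C (insert a A)"
      then obtain c where c: "\<forall>b\<in>insert a A. cmod (c b) \<le> 1" "s = c a *\<^sub>C (x \<cdot> a) + (\<Sum>b\<in>A. c b *\<^sub>C (x \<cdot> b))"
        using insert.hyps by (auto simp: C_def)
      then show "s \<in> ?R" unfolding C_def
        by (intro CollectI exI[of _ "c a *\<^sub>C (x \<cdot> a)"] exI[of _ "\<Sum>b\<in>A. c b *\<^sub>C (x \<cdot> b)"] conjI exI[of _ c]) auto
    next
      fix s assume "s \<in> ?R"
      then obtain k c where kc: "cmod k \<le> 1" "\<forall>b\<in>A. cmod (c b) \<le> 1" "s = k *\<^sub>C (x \<cdot> a) + (\<Sum>b\<in>A. c b *\<^sub>C (x \<cdot> b))"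
        unfolding C_def by auto
      have "(\<Sum>b\<in>A. c b *\<^sub>C (x \<cdot> b)) = (\<Sum>b\<in>A. (c(a := k)) b *\<^sub>C (x \<cdot> b))"
        using insert.hyps by (intro sum.cong) auto
      then show "s \<in> C (insert a A)" unfolding C_def using insert.hyps kc
        by (intro CollectI exI[of _ "c(a := k)"]) auto
    qed
    then show ?case using compact_sums[OF compact_scaleC_cball insert.IH] by simp
  qed
  from this[OF E(1)] obtain k where k: "finite k" "C E \<subseteq> (\<Union>y\<in>k. ball y (e/4))"
    unfolding compact_eq_totally_bounded using e by (meson zero_less_divide_iff zero_less_numeral)
  \<comment> \<open>Closed balls of radius e/2 = e/4 + e/4 are used since a finite union of them is
    closed and so also covers the closure.\<close>
  have im: "(\<cdot>) x ` cball 0 1 \<subseteq> (\<Union>y\<in>k. cball y (e/2))"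
  proof (intro subsetI, elim imageE)
    fix s v assume s: "s = x \<cdot> v" and v: "v \<in> cball 0 1"
    define p where "p = (\<Sum>b\<in>E. cinner v b *\<^sub>C b)"
    have vp: "cinner (v - p) b = 0" if "b \<in> E" for b
      unfolding p_def by (rule finite_projection_orthogonal[OF E(1,2) that])
    have "cinner v p = cinner p p"
    proof -
      have "cinner (v - p) p = 0" by (subst (2) p_def) (simp add: cinner_sum_right cinner_simps(8) vp)
      then show ?thesis by (simp add: cinner_simps)
    qed
    then have "(norm (v - p))\<^sup>2 = (norm v)\<^sup>2 - (norm p)\<^sup>2"
      by (simp add: norm_eq_Re_cinner cinner_simps cinner_commute[of p v])
    then have "(norm (v - p))\<^sup>2 \<le> 1\<^sup>2" 
    proof -
      have "(norm v)\<^sup>2 \<le> 1" using v by (simp add: power_le_one)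
      then show ?thesis using \<open>(norm (v - p))\<^sup>2 = (norm v)\<^sup>2 - (norm p)\<^sup>2\<close> zero_le_power2[of "norm p"]
        unfolding one_power2 by linarith
    qed
    then have n1: "norm (v - p) \<le> 1" by (rule power2_le_imp_le) simp
    have "norm (x \<cdot> (v - p)) \<le> e/4 * norm (v - p)" by (rule F') (use E(3) vp in blast)
    also have "\<dots> \<le> e/4 * 1" using n1 e by (intro mult_left_mono) auto
    finally have d1: "dist (x \<cdot> v) (x \<cdot> p) \<le> e/4" by (simp add: dist_norm bop_simps)
    have "x \<cdot> p \<in> C E" unfolding C_def
    proof (intro CollectI exI conjI ballI)
      show "x \<cdot> p = (\<Sum>b\<in>E. cinner v b *\<^sub>C (x \<cdot> b))" by (simp add: p_def bop_apply_sum bop_simps)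
      fix b assume "b \<in> E"
      have "cmod (cinner v b) \<le> norm v * norm b" by (rule Cauchy_Schwarz)
      then show "cmod (cinner v b) \<le> 1" using orthonormal_on_norm[OF E(2) \<open>b \<in> E\<close>] v by simp
    qed
    then obtain y where "y \<in> k" "dist y (x \<cdot> p) < e/4" using k(2) by auto
    then have "dist y (x \<cdot> v) \<le> e/2" using d1 dist_triangle[of y "x \<cdot> v" "x \<cdot> p"] by (simp add: dist_commute)
    then show "s \<in> (\<Union>y\<in>k. cball y (e/2))" using \<open>y \<in> k\<close> s by auto
  qed
  have "closed (\<Union>y\<in>k. cball y (e/2))" using k(1) by (intro closed_UN) auto
  then have "closure ((\<cdot>) x ` cball 0 1) \<subseteq> (\<Union>y\<in>k. cball y (e/2))" using im by (rule closure_minimal[rotated])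
  also have "\<dots> \<subseteq> (\<Union>y\<in>k. ball y e)" using e by (intro UN_mono) auto
  finally show "\<exists>k. finite k \<and> closure ((\<cdot>) x ` cball 0 1) \<subseteq> (\<Union>y\<in>k. ball y e)" using k(1) by blast
qed

subsection \<open>Ky Fan sums\<close>

text \<open>Weights between 0 and 1 of total at most k do best on the k largest entries. After
  subtracting \<open>m k\<close> from the entries, each term is bounded by the positive part, which
  lives on the indices below k.\<close>

lemma top_sum_bound:
  fixes m c :: "nat \<Rightarrow> real"
  assumes m: "decseq m" "\<And>i. m i \<ge> 0" and c: "\<And>i. 0 \<le> c i" "\<And>i. c i \<le> 1"
    and k: "(\<Sum>i<M. c i) \<le> real k"
  shows "(\<Sum>i<M. m i * c i) \<le> (\<Sum>i<k. m i)"
proof -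
  define r where "r i = (if i < k then m i - m k else 0)" for i
  have r: "(m i - m k) * c i \<le> r i" for i
    using c[of i] decseqD[OF m(1), of i k] decseqD[OF m(1), of k i]
    by (auto simp: r_def mult_left_le mult_nonneg_nonpos mult_nonpos_nonneg not_less)
  have "(\<Sum>i<M. m i * c i) = (\<Sum>i<M. (m i - m k) * c i) + m k * (\<Sum>i<M. c i)"
    by (simp add: sum_distrib_left sum.distrib[symmetric] algebra_simps)
  also have "\<dots> \<le> (\<Sum>i<M. r i) + m k * real k"
    using r k m(2)[of k] by (intro add_mono sum_mono mult_left_mono) auto
  also have "(\<Sum>i<M. r i) \<le> (\<Sum>i<k. r i)"
  proof -
    have "(\<Sum>i<M. r i) = (\<Sum>i\<in>{..<M} \<inter> {..<k}. r i)"
      by (rule sum.mono_neutral_right) (auto simp: r_def)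
    also have "\<dots> \<le> (\<Sum>i<k. r i)"
      using decseqD[OF m(1)] by (intro sum_mono2) (auto simp: r_def)
    finally show ?thesis .
  qed
  also have "(\<Sum>i<k. r i) + m k * real k = (\<Sum>i<k. m i)"
    by (simp add: r_def sum_subtractf)
  finally show ?thesis by simp
qed

text \<open>In the eigenvector expansion, the arithmetic-geometric mean inequality bounds the i-th
  term by \<open>\<bar>l i\<bar> * d j i\<close>. The column sums \<open>c i\<close> are at most 1
  by Bessel for \<open>v\<close> and \<open>w\<close>, their total is at most k by Bessel for
  \<open>e\<close>, so \<open>top_sum_bound\<close> applies.\<close>

lemma Ky_Fan_eigsys:
  fixes x :: "'a::separable_infinite_hilbert bop"
  assumes es: "eigsys x e l" and v: "suborthonormal_on {..<k} v" and w: "suborthonormal_on {..<k} w"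
  shows "(\<Sum>j<k. cmod (cinner (x \<cdot> v j) (w j))) \<le> (\<Sum>i<k. \<bar>l i\<bar>)"
proof (rule LIMSEQ_le_const2)
  define t where "t j i = cinner (v j) (e i) * complex_of_real (l i) * cinner (e i) (w j)" for j i
  have t: "t j sums cinner (x \<cdot> v j) (w j)" for j
    using bounded_linear.sums[OF bounded_linear_cinner_left eigsys_expansion[OF es], of "v j" "w j"]
    unfolding t_def[abs_def] by (simp add: cinner_simps)
  show "(\<lambda>M. \<Sum>j<k. cmod (\<Sum>i<M. t j i)) \<longlonglongrightarrow> (\<Sum>j<k. cmod (cinner (x \<cdot> v j) (w j)))"
    using t by (intro tendsto_sum tendsto_norm) (simp add: sums_def)
  define d where "d j i = ((cmod (cinner (v j) (e i)))\<^sup>2 + (cmod (cinner (w j) (e i)))\<^sup>2) / 2" for j i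
  have td: "cmod (t j i) \<le> \<bar>l i\<bar> * d j i" for j i
  proof -
    have "cmod (t j i) = \<bar>l i\<bar> * (cmod (cinner (v j) (e i)) * cmod (cinner (w j) (e i)))"
      by (simp add: t_def norm_mult cmod_cinner_commute[of "e i"])
    also have "\<dots> \<le> \<bar>l i\<bar> * d j i"
      unfolding d_def by (intro mult_left_mono) (use sum_squares_bound[of "cmod (cinner (v j) (e i))" "cmod (cinner (w j) (e i))"] in simp_all)
    finally show ?thesis .
  qed
  define c where "c i = (\<Sum>j<k. d j i)" for i
  have c0: "0 \<le> c i" for i by (simp add: c_def d_def sum_nonneg)
  have c1: "c i \<le> 1" for i
  proof -
    have "c i = ((\<Sum>j<k. (cmod (cinner (e i) (v j)))\<^sup>2) + (\<Sum>j<k. (cmod (cinner (e i) (w j)))\<^sup>2)) / 2"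
      by (simp add: c_def d_def sum.distrib sum_divide_distrib[symmetric] cmod_cinner_commute[of "e i"])
    also have "\<dots> \<le> ((norm (e i))\<^sup>2 + (norm (e i))\<^sup>2) / 2"
      by (intro divide_right_mono add_mono Bessel v w) auto
    finally show ?thesis using eigsysD(8)[OF es] by simp
  qed
  have ck: "(\<Sum>i<M. c i) \<le> real k" for M
  proof -
    have on: "suborthonormal_on {..<M} e"
      by (intro orthonormal_on_imp_suborthonormal_on orthonormal_on_subset[OF eigsysD(1)[OF es]]) auto
    have "(\<Sum>i<M. c i) = (\<Sum>j<k. \<Sum>i<M. d j i)" unfolding c_def by (rule sum.swap)
    also have "\<dots> = (\<Sum>j<k. ((\<Sum>i<M. (cmod (cinner (v j) (e i)))\<^sup>2) + (\<Sum>i<M. (cmod (cinner (w j) (e i)))\<^sup>2)) / 2)"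
      by (simp add: d_def sum.distrib sum_divide_distrib[symmetric])
    also have "\<dots> \<le> (\<Sum>j<k. ((norm (v j))\<^sup>2 + (norm (w j))\<^sup>2) / 2)"
      by (intro sum_mono divide_right_mono add_mono Bessel on) auto
    also have "\<dots> \<le> (\<Sum>j<k. 1)"
    proof (rule sum_mono)
      fix j assume "j \<in> {..<k}"
      then have "norm (v j) \<le> 1" "norm (w j) \<le> 1" using v w by (auto simp: suborthonormal_on_def)
      then have "(norm (v j))\<^sup>2 \<le> 1" "(norm (w j))\<^sup>2 \<le> 1" by (simp_all add: power_le_one)
      then show "((norm (v j))\<^sup>2 + (norm (w j))\<^sup>2) / 2 \<le> 1" by simp
    qed
    finally show ?thesis by simp
  qed
  have "(\<Sum>j<k. cmod (\<Sum>i<M. t j i)) \<le> (\<Sum>i<k. \<bar>l i\<bar>)" for M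
  proof -
    have "(\<Sum>j<k. cmod (\<Sum>i<M. t j i)) \<le> (\<Sum>j<k. \<Sum>i<M. \<bar>l i\<bar> * d j i)"
      by (intro sum_mono sum_norm_le td)
    also have "\<dots> = (\<Sum>i<M. \<bar>l i\<bar> * c i)"
      unfolding c_def sum_distrib_left by (rule sum.swap)
    also have "\<dots> \<le> (\<Sum>i<k. \<bar>l i\<bar>)"
      by (intro top_sum_bound eigsysD(4)[OF es] c0 c1 ck) auto
    finally show ?thesis .
  qed
  then show "\<exists>N. \<forall>M\<ge>N. (\<Sum>j<k. cmod (\<Sum>i<M. t j i)) \<le> (\<Sum>i<k. \<bar>l i\<bar>)" by blast
qed

definition kyfan :: "nat \<Rightarrow> 'a::separable_infinite_hilbert bop \<Rightarrow> real" where
  "kyfan k x = (\<Sum>j<k. singular_values x j)"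

definition compact_hermitian :: "'a::separable_infinite_hilbert bop \<Rightarrow> bool" where
  "compact_hermitian x \<longleftrightarrow> compact_op x \<and> hermitian x"

lemma compact_hermitian_eigsys:
  assumes "compact_hermitian x"
  obtains e l where "eigsys x e l" "singular_values x = (\<lambda>j. \<bar>l j\<bar>)"
proof -
  obtain e l where "eigsys x e l" by (rule spectral_theorem) (use assms in \<open>auto simp: compact_hermitian_def\<close>)
  then show ?thesis using that singular_values_eigsys[of x e l] assms by (simp add: compact_hermitian_def)
qed

lemma kyfan_upper:
  assumes "compact_hermitian x" "suborthonormal_on {..<k} v" "suborthonormal_on {..<k} w"
  shows "(\<Sum>j<k. cmod (cinner (x \<cdot> v j) (w j))) \<le> kyfan k x"
proof -
  obtain e l where "eigsys x e l" "singular_values x = (\<lambda>j. \<bar>l j\<bar>)"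
    using compact_hermitian_eigsys[OF assms(1)] by blast
  then show ?thesis using Ky_Fan_eigsys[OF _ assms(2,3)] by (simp add: kyfan_def)
qed

text \<open>The vectors \<open>v\<close> are eigenvectors; the signs of the eigenvalues are moved to
  \<open>w\<close>.\<close>

lemma kyfan_attained:
  assumes "compact_hermitian x"
  obtains v w where "suborthonormal_on {..<k} v" "suborthonormal_on {..<k} w"
    "kyfan k x = (\<Sum>j<k. Re (cinner (x \<cdot> v j) (w j)))" "\<And>j. j < k \<Longrightarrow> norm (v j) = 1"
proof -
  obtain e l where es: "eigsys x e l" and s: "singular_values x = (\<lambda>j. \<bar>l j\<bar>)"
    using compact_hermitian_eigsys[OF assms(1)] by blast
  define w where "w j = complex_of_real (sgn (l j)) *\<^sub>C e j" for j
  have e: "suborthonormal_on {..<k} e"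
    by (intro orthonormal_on_imp_suborthonormal_on orthonormal_on_subset[OF eigsysD(1)[OF es]]) auto
  have "suborthonormal_on {..<k} w"
    using eigsysD(7,8)[OF es] by (auto simp: suborthonormal_on_def w_def cinner_simps norm_scaleC sgn_if)
  moreover have "kyfan k x = (\<Sum>j<k. Re (cinner (x \<cdot> e j) (w j)))"
    unfolding kyfan_def s
    by (intro sum.cong refl) (simp add: w_def eigsysD(2,7)[OF es] cinner_simps abs_mult_sgn abs_sgn)
  ultimately show ?thesis using that e eigsysD(8)[OF es] by blast
qed

lemma kyfan_lipschitz_aux:
  assumes "compact_hermitian x" "compact_hermitian y"
  shows "kyfan k x \<le> kyfan k y + k * norm (x - y)"
proof -
  obtain v w where vw: "suborthonormal_on {..<k} v" "suborthonormal_on {..<k} w"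
    and k: "kyfan k x = (\<Sum>j<k. Re (cinner (x \<cdot> v j) (w j)))"
    using kyfan_attained[OF assms(1), of k] by blast
  have "Re (cinner (x \<cdot> v j) (w j)) \<le> cmod (cinner (y \<cdot> v j) (w j)) + norm (x - y)" if "j < k" for j
  proof -
    have "cmod (cinner ((x - y) \<cdot> v j) (w j)) \<le> norm ((x - y) \<cdot> v j) * norm (w j)" by (rule Cauchy_Schwarz)
    also have "\<dots> \<le> (norm (x - y) * norm (v j)) * norm (w j)" by (intro mult_right_mono norm_bop_apply) auto
    also have "\<dots> \<le> (norm (x - y) * 1) * 1"
      using that vw by (intro mult_mono) (auto simp: suborthonormal_on_def)
    finally have "cmod (cinner ((x - y) \<cdot> v j) (w j)) \<le> norm (x - y)" by simp
    moreover have "cinner (x \<cdot> v j) (w j) = cinner (y \<cdot> v j) (w j) + cinner ((x - y) \<cdot> v j) (w j)"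
      by (simp add: bop_simps cinner_simps)
    then have "cmod (cinner (x \<cdot> v j) (w j)) \<le> cmod (cinner (y \<cdot> v j) (w j)) + cmod (cinner ((x - y) \<cdot> v j) (w j))"
      by (simp only: norm_triangle_ineq)
    ultimately show ?thesis
      using complex_Re_le_cmod[of "cinner (x \<cdot> v j) (w j)"] by simp
  qed
  then have "kyfan k x \<le> (\<Sum>j<k. cmod (cinner (y \<cdot> v j) (w j)) + norm (x - y))"
    unfolding k by (intro sum_mono) auto
  also have "\<dots> \<le> kyfan k y + k * norm (x - y)"
    using kyfan_upper[OF assms(2) vw] by (simp add: sum.distrib)
  finally show ?thesis .
qed

text \<open>Singular values are differences of consecutive Ky Fan sums, so this provides their
  continuity along norm continuous curves.\<close>

lemma kyfan_lipschitz:
  assumes "compact_hermitian x" "compact_hermitian y"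
  shows "\<bar>kyfan k x - kyfan k y\<bar> \<le> k * norm (x - y)"
  using kyfan_lipschitz_aux[OF assms, of k] kyfan_lipschitz_aux[OF assms(2,1), of k]
  by (simp add: norm_minus_commute abs_le_iff)

lemma singular_values_kyfan: "singular_values x j = kyfan (Suc j) x - kyfan j x"
  by (simp add: kyfan_def)

lemma compact_hermitian_singular_values:
  assumes "compact_hermitian x"
  shows "decseq (singular_values x)" "singular_values x \<longlonglongrightarrow> 0" "0 \<le> singular_values x j"
    "singular_values x j \<le> norm x"
proof -
  obtain e l where es: "eigsys x e l" and s: "singular_values x = (\<lambda>j. \<bar>l j\<bar>)"
    using compact_hermitian_eigsys[OF assms(1)] by blast
  show "decseq (singular_values x)" "singular_values x \<longlonglongrightarrow> 0" "0 \<le> singular_values x j"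
    using eigsysD(4,6)[OF es] by (simp_all add: s)
  show "singular_values x j \<le> norm x"
    using norm_bop_apply[of x "e j"] by (simp add: s eigsysD(2,8)[OF es] norm_scaleC)
qed

subsection \<open>Diagonal operators\<close>

lemma bop_eq_on_orthonormal:
  fixes x y :: "'a::complex_hilbert bop"
  assumes e: "orthonormal_on UNIV (e::nat \<Rightarrow> 'a)" and "\<And>n. x \<cdot> e n = y \<cdot> e n"
    "\<And>v. (\<And>n. cinner v (e n) = 0) \<Longrightarrow> x \<cdot> v = y \<cdot> v"
  shows "x = y"
proof (rule bop_eqI)
  fix v
  obtain w where w: "(\<lambda>n. cinner v (e n) *\<^sub>C e n) sums (v - w)" "\<And>n. cinner w (e n) = 0"
    using orthonormal_decomposition[OF e] by blast
  have "x \<cdot> (v - w) = y \<cdot> (v - w)"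
    using bounded_linear.sums[OF bounded_linear_bop_apply[of x] w(1)]
      bounded_linear.sums[OF bounded_linear_bop_apply[of y] w(1)] assms(2)
    by (simp add: bop_apply_scaleC sums_unique2)
  then show "x \<cdot> v = y \<cdot> v" using assms(3)[OF w(2)] by (simp add: bop_apply_diff)
qed

text \<open>With two families the same construction yields diagonal operators (e = f) and the
  operators that carry one orthonormal family to multiples of another.\<close>

lemma exists_diagonal_op:
  fixes e f :: "nat \<Rightarrow> 'a::complex_hilbert"
  assumes e: "orthonormal_on UNIV e" and f: "orthonormal_on UNIV f" and c: "\<And>n. cmod (c n) \<le> B"
  obtains x where "\<And>n. x \<cdot> e n = c n *\<^sub>C f n" "\<And>v. (\<And>n. cinner v (e n) = 0) \<Longrightarrow> x \<cdot> v = 0"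
    "\<And>v. (\<lambda>n. (c n * cinner v (e n)) *\<^sub>C f n) sums (x \<cdot> v)"
proof -
  have B0: "B \<ge> 0" using c[of 0] norm_ge_zero order_trans by blast
  have le: "(cmod (c n * cinner v (e n)))\<^sup>2 \<le> B\<^sup>2 * (cmod (cinner v (e n)))\<^sup>2" for n v
    using c[of n] by (simp add: norm_mult power_mult_distrib mult_right_mono power_mono)
  have sm: "summable (\<lambda>n. (c n * cinner v (e n)) *\<^sub>C f n)" for v
  proof (intro orthonormal_series_summable f)
    show "summable (\<lambda>n. (cmod (c n * cinner v (e n)))\<^sup>2)"
      by (rule summable_comparison_test'[OF summable_mult[OF Bessel_summable[OF e, of v], of "B\<^sup>2"], of 0])
        (use le in simp)
  qed
  define g where "g v = (\<Sum>n. (c n * cinner v (e n)) *\<^sub>C f n)" for v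
  have gs: "(\<lambda>n. (c n * cinner v (e n)) *\<^sub>C f n) sums g v" for v
    unfolding g_def using sm by (rule summable_sums)
  have gn: "norm (g v) \<le> B * norm v" for v
  proof (rule LIMSEQ_le_const2)
    show "(\<lambda>M. norm (\<Sum>n<M. (c n * cinner v (e n)) *\<^sub>C f n)) \<longlonglongrightarrow> norm (g v)"
      using gs[of v] by (intro tendsto_norm) (simp add: sums_def)
    have "norm (\<Sum>n<M. (c n * cinner v (e n)) *\<^sub>C f n) \<le> B * norm v" for M
    proof (rule power2_le_imp_le)
      have "(norm (\<Sum>n<M. (c n * cinner v (e n)) *\<^sub>C f n))\<^sup>2
          = (\<Sum>n<M. (cmod (c n * cinner v (e n)))\<^sup>2 * (norm (f n))\<^sup>2)"
        using f by (intro norm_sum_orthogonal) (auto simp: orthonormal_on_def)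
      also have "\<dots> \<le> (\<Sum>n<M. B\<^sup>2 * (cmod (cinner v (e n)))\<^sup>2)"
        using le orthonormal_on_norm[OF f] by (intro sum_mono) simp
      also have "\<dots> \<le> B\<^sup>2 * (norm v)\<^sup>2"
        unfolding sum_distrib_left[symmetric]
        by (intro mult_left_mono Bessel orthonormal_on_imp_suborthonormal_on orthonormal_on_subset[OF e]) auto
      finally show "(norm (\<Sum>n<M. (c n * cinner v (e n)) *\<^sub>C f n))\<^sup>2 \<le> (B * norm v)\<^sup>2"
        by (simp add: power_mult_distrib)
    qed (use B0 in simp)
    then show "\<exists>M. \<forall>n\<ge>M. norm (\<Sum>i<n. (c i * cinner v (e i)) *\<^sub>C f i) \<le> B * norm v" by blast
  qed
  obtain x where x: "\<And>v. x \<cdot> v = g v"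
  proof (rule exists_bop[of g B])
    fix v w and a :: complex
    show "g (v + w) = g v + g w"
      using sums_add[OF gs[of v] gs[of w]] gs[of "v + w"]
      by (simp add: cinner_simps distrib_left scaleC_add_left sums_unique2)
    show "g (a *\<^sub>C v) = a *\<^sub>C g v"
      using bounded_linear.sums[OF bounded_linear_scaleC[of a] gs[of v]] gs[of "a *\<^sub>C v"]
      by (simp add: cinner_simps scaleC_scaleC mult.left_commute sums_unique2)
  qed (use gn in blast)+
  have "x \<cdot> e m = c m *\<^sub>C f m" for m
  proof -
    have "(\<lambda>n. (c n * cinner (e m) (e n)) *\<^sub>C f n) = (\<lambda>n. if n = m then c n *\<^sub>C f n else 0)"
      using e by (auto simp: orthonormal_on_def complex_vector.scale_zero_left)
    then show ?thesis using gs[of "e m"] sums_single[of m "\<lambda>n. c n *\<^sub>C f n"] sums_unique2 x by metis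
  qed
  moreover have "x \<cdot> v = 0" if "\<And>n. cinner v (e n) = 0" for v
    by (simp add: x g_def that complex_vector.scale_zero_left)
  ultimately show ?thesis using that gs x by metis
qed

text \<open>For bounded \<open>l\<close> the two conditions determine the operator, by
  \<open>diag_eq\<close>, so the choice is harmless.\<close>

definition diag :: "(nat \<Rightarrow> 'a::separable_infinite_hilbert) \<Rightarrow> (nat \<Rightarrow> real) \<Rightarrow> 'a bop" where
  "diag e l = (SOME x. (\<forall>n. x \<cdot> e n = complex_of_real (l n) *\<^sub>C e n) \<and>
     (\<forall>v. (\<forall>n. cinner v (e n) = 0) \<longrightarrow> x \<cdot> v = 0))"

lemma diag:
  assumes e: "orthonormal_on UNIV e" and l: "\<And>n. \<bar>l n\<bar> \<le> B"
  shows "diag e l \<cdot> e n = complex_of_real (l n) *\<^sub>C e n" "(\<And>n. cinner v (e n) = 0) \<Longrightarrow> diag e l \<cdot> v = 0"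
proof -
  obtain x where "\<And>n. x \<cdot> e n = complex_of_real (l n) *\<^sub>C e n" "\<And>v. (\<And>n. cinner v (e n) = 0) \<Longrightarrow> x \<cdot> v = 0"
    by (rule exists_diagonal_op[OF e e, of "\<lambda>n. complex_of_real (l n)" B]) (use l in auto)
  then have "\<exists>x. (\<forall>n. x \<cdot> e n = complex_of_real (l n) *\<^sub>C e n) \<and>
     (\<forall>v. (\<forall>n. cinner v (e n) = 0) \<longrightarrow> x \<cdot> v = 0)" by blast
  from someI_ex[OF this] show "diag e l \<cdot> e n = complex_of_real (l n) *\<^sub>C e n"
    "(\<And>n. cinner v (e n) = 0) \<Longrightarrow> diag e l \<cdot> v = 0" unfolding diag_def by blast+
qed

lemma diag_eq:
  assumes e: "orthonormal_on UNIV e" and l: "\<And>n. \<bar>l n\<bar> \<le> B"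
    and x: "\<And>n. x \<cdot> e n = complex_of_real (l n) *\<^sub>C e n" "\<And>v. (\<And>n. cinner v (e n) = 0) \<Longrightarrow> x \<cdot> v = 0"
  shows "x = diag e l"
  by (rule bop_eq_on_orthonormal[OF e]) (use diag[OF e l] x in auto)

lemma diag_add:
  assumes e: "orthonormal_on UNIV e" and l: "\<And>n. \<bar>l n\<bar> \<le> B" "\<And>n. \<bar>m n\<bar> \<le> B"
  shows "diag e (\<lambda>n. l n + m n) = diag e l + diag e m"
proof (rule diag_eq[OF e, symmetric])
  show "\<bar>l n + m n\<bar> \<le> 2 * B" for n using l(1)[of n] l(2)[of n] by linarith
qed (simp_all add: bop_simps diag[OF e l(1)] diag[OF e l(2)] scaleC_add_left)

lemma diag_eigsys:
  assumes e: "orthonormal_on UNIV e" and l: "decseq (\<lambda>n. \<bar>l n\<bar>)" "l \<longlonglongrightarrow> 0"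
  shows "eigsys (diag e l) e l" "compact_hermitian (diag e l)"
proof -
  have b: "\<bar>l n\<bar> \<le> \<bar>l 0\<bar>" for n using decseqD[OF l(1), of 0 n] by simp
  note d = diag[OF e, of l, OF b]
  show es: "eigsys (diag e l) e l" using d e l by (auto simp: eigsys_def)
  have sums: "(\<lambda>n. (cinner v (e n) * complex_of_real (l n)) *\<^sub>C e n) sums (diag e l \<cdot> v)" for v
    by (rule eigsys_expansion[OF es])
  have h: "hermitian (diag e l)" unfolding hermitian_cinner
  proof (intro allI)
    fix v w
    have "(\<lambda>n. cinner v (e n) * complex_of_real (l n) * cinner (e n) w) sums cinner (diag e l \<cdot> v) w"
      using bounded_linear.sums[OF bounded_linear_cinner_left sums, of v w] by (simp add: cinner_simps)
    moreover have "(\<lambda>n. cinner v (e n) * complex_of_real (l n) * cinner (e n) w) sums cinner v (diag e l \<cdot> w)"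
      using bounded_linear.sums[OF bounded_linear_cinner_right sums, of v w]
      by (simp add: cinner_simps mult_ac cinner_commute[of w])
    ultimately show "cinner (diag e l \<cdot> v) w = cinner v (diag e l \<cdot> w)" by (rule sums_unique2)
  qed
  have "compact_op (diag e l)"
  proof (rule compact_op_approx)
    fix \<epsilon> :: real assume \<epsilon>: "\<epsilon> > 0"
    have "\<forall>\<^sub>F n in sequentially. \<bar>l n\<bar> < \<epsilon>" by (rule order_tendstoD(2)[OF eigsysD(6)[OF es] \<epsilon>])
    then obtain M where M: "\<And>n. n \<ge> M \<Longrightarrow> \<bar>l n\<bar> < \<epsilon>" unfolding eventually_sequentially by blast
    have "norm (diag e l \<cdot> v) \<le> \<epsilon> * norm v" if v: "\<forall>f\<in>e ` {..<M}. cinner v f = 0" for v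
    proof -
      \<comment> \<open>On v orthogonal to the first M vectors, dropping the first M entries changes
        nothing, and the remaining entries are bounded by \<open>\<epsilon>\<close>.\<close>
      define c where "c n = complex_of_real (if n < M then 0 else l n)" for n
      obtain x where x: "\<And>n. x \<cdot> e n = c n *\<^sub>C e n" "\<And>v. (\<And>n. cinner v (e n) = 0) \<Longrightarrow> x \<cdot> v = 0"
        "\<And>v. (\<lambda>n. (c n * cinner v (e n)) *\<^sub>C e n) sums (x \<cdot> v)"
        by (rule exists_diagonal_op[OF e e, of c \<epsilon>]) (use M \<epsilon> in \<open>auto simp: c_def less_imp_le\<close>)
      have "(\<lambda>n. (c n * cinner v (e n)) *\<^sub>C e n) = (\<lambda>n. (cinner v (e n) * complex_of_real (l n)) *\<^sub>C e n)"
        using v by (auto simp: c_def)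
      then have xv: "diag e l \<cdot> v = x \<cdot> v" using x(3)[of v] sums[of v] sums_unique2 by metis
      have "norm (\<Sum>n<k. (c n * cinner v (e n)) *\<^sub>C e n) \<le> \<epsilon> * norm v" for k
      proof (rule power2_le_imp_le)
        have ce: "(cmod (c n * cinner v (e n)))\<^sup>2 \<le> \<epsilon>\<^sup>2 * (cmod (cinner v (e n)))\<^sup>2" for n
          using M[of n] \<epsilon> by (auto simp: c_def norm_mult power_mult_distrib intro!: mult_right_mono power_mono abs_le_square_iff[THEN iffD1])
        have "(norm (\<Sum>n<k. (c n * cinner v (e n)) *\<^sub>C e n))\<^sup>2
            = (\<Sum>n<k. (cmod (c n * cinner v (e n)))\<^sup>2 * (norm (e n))\<^sup>2)"
          using e by (intro norm_sum_orthogonal) (auto simp: orthonormal_on_def)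
        also have "\<dots> \<le> (\<Sum>n<k. \<epsilon>\<^sup>2 * (cmod (cinner v (e n)))\<^sup>2)"
          using ce orthonormal_on_norm[OF e] by (intro sum_mono) simp
        also have "\<dots> \<le> \<epsilon>\<^sup>2 * (norm v)\<^sup>2"
          unfolding sum_distrib_left[symmetric]
          by (intro mult_left_mono Bessel orthonormal_on_imp_suborthonormal_on orthonormal_on_subset[OF e]) auto
        finally show "(norm (\<Sum>n<k. (c n * cinner v (e n)) *\<^sub>C e n))\<^sup>2 \<le> (\<epsilon> * norm v)\<^sup>2"
          by (simp add: power_mult_distrib)
      qed (use \<epsilon> in simp)
      then show ?thesis unfolding xv
        using LIMSEQ_le_const2[OF tendsto_norm[OF x(3)[of v, unfolded sums_def]]] by blast
    qed
    then show "\<exists>F. finite F \<and> (\<forall>v. (\<forall>f\<in>F. cinner v f = 0) \<longrightarrow> norm (diag e l \<cdot> v) \<le> \<epsilon> * norm v)"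
      by (intro exI[of _ "e ` {..<M}"]) auto
  qed
  then show "compact_hermitian (diag e l)" using h by (simp add: compact_hermitian_def)
qed

lemma eigsys_diag:
  assumes "eigsys x e l"
  shows "x = diag e l"
proof (rule diag_eq[OF eigsysD(1)[OF assms]])
  show "\<bar>l n\<bar> \<le> \<bar>l 0\<bar>" for n using decseqD[OF eigsysD(4)[OF assms], of 0 n] by simp
qed (use eigsysD(2,3)[OF assms] in auto)

subsection \<open>Symmetric norms and their ideals\<close>

lemma scaleC_of_real_bop: "complex_of_real r *\<^sub>C x = r *\<^sub>R (x::'a::complex_hilbert bop)"
  by (rule bop_eqI) (simp add: bop_simps scaleC_of_real)

context symmetric_norm
begin

text \<open>\<open>enn2real\<close> sends infinity to 0, so \<open>nu\<close> agrees with the norm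
  only on \<open>norm_ideal N\<close>.\<close>

definition nu :: "'h bop \<Rightarrow> real" where "nu x = enn2real (N x)"

lemma N_scaleR: "N (r *\<^sub>R x) = ennreal \<bar>r\<bar> * N x"
  using scaleC[of "complex_of_real r" x] by (simp add: scaleC_of_real_bop)

lemma N_uminus: "N (- x) = N x"
  using N_scaleR[of "-1" x] by simp

lemma N_minus_commute: "N (x - y) = N (y - x)"
  using N_uminus[of "x - y"] by simp

lemma N_mult_left: "N (x * y) \<le> ennreal (norm x) * N y"
  using ideal[of x y 1] by simp

lemma N_mult_right: "N (y * x) \<le> N y * ennreal (norm x)"
  using ideal[of 1 y x] by simp

lemma norm_ideal_nu: "x \<in> norm_ideal N \<Longrightarrow> N x = ennreal (nu x)"
  by (simp add: norm_ideal_def nu_def)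

lemma nu_nonneg: "0 \<le> nu x" by (simp add: nu_def)

lemma nu_pos: "x \<in> norm_ideal N \<Longrightarrow> x \<noteq> 0 \<Longrightarrow> 0 < nu x"
  using norm_ideal_nu[of x] zero_iff[of x] nu_nonneg[of x] by (metis ennreal_0 order_le_less)

lemma norm_ideal_zero [simp]: "0 \<in> norm_ideal N" 
  using zero_iff[of 0] by (simp add: norm_ideal_def)

lemma norm_ideal_add: "x \<in> norm_ideal N \<Longrightarrow> y \<in> norm_ideal N \<Longrightarrow> x + y \<in> norm_ideal N"
  using triangle[of x y] by (auto simp: norm_ideal_def intro: le_less_trans)

lemma norm_ideal_uminus: "x \<in> norm_ideal N \<Longrightarrow> - x \<in> norm_ideal N"
  by (simp add: norm_ideal_def N_uminus)

lemma norm_ideal_diff: "x \<in> norm_ideal N \<Longrightarrow> y \<in> norm_ideal N \<Longrightarrow> x - y \<in> norm_ideal N"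
  using norm_ideal_add[of x "-y"] norm_ideal_uminus[of y] by simp

lemma norm_ideal_scaleC: "x \<in> norm_ideal N \<Longrightarrow> c *\<^sub>C x \<in> norm_ideal N"
  by (simp add: norm_ideal_def scaleC ennreal_mult_less_top)

lemma norm_ideal_scaleR: "x \<in> norm_ideal N \<Longrightarrow> r *\<^sub>R x \<in> norm_ideal N"
  by (simp add: norm_ideal_def N_scaleR ennreal_mult_less_top)

lemma norm_ideal_mult_left: "y \<in> norm_ideal N \<Longrightarrow> x * y \<in> norm_ideal N"
  using N_mult_left[of x y] by (auto simp: norm_ideal_def ennreal_mult_less_top intro: le_less_trans)

lemma norm_ideal_mult_right: "y \<in> norm_ideal N \<Longrightarrow> y * x \<in> norm_ideal N"
  using N_mult_right[of y x] by (auto simp: norm_ideal_def ennreal_mult_less_top intro: le_less_trans)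

lemma nu_triangle: "x \<in> norm_ideal N \<Longrightarrow> y \<in> norm_ideal N \<Longrightarrow> nu (x + y) \<le> nu x + nu y"
  using triangle[of x y] norm_ideal_add[of x y]
  by (simp add: norm_ideal_nu nu_nonneg flip: ennreal_plus)

lemma nu_diff_le: "x \<in> norm_ideal N \<Longrightarrow> y \<in> norm_ideal N \<Longrightarrow> \<bar>nu x - nu y\<bar> \<le> nu (x - y)"
  using nu_triangle[of "x - y" y] nu_triangle[of "y - x" x] norm_ideal_diff[of x y] norm_ideal_diff[of y x]
    N_minus_commute[of x y] by (simp add: nu_def[of "_ - _"])

end

section \<open>Unitary operators and rank one operators\<close>

lemma unitary_norm: "unitary u \<Longrightarrow> norm (u \<cdot> v) = norm v"
proof -
  assume "unitary u"
  then have "adj u \<cdot> u \<cdot> v = v" by (metis one_bop_apply times_bop_apply unitary_def)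
  then have "(norm (u \<cdot> v))\<^sup>2 = (norm v)\<^sup>2"
    unfolding norm_eq_Re_cinner by (metis cinner_adj_right)
  then show ?thesis by (simp add: power2_eq_iff_nonneg)
qed

lemma unitary_norm_le: "unitary u \<Longrightarrow> norm u \<le> 1"
  by (rule norm_bop_bound) (simp_all add: unitary_norm)

lemma unitary_adj: "unitary u \<Longrightarrow> unitary (adj u)"
  by (simp add: unitary_def)

lemma unitary_mult: "unitary u \<Longrightarrow> unitary v \<Longrightarrow> unitary (u * v)"
  unfolding unitary_def adj_times by (metis mult.assoc mult.left_neutral)

lemma (in symmetric_norm) N_unitary_left: "unitary u \<Longrightarrow> N (u * x) = N x"
proof (rule antisym)
  assume u: "unitary u"
  have le: "N (w * y) \<le> N y" if "unitary w" for w y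
  proof -
    have "N (w * y) \<le> ennreal (norm w) * N y" by (rule N_mult_left)
    also have "\<dots> \<le> ennreal 1 * N y" by (intro mult_right_mono ennreal_leI unitary_norm_le that) simp
    finally show ?thesis by simp
  qed
  show "N (u * x) \<le> N x" by (rule le[OF u])
  have "N (adj u * (u * x)) \<le> N (u * x)" by (rule le[OF unitary_adj[OF u]])
  also have "adj u * (u * x) = x" using u by (simp add: unitary_def mult.assoc[symmetric])
  finally show "N x \<le> N (u * x)" .
qed

lemma exists_rank_one:
  fixes a b :: "'a::complex_hilbert"
  obtains x where "\<And>v. x \<cdot> v = cinner v b *\<^sub>C a" "norm x \<le> norm a * norm b"
proof -
  have bd: "norm (cinner v b *\<^sub>C a) \<le> (norm a * norm b) * norm v" for v
    using mult_right_mono[OF Cauchy_Schwarz[of v b], of "norm a"] by (simp add: norm_scaleC ac_simps)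
  obtain x where x: "\<And>v. x \<cdot> v = cinner v b *\<^sub>C a"
    by (rule exists_bop[of "\<lambda>v. cinner v b *\<^sub>C a"])
      (use bd in \<open>auto simp: cinner_simps scaleC_add_left scaleC_scaleC\<close>)
  then show ?thesis using bd by (intro that norm_bop_bound) auto
qed

subsection \<open>Symmetric gauge functions and weak majorization\<close>

definition trunc :: "nat \<Rightarrow> (nat \<Rightarrow> real) \<Rightarrow> nat \<Rightarrow> real" where
  "trunc n a = (\<lambda>j. if j < n then a j else 0)"

lemma finite_trunc: "finite {j. trunc n a j \<noteq> 0}"
  by (rule finite_subset[of _ "{..<n}"]) (auto simp: trunc_def split: if_splits)

text \<open>Summation by parts in the form of an induction: since partial sums of \<open>d\<close>
  are nonnegative, replacing the factor \<open>a k\<close> by the smaller \<open>a (Suc k)\<close>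
  can only decrease the bound.\<close>

lemma Abel_nonneg:
  fixes a d :: "nat \<Rightarrow> real"
  assumes a: "\<And>j. Suc j < n \<Longrightarrow> a (Suc j) \<le> a j" "\<And>j. j < n \<Longrightarrow> 0 \<le> a j"
    and D: "\<And>k. k \<le> n \<Longrightarrow> 0 \<le> (\<Sum>j<k. d j)"
  shows "0 \<le> (\<Sum>j<n. a j * d j)"
proof -
  have "a k * (\<Sum>j<Suc k. d j) \<le> (\<Sum>j<Suc k. a j * d j)" if "k < n" for k
    using that
  proof (induction k)
    case (Suc k)
    have "a (Suc k) * (\<Sum>j<Suc k. d j) \<le> a k * (\<Sum>j<Suc k. d j)"
      using Suc.prems by (intro mult_right_mono a D) auto
    then show ?case using Suc by (simp add: algebra_simps)
  qed simp
  note k = this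
  show ?thesis
  proof (cases n)
    case (Suc m)
    have "0 \<le> a m * (\<Sum>j<n. d j)" using a(2)[of m] D[of n] Suc by (intro mult_nonneg_nonneg) auto
    then show ?thesis using k[of m] unfolding Suc by linarith
  qed simp
qed

lemma exists_decreasing_permutation:
  fixes w :: "nat \<Rightarrow> real"
  obtains p where "bij_betw p {..<n} {..<n}" "\<And>i j. i \<le> j \<Longrightarrow> j < n \<Longrightarrow> w (p j) \<le> w (p i)"
proof -
  define ys where "ys = sort_key (\<lambda>i. - w i) [0..<n]"
  have len: "length ys = n" and dis: "distinct ys" and st: "set ys = {..<n}"
    by (auto simp: ys_def)
  have srt: "sorted (map (\<lambda>i. - w i) ys)" by (simp add: ys_def)
  have "bij_betw ((!) ys) {..<n} {..<n}"
    by (rule bij_betw_nth[OF dis]) (simp_all add: len st)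
  moreover have "w (ys ! j) \<le> w (ys ! i)" if "i \<le> j" "j < n" for i j
    using sorted_nth_mono[OF srt that(1)] that(1,2) len by simp
  ultimately show ?thesis by (rule that)
qed

context symmetric_gauge
begin

lemma trunc_nonneg: "0 \<le> \<phi> (trunc n a)" by (rule nonneg[OF finite_trunc])

lemma trunc_scale: "\<phi> (trunc n (\<lambda>j. r * a j)) = \<bar>r\<bar> * \<phi> (trunc n a)"
proof -
  have "trunc n (\<lambda>j. r * a j) = (\<lambda>j. r * trunc n a j)" by (auto simp: trunc_def)
  then show ?thesis using scale[OF finite_trunc] by simp
qed

lemma trunc_triangle: "\<phi> (trunc n (\<lambda>j. a j + b j)) \<le> \<phi> (trunc n a) + \<phi> (trunc n b)"
proof -
  have "trunc n (\<lambda>j. a j + b j) = (\<lambda>j. trunc n a j + trunc n b j)" by (auto simp: trunc_def)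
  then show ?thesis using triangle[OF finite_trunc finite_trunc] by simp
qed

lemma trunc_cong: "(\<And>j. j < n \<Longrightarrow> a j = b j) \<Longrightarrow> \<phi> (trunc n a) = \<phi> (trunc n b)"
  by (rule arg_cong[of _ _ \<phi>]) (auto simp: trunc_def)

text \<open>Hahn--Banach in finite dimension: the coordinates of a norming functional are chosen one by one.\<close>
lemma exists_norming_weights:
  obtains w where "(\<Sum>j<n. w j * b j) = \<phi> (trunc n b)" "\<And>c. (\<Sum>j<n. w j * c j) \<le> \<phi> (trunc n c)"
proof -
  \<comment> \<open>A pair (r, c) stands for the vector r b + c. The functional is prescribed as r
    times the gauge of b and is extended to one more coordinate of c at a time.\<close>
  define q where "q r c = \<phi> (trunc n (\<lambda>j. r * b j + c j))" for r c
  have q_add: "q (r + s) (\<lambda>j. c j + d j) \<le> q r c + q s d" for r s c d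
    using trunc_triangle[of n "\<lambda>j. r * b j + c j" "\<lambda>j. s * b j + d j"]
    by (simp add: q_def algebra_simps)
  have q_scale: "q (t * r) (\<lambda>j. t * c j) = t * q r c" if "t > 0" for t r c
    using trunc_scale[of n t "\<lambda>j. r * b j + c j"] that by (simp add: q_def algebra_simps)
  have "\<exists>w. \<forall>r c. (\<forall>j\<ge>m. c j = 0) \<longrightarrow> r * \<phi> (trunc n b) + (\<Sum>j<m. w j * c j) \<le> q r c" for m
  proof (induction m)
    case 0
    have "r * \<phi> (trunc n b) \<le> q r c" if "\<forall>j. c j = 0" for r c
      using trunc_scale[of n r b] mult_right_mono[OF abs_ge_self[of r] trunc_nonneg[of n b]] that
      by (simp add: q_def)
    then show ?case by simp
  next
    case (Suc m)
    then obtain w where w: "\<And>r c. (\<forall>j\<ge>m. c j = 0) \<Longrightarrow> r * \<phi> (trunc n b) + (\<Sum>j<m. w j * c j) \<le> q r c" by blast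
    define f where "f r c = r * \<phi> (trunc n b) + (\<Sum>j<m. w j * c j)" for r c
    define \<delta> where "\<delta> t = (\<lambda>j. if j = m then t else (0::real))" for t :: real
    define Z where "Z = {c :: nat \<Rightarrow> real. \<forall>j\<ge>m. c j = 0}"
    define A where "A = {f r c - q r (\<lambda>j. c j + \<delta> (-1) j) | r c. c \<in> Z}"
    have AB: "f r c - q r (\<lambda>j. c j + \<delta> (-1) j) \<le> q s (\<lambda>j. d j + \<delta> 1 j) - f s d" if "c \<in> Z" "d \<in> Z" for r c s d
    proof -
      have "f r c + f s d = f (r + s) (\<lambda>j. c j + d j)"
        by (simp add: f_def algebra_simps sum.distrib)
      also have "\<dots> \<le> q (r + s) (\<lambda>j. c j + d j)"
        unfolding f_def by (rule w) (use that in \<open>auto simp: Z_def\<close>)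
      also have "(\<lambda>j. c j + d j) = (\<lambda>j. (c j + \<delta> (-1) j) + (d j + \<delta> 1 j))" by (auto simp: \<delta>_def)
      also have "q (r + s) \<dots> \<le> q r (\<lambda>j. c j + \<delta> (-1) j) + q s (\<lambda>j. d j + \<delta> 1 j)" by (rule q_add)
      finally show ?thesis by simp
    qed
    have Z0: "(\<lambda>j. 0) \<in> Z" by (simp add: Z_def)
    have bdd: "bdd_above A"
      by (rule bdd_aboveI[of _ "q 0 (\<lambda>j. 0 + \<delta> 1 j) - f 0 (\<lambda>j. 0)"]) (use AB[OF _ Z0] in \<open>auto simp: A_def\<close>)
    \<comment> \<open>The value on the new coordinate vector has to lie above all lower bounds and
      below all upper bounds; \<open>AB\<close> says that these are separated.\<close>
    define y where "y = Sup A"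
    have lo: "f r c - q r (\<lambda>j. c j + \<delta> (-1) j) \<le> y" if "c \<in> Z" for r c
      unfolding y_def by (rule cSup_upper[OF _ bdd]) (use that in \<open>auto simp: A_def\<close>)
    have hi: "y \<le> q s (\<lambda>j. d j + \<delta> 1 j) - f s d" if "d \<in> Z" for s d
      unfolding y_def by (rule cSup_least) (use Z0 AB that in \<open>auto simp: A_def\<close>)
    have key: "f r c + y * t \<le> q r (\<lambda>j. c j + \<delta> t j)" if c: "c \<in> Z" for r c t
    proof (cases t "0::real" rule: linorder_cases)
      case equal
      then show ?thesis using w[of c r] c by (simp add: Z_def f_def \<delta>_def)
    next
      case greater
      have "y \<le> q (r / t) (\<lambda>j. c j / t + \<delta> 1 j) - f (r / t) (\<lambda>j. c j / t)"
        by (rule hi) (use c in \<open>auto simp: Z_def\<close>)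
      then have "t * y \<le> t * q (r / t) (\<lambda>j. c j / t + \<delta> 1 j) - t * f (r / t) (\<lambda>j. c j / t)"
        using greater by (simp add: right_diff_distrib[symmetric])
      also have "t * q (r / t) (\<lambda>j. c j / t + \<delta> 1 j) = q r (\<lambda>j. c j + \<delta> t j)"
        using greater q_scale[OF greater, of "r/t" "\<lambda>j. c j / t + \<delta> 1 j"]
        by (simp add: distrib_left \<delta>_def if_distrib cong: if_cong)
      also have "t * f (r / t) (\<lambda>j. c j / t) = f r c"
        using greater by (simp add: f_def distrib_left sum_distrib_left)
      finally show ?thesis by (simp add: mult.commute)
    next
      case less
      obtain s where t: "t = - s" using minus_minus[of t] by metis
      have s: "s > 0" using less by (simp add: t)
      have "f (r / s) (\<lambda>j. c j / s) - q (r / s) (\<lambda>j. c j / s + \<delta> (-1) j) \<le> y"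
        by (rule lo) (use c in \<open>auto simp: Z_def\<close>)
      then have "s * f (r / s) (\<lambda>j. c j / s) - s * q (r / s) (\<lambda>j. c j / s + \<delta> (-1) j) \<le> s * y"
        using s by (simp add: right_diff_distrib[symmetric])
      also have "s * q (r / s) (\<lambda>j. c j / s + \<delta> (-1) j) = q r (\<lambda>j. c j + \<delta> t j)"
      proof -
        have "(\<lambda>j. s * (c j / s + \<delta> (-1) j)) = (\<lambda>j. c j + \<delta> t j)"
          using s by (intro ext) (simp add: \<delta>_def t field_simps)
        then show ?thesis using s q_scale[OF s, of "r/s" "\<lambda>j. c j / s + \<delta> (-1) j"] by simp
      qed
      also have "s * f (r / s) (\<lambda>j. c j / s) = f r c"
        using s by (simp add: f_def distrib_left sum_distrib_left)
      finally show ?thesis by (simp add: t mult.commute)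
    qed
    show ?case
    proof (intro exI allI impI)
      fix r and c :: "nat \<Rightarrow> real" assume c: "\<forall>j\<ge>Suc m. c j = 0"
      define d where "d = (\<lambda>j. if j = m then 0 else c j)"
      have "d \<in> Z" using c by (auto simp: d_def Z_def)
      have "c = (\<lambda>j. d j + \<delta> (c m) j)" by (auto simp: d_def \<delta>_def)
      then have "f r d + y * c m \<le> q r c" using key[OF \<open>d \<in> Z\<close>, of r "c m"] by simp
      moreover have "(\<Sum>j<m. w j * d j) = (\<Sum>j<m. w j * c j)" by (intro sum.cong) (auto simp: d_def)
      moreover have "(\<Sum>j<m. (w(m := y)) j * c j) = (\<Sum>j<m. w j * c j)" by (intro sum.cong) auto
      ultimately show "r * \<phi> (trunc n b) + (\<Sum>j<Suc m. (w(m := y)) j * c j) \<le> q r c"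
        by (simp add: f_def)
    qed
  qed
  then obtain w where w: "\<And>r c. (\<forall>j\<ge>n. c j = 0) \<Longrightarrow> r * \<phi> (trunc n b) + (\<Sum>j<n. w j * c j) \<le> q r c" by blast
  have le: "(\<Sum>j<n. w j * c j) \<le> \<phi> (trunc n c)" for c
  proof -
    have "(\<Sum>j<n. w j * c j) = (\<Sum>j<n. w j * trunc n c j)" by (intro sum.cong) (auto simp: trunc_def)
    also have "\<dots> \<le> q 0 (trunc n c)" using w[of "trunc n c" 0] by (simp add: trunc_def)
    also have "\<dots> = \<phi> (trunc n c)" unfolding q_def by (rule trunc_cong) (simp add: trunc_def)
    finally show ?thesis .
  qed
  \<comment> \<open>The pair (1, -b) stands for the zero vector, which forces the prescribed value
    on b to agree with that of the weights.\<close>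
  have "\<phi> (trunc n b) - (\<Sum>j<n. w j * b j) \<le> 0"
  proof -
    have "1 * \<phi> (trunc n b) + (\<Sum>j<n. w j * (- trunc n b j)) \<le> q 1 (\<lambda>j. - trunc n b j)"
      by (rule w) (simp add: trunc_def)
    also have "q 1 (\<lambda>j. - trunc n b j) = \<phi> (trunc n (\<lambda>j. 0 * b j))"
      unfolding q_def by (rule trunc_cong) (simp add: trunc_def)
    also have "\<dots> = 0" unfolding trunc_scale by simp
    also have "(\<Sum>j<n. w j * (- trunc n b j)) = - (\<Sum>j<n. w j * b j)"
      unfolding sum_negf[symmetric] by (intro sum.cong) (auto simp: trunc_def)
    finally show ?thesis by simp
  qed
  then have "(\<Sum>j<n. w j * b j) = \<phi> (trunc n b)" using le[of b] by simp
  then show ?thesis using le that by blast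
qed

lemma trunc_signed_permutation:
  assumes p: "bij_betw p {..<n} {..<n}" and s: "\<And>j. \<bar>s j\<bar> = 1"
  shows "\<phi> (trunc n (\<lambda>j. s j * b (p j))) = \<phi> (trunc n b)"
proof -
  define P where "P j = (if j < n then p j else j)" for j
  have bij: "bij P"
  proof -
    have "bij_betw P ({..<n} \<union> {n..}) ({..<n} \<union> {n..})"
    proof (rule bij_betw_combine)
      show "bij_betw P {..<n} {..<n}" using p by (subst bij_betw_cong[of _ _ p]) (auto simp: P_def)
      show "bij_betw P {n..} {n..}" by (subst bij_betw_cong[of _ _ id]) (auto simp: P_def)
    qed auto
    moreover have "{..<n} \<union> {n..} = UNIV" by auto
    ultimately show ?thesis by simp
  qed
  have "\<phi> (trunc n (\<lambda>j. s j * b (p j))) = \<phi> (\<lambda>j. \<bar>trunc n (\<lambda>j. s j * b (p j)) j\<bar>)"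
    by (rule abs[OF finite_trunc, symmetric])
  also have "(\<lambda>j. \<bar>trunc n (\<lambda>j. s j * b (p j)) j\<bar>) = (\<lambda>j. \<bar>trunc n (\<lambda>j. b (p j)) j\<bar>)"
    using s by (auto simp: trunc_def abs_mult)
  also have "\<phi> \<dots> = \<phi> (trunc n (\<lambda>j. b (p j)))" by (rule abs[OF finite_trunc])
  also have "trunc n (\<lambda>j. b (p j)) = (\<lambda>j. trunc n b (P j))"
    using bij_betwE[OF p] by (auto simp: trunc_def P_def)
  also have "\<phi> \<dots> = \<phi> (trunc n b)" by (rule permute[OF finite_trunc bij])
  finally show ?thesis .
qed

text \<open>Take weights \<open>w\<close> norming \<open>a\<close> and let m be the decreasing
  rearrangement of |w|. Then w.a is at most m.a by Abel summation, m.a is at most m.b by Abel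
  summation again, and m.b equals w applied to a signed permutation of b, whose gauge is that of b.
  The sequence \<open>b\<close> may be unordered.\<close>

lemma weak_majorization:
  assumes a: "\<And>j. Suc j < n \<Longrightarrow> a (Suc j) \<le> a j" "\<And>j. j < n \<Longrightarrow> 0 \<le> a j"
    and ab: "\<And>k. k \<le> n \<Longrightarrow> (\<Sum>j<k. a j) \<le> (\<Sum>j<k. b j)"
  shows "\<phi> (trunc n a) \<le> \<phi> (trunc n b)"
proof -
  obtain w where w: "(\<Sum>j<n. w j * a j) = \<phi> (trunc n a)" "\<And>c. (\<Sum>j<n. w j * c j) \<le> \<phi> (trunc n c)"
    using exists_norming_weights by blast
  obtain p where p: "bij_betw p {..<n} {..<n}" "\<And>i j. i \<le> j \<Longrightarrow> j < n \<Longrightarrow> \<bar>w (p j)\<bar> \<le> \<bar>w (p i)\<bar>"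
    using exists_decreasing_permutation[of n "\<lambda>j. \<bar>w j\<bar>"] by blast
  \<comment> \<open>Truncation keeps the sequence decreasing and nonnegative beyond n, as
    \<open>top_sum_bound\<close> demands.\<close>
  define m where "m = trunc n (\<lambda>i. \<bar>w (p i)\<bar>)"
  have m: "decseq m" "\<And>i. m i \<ge> 0"
    using p(2) by (auto simp: m_def trunc_def decseq_def)
  have top: "(\<Sum>j<k. \<bar>w j\<bar>) \<le> (\<Sum>j<k. m j)" if "k \<le> n" for k
  proof -
    define c where "c i = (if p i < k then 1 else 0::real)" for i
    have cn: "(\<Sum>i<n. h (p i) * c i) = (\<Sum>j<k. h j)" for h :: "nat \<Rightarrow> real"
    proof -
      have "(\<Sum>i<n. h (p i) * c i) = (\<Sum>j<n. h j * (if j < k then 1 else 0))"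
        unfolding c_def by (rule sum.reindex_bij_betw[OF p(1), of "\<lambda>j. h j * (if j < k then 1 else 0)"])
      also have "\<dots> = (\<Sum>j<k. h j)"
        using that by (intro sum.mono_neutral_cong_right) auto
      finally show ?thesis .
    qed
    have "(\<Sum>j<k. \<bar>w j\<bar>) = (\<Sum>i<n. m i * c i)"
      using cn[of "\<lambda>j. \<bar>w j\<bar>"] by (simp add: m_def trunc_def)
    also have "\<dots> \<le> (\<Sum>j<k. m j)"
      by (rule top_sum_bound[OF m]) (use cn[of "\<lambda>_. 1"] in \<open>auto simp: c_def\<close>)
    finally show ?thesis .
  qed
  have "\<phi> (trunc n a) \<le> (\<Sum>j<n. \<bar>w j\<bar> * a j)"
    unfolding w(1)[symmetric] using a(2) by (intro sum_mono mult_right_mono) auto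
  also have "\<dots> \<le> (\<Sum>j<n. m j * a j)"
    using Abel_nonneg[of n a "\<lambda>j. m j - \<bar>w j\<bar>"] a top
    by (simp add: sum_subtractf algebra_simps)
  also have "\<dots> \<le> (\<Sum>j<n. m j * b j)"
    using Abel_nonneg[of n m "\<lambda>j. b j - a j"] m ab
    by (simp add: sum_subtractf algebra_simps decseq_SucD)
  also have "\<dots> = (\<Sum>j<n. w j * ((if w j < 0 then -1 else 1) * b (inv_into {..<n} p j)))"
  proof -
    have "(\<Sum>j<n. m j * b j) = (\<Sum>i<n. \<bar>w (p i)\<bar> * b (inv_into {..<n} p (p i)))"
      using p(1) by (intro sum.cong refl) (auto simp: m_def trunc_def bij_betw_def)
    also have "\<dots> = (\<Sum>j<n. \<bar>w j\<bar> * b (inv_into {..<n} p j))"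
      by (rule sum.reindex_bij_betw[OF p(1), of "\<lambda>j. \<bar>w j\<bar> * b (inv_into {..<n} p j)"])
    also have "\<dots> = (\<Sum>j<n. w j * ((if w j < 0 then -1 else 1) * b (inv_into {..<n} p j)))"
      by (intro sum.cong refl) auto
    finally show ?thesis .
  qed
  also have "\<dots> \<le> \<phi> (trunc n (\<lambda>j. (if w j < 0 then -1 else 1) * b (inv_into {..<n} p j)))"
    by (rule w(2))
  also have "\<dots> = \<phi> (trunc n b)"
    by (rule trunc_signed_permutation[OF bij_betw_inv_into[OF p(1)]]) auto
  finally show ?thesis .
qed

end

subsection \<open>The ideal of a symmetric norm given by a gauge function\<close>

locale gauge_norm = symmetric_norm N + gauge: symmetric_gauge \<phi>
  for N :: "'h::separable_infinite_hilbert bop \<Rightarrow> ennreal" and \<phi> +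
  assumes N_gauge: "compact_op x \<Longrightarrow> N x = (SUP n. ennreal (\<phi> (trunc n (singular_values x))))"
    and not_equivalent: "\<not> equivalent_to_uniform N"
begin

text \<open>Supplies a nonzero element of the ideal, used to compare the two norms and to build
  short loops.\<close>

lemma rank_one_norm:
  obtains p e where "p \<noteq> 0" "p \<in> norm_ideal N" "hermitian p" "norm e = 1" "\<And>v. p \<cdot> v = cinner v e *\<^sub>C e"
proof -
  obtain b :: "nat \<Rightarrow> 'h" where "orthonormal_basis b" by (rule exists_orthonormal_basis)
  then have on: "orthonormal_on UNIV b" by (simp add: orthonormal_basis_def)
  define l where "l = (\<lambda>n::nat. if n = 0 then 1 else 0 :: real)"
  have l: "decseq (\<lambda>n. \<bar>l n\<bar>)" "l \<longlonglongrightarrow> 0"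
    by (auto simp: l_def decseq_def intro!: tendsto_eventually eventually_sequentiallyI[of 1])
  define p where "p = diag b l"
  have es: "eigsys p b l" and ch: "compact_hermitian p" unfolding p_def by (rule diag_eigsys[OF on l])+
  have sv: "singular_values p = l"
    using singular_values_eigsys[OF _ es] ch by (auto simp: compact_hermitian_def l_def)
  have b0: "norm (b 0) = 1" using orthonormal_on_norm[OF on] by simp
  have pb: "p \<cdot> b 0 = b 0" using eigsysD(2)[OF es, of 0] by (simp add: l_def)
  have pv: "p \<cdot> v = cinner v (b 0) *\<^sub>C b 0" for v
  proof -
    have "(\<lambda>n. (cinner v (b n) * complex_of_real (l n)) *\<^sub>C b n) = (\<lambda>n. if n = 0 then cinner v (b n) *\<^sub>C b n else 0)"
      by (auto simp: l_def complex_vector.scale_zero_left)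
    then show ?thesis using eigsys_expansion[OF es, of v] sums_single[of 0 "\<lambda>n. cinner v (b n) *\<^sub>C b n"] sums_unique2 by metis
  qed
  have "N p \<le> ennreal (\<phi> (trunc 1 l))"
    unfolding N_gauge[OF ch[unfolded compact_hermitian_def, THEN conjunct1]] sv
  proof (rule SUP_least)
    fix n
    \<comment> \<open>As \<open>l\<close> has a single nonzero entry, its truncations are zero for n
      = 0 and all equal otherwise.\<close>
    have "trunc n l = trunc 1 (\<lambda>j. (if n = 0 then 0 else 1) * l j)" by (auto simp: trunc_def l_def)
    then have "\<phi> (trunc n l) \<le> \<phi> (trunc 1 l)"
      using gauge.trunc_scale[of 1 "if n = 0 then 0 else 1" l] gauge.trunc_nonneg[of 1 l] by auto
    then show "ennreal (\<phi> (trunc n l)) \<le> ennreal (\<phi> (trunc 1 l))" by (rule ennreal_leI)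
  qed
  then have "p \<in> norm_ideal N" by (auto simp: norm_ideal_def intro: le_less_trans)
  moreover have "p \<noteq> 0" using pb b0 by auto
  ultimately show ?thesis using that[of p "b 0"] ch b0 pv by (auto simp: compact_hermitian_def)
qed

text \<open>Rank one operators a and c of norm at most 1 compress x to norm (x v) times the fixed
  projection \<open>p\<close>, so the ideal property bounds norm (x v) times \<open>nu p\<close> by
  the norm of x.\<close>

lemma norm_le_nu_ex: "\<exists>C>0. \<forall>x. ennreal (norm x) \<le> ennreal C * N x"
proof -
  obtain p e where p: "p \<noteq> 0" "p \<in> norm_ideal N" "norm e = 1" "\<And>v. p \<cdot> v = cinner v e *\<^sub>C e"
    using rank_one_norm by metis
  have np: "nu p > 0" by (rule nu_pos[OF p(2,1)])
  have key: "ennreal (norm (x \<cdot> v) * nu p) \<le> N x" if v: "norm v = 1" for x v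
  proof (cases "x \<cdot> v = 0")
    case False
    define y where "y = complex_of_real (1 / norm (x \<cdot> v)) *\<^sub>C (x \<cdot> v)"
    have y: "norm y = 1" using False by (simp add: y_def norm_scaleC norm_divide)
    obtain a where a: "\<And>w. a \<cdot> w = cinner w e *\<^sub>C v" "norm a \<le> norm v * norm e" using exists_rank_one by blast
    obtain c where c: "\<And>w. c \<cdot> w = cinner w y *\<^sub>C e" "norm c \<le> norm e * norm y" using exists_rank_one by blast
    have cxa: "c * x * a = norm (x \<cdot> v) *\<^sub>R p"
    proof (rule bop_eqI)
      fix w
      have "cinner (x \<cdot> v) y = of_real (norm (x \<cdot> v))"
        using False by (simp add: y_def cinner_simps cinner_self power2_eq_square)
      then show "(c * x * a) \<cdot> w = (norm (x \<cdot> v) *\<^sub>R p) \<cdot> w"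
        by (simp add: bop_simps a(1) c(1) p(4) cinner_simps scaleC_of_real[symmetric] scaleC_scaleC mult.commute)
    qed
    have "ennreal (norm (x \<cdot> v)) * N p = N (c * x * a)" unfolding cxa N_scaleR by simp
    also have "\<dots> \<le> ennreal (norm c) * N x * ennreal (norm a)" by (rule ideal)
    also have "\<dots> \<le> ennreal 1 * N x * ennreal 1"
      using a(2) c(2) p(3) y v by (intro mult_mono ennreal_leI) auto
    finally show ?thesis using norm_ideal_nu[OF p(2)] by (simp add: ennreal_mult nu_nonneg)
  qed simp
  have "ennreal (norm x) \<le> ennreal (1 / nu p) * N x" for x
  proof (cases "x \<in> norm_ideal N")
    case True
    have kr: "norm (x \<cdot> v) * nu p \<le> nu x" if "norm v = 1" for v
      using key[OF that, of x] norm_ideal_nu[OF True] by (simp add: nu_nonneg)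
    have "norm x \<le> nu x / nu p"
    proof (rule norm_bop_bound)
      fix v
      show "norm (x \<cdot> v) \<le> nu x / nu p * norm v"
      proof (cases "v = 0")
        case False
        have "norm (complex_of_real (1 / norm v) *\<^sub>C v) = 1" using False by (simp add: norm_scaleC norm_divide)
        from kr[OF this] show ?thesis using False np by (simp add: bop_simps norm_scaleC norm_divide field_simps)
      qed simp
    qed (use np nu_nonneg[of x] in simp)
    then show ?thesis using norm_ideal_nu[OF True] np nu_nonneg[of x] by (simp add: ennreal_mult[symmetric])
  next
    case False
    then have "N x = top" by (simp add: norm_ideal_def less_top[symmetric])
    then show ?thesis using np by (simp add: ennreal_mult_top)
  qed
  then show ?thesis using np by (intro exI[of _ "1 / nu p"]) auto
qed

definition embed_const :: real where "embed_const = (SOME C. C > 0 \<and> (\<forall>x. ennreal (norm x) \<le> ennreal C * N x))"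

lemma embed_const: "embed_const > 0" "ennreal (norm x) \<le> ennreal embed_const * N x"
  using someI_ex[OF norm_le_nu_ex] unfolding embed_const_def by blast+

lemma norm_le_nu: "x \<in> norm_ideal N \<Longrightarrow> norm x \<le> embed_const * nu x"
  using embed_const(2)[of x] embed_const(1) norm_ideal_nu[of x] nu_nonneg[of x] by (simp add: ennreal_mult[symmetric])

text \<open>On a noncompact \<open>x\<close> one can find orthonormal vectors with orthogonal images of norm at least
  \<open>\<epsilon>\<close>; hence the identity factors through \<open>x\<close>, and the whole algebra would be the ideal.\<close>
lemma norm_ideal_compact:
  assumes x: "x \<in> norm_ideal N"
  shows "compact_op x"
proof (rule ccontr)
  assume "\<not> compact_op x"
  then obtain \<epsilon> where \<epsilon>: "\<epsilon> > 0" and nc: "\<And>F. finite F \<Longrightarrow> \<exists>v. (\<forall>f\<in>F. cinner v f = 0) \<and> \<epsilon> * norm v < norm (x \<cdot> v)"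
    using compact_op_approx[of x] by (meson not_le)
  define R where "R F v \<longleftrightarrow> (\<forall>f\<in>F. cinner v f = 0) \<and> norm v = 1 \<and> \<epsilon> < norm (x \<cdot> v)" for F v
  \<comment> \<open>Besides v the set also receives x* x v. Orthogonality to it makes the images
    under x orthogonal as well.\<close>
  have "\<exists>f. \<forall>n. finite (f n) \<and> (\<exists>v. R (f n) v \<and> f (Suc n) = insert v (insert (adj x \<cdot> x \<cdot> v) (f n)))"
  proof (rule dependent_nat_choice)
    show "\<exists>F::'h set. finite F" by blast
    fix F :: "'h set" assume "finite F"
    from nc[OF this] obtain v where v: "\<forall>f\<in>F. cinner v f = 0" "\<epsilon> * norm v < norm (x \<cdot> v)" by blast
    then have "v \<noteq> 0" by auto
    define y where "y = complex_of_real (1 / norm v) *\<^sub>C v"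
    have "R F y" using v \<open>v \<noteq> 0\<close> 
      by (simp add: R_def y_def cinner_simps norm_scaleC norm_divide bop_simps field_simps)
    then show "\<exists>G. finite G \<and> (\<exists>v. R F v \<and> G = insert v (insert (adj x \<cdot> x \<cdot> v) F))"
      using \<open>finite F\<close> by (intro exI[of _ "insert y (insert (adj x \<cdot> x \<cdot> y) F)"]) auto
  qed
  then obtain f e where f: "\<And>n. R (f n) (e n)" "\<And>n. f (Suc n) = insert (e n) (insert (adj x \<cdot> x \<cdot> e n) (f n))"
    by metis
  have mono: "f m \<subseteq> f n" if "m \<le> n" for m n
    by (rule lift_Suc_mono_le[OF _ that]) (use f(2) in blast)
  have ort: "cinner (e n) (e m) = 0" "cinner (x \<cdot> e n) (x \<cdot> e m) = 0" if "m < n" for m n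
  proof -
    have "e m \<in> f n" "adj x \<cdot> x \<cdot> e m \<in> f n" using mono[of "Suc m" n] that f(2)[of m] by auto
    then show "cinner (e n) (e m) = 0" "cinner (x \<cdot> e n) (x \<cdot> e m) = 0"
      using f(1)[of n] by (auto simp: R_def cinner_adj_right)
  qed
  have ort': "cinner (e n) (e m) = 0" "cinner (x \<cdot> e n) (x \<cdot> e m) = 0" if "m \<noteq> n" for m n
    using ort that cinner_eq_0_commute by (metis nat_neq_iff)+
  have e1: "norm (e n) = 1" and xe: "\<epsilon> < norm (x \<cdot> e n)" for n using f(1)[of n] by (auto simp: R_def)
  define g where "g n = complex_of_real (1 / norm (x \<cdot> e n)) *\<^sub>C (x \<cdot> e n)" for n
  have xe0: "x \<cdot> e n \<noteq> 0" for n using xe[of n] \<epsilon> by auto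
  have g1: "norm (g n) = 1" for n using xe0[of n] by (simp add: g_def norm_scaleC norm_divide)
  have oe: "orthonormal_on UNIV e" using ort'(1) e1 by (auto simp: orthonormal_on_def cinner_self)
  have og: "orthonormal_on UNIV g" unfolding orthonormal_on_def
    using ort'(2) g1 by (auto simp: cinner_self) (auto simp: g_def cinner_simps)
  obtain b :: "nat \<Rightarrow> 'h" where b: "orthonormal_basis b" by (rule exists_orthonormal_basis)
  then have ob: "orthonormal_on UNIV b" by (simp add: orthonormal_basis_def)
  from exists_diagonal_op[OF ob oe, of "\<lambda>_. 1" 1, simplified]
  obtain V where V: "\<And>n. V \<cdot> b n = e n" by metis
  have "cmod (complex_of_real (1 / norm (x \<cdot> e n))) \<le> 1 / \<epsilon>" for n
    using xe[of n] \<epsilon> xe0[of n] by (simp add: norm_divide field_simps)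
  from exists_diagonal_op[OF og ob, of "\<lambda>n. complex_of_real (1 / norm (x \<cdot> e n))", OF this]
  obtain Y where Y: "\<And>n. Y \<cdot> g n = complex_of_real (1 / norm (x \<cdot> e n)) *\<^sub>C b n" by metis
  \<comment> \<open>V maps b n to e n, x maps it to a multiple of the unit vector g n, and Y maps
    that back to b n; Y is bounded since the norms of x e n stay above
    \<open>\<epsilon>\<close>.\<close>
  have "Y * x * V = 1"
  proof (rule bop_eq_on_orthonormal[OF ob])
    fix n
    have "x \<cdot> e n = complex_of_real (norm (x \<cdot> e n)) *\<^sub>C g n"
      using xe0[of n] by (simp add: g_def scaleC_scaleC)
    then have "Y \<cdot> x \<cdot> e n = complex_of_real (norm (x \<cdot> e n)) *\<^sub>C Y \<cdot> g n" by (metis bop_apply_scaleC)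
    then show "(Y * x * V) \<cdot> b n = 1 \<cdot> b n"
      using xe0[of n] by (simp add: bop_simps V Y scaleC_scaleC)
  next
    fix v assume "\<And>n. cinner v (b n) = 0"
    then have "v = 0" using b by (auto simp: orthonormal_basis_def)
    then show "(Y * x * V) \<cdot> v = 1 \<cdot> v" by simp
  qed
  then have one: "1 \<in> norm_ideal N"
    using norm_ideal_mult_right[OF norm_ideal_mult_left[OF x]] by metis
  have up: "N y \<le> ennreal ((nu 1 + 1) * norm y)" for y
  proof -
    have "N y \<le> ennreal (norm y) * N 1" using N_mult_left[of y 1] by simp
    also have "\<dots> = ennreal (norm y * nu 1)" using norm_ideal_nu[OF one] by (simp add: ennreal_mult nu_nonneg)
    also have "\<dots> \<le> ennreal ((nu 1 + 1) * norm y)" by (intro ennreal_leI) (simp add: algebra_simps)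
    finally show ?thesis .
  qed
  have "ennreal (1 / embed_const * norm y) \<le> N y" for y
  proof -
    have yI: "y \<in> norm_ideal N" using norm_ideal_mult_left[OF one, of y] by simp
    show ?thesis using norm_le_nu[OF yI] norm_ideal_nu[OF yI] embed_const(1) by (simp add: nu_nonneg field_simps)
  qed
  then have "equivalent_to_uniform N" unfolding equivalent_to_uniform_def
    using up embed_const(1) nu_nonneg[of 1] by (intro exI[of _ "1 / embed_const"] exI[of _ "nu 1 + 1"]) auto
  then show False using not_equivalent by blast
qed

lemma norm_ideal_compact_hermitian: "x \<in> norm_ideal N \<Longrightarrow> hermitian x \<Longrightarrow> compact_hermitian x"
  by (simp add: compact_hermitian_def norm_ideal_compact)

lemma N_compact_hermitian: "compact_hermitian x \<Longrightarrow> N x = (SUP n. ennreal (\<phi> (trunc n (singular_values x))))"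
  by (simp add: compact_hermitian_def N_gauge)

lemma gauge_le_nu:
  assumes "x \<in> norm_ideal N" "hermitian x"
  shows "\<phi> (trunc n (singular_values x)) \<le> nu x"
proof -
  have "ennreal (\<phi> (trunc n (singular_values x))) \<le> N x"
    unfolding N_compact_hermitian[OF norm_ideal_compact_hermitian[OF assms]] by (rule SUP_upper) simp
  then show ?thesis using norm_ideal_nu[OF assms(1)] by (simp add: nu_nonneg)
qed

end

subsection \<open>Polynomial approximation of the arc length function\<close>

text \<open>The Taylor polynomials of \<open>arcsin\<close> have nonnegative coefficients.  So their derivatives are dominated
  by \<open>1 / sqrt (1 - x\<^sup>2)\<close>, and \<open>asin_poly n (cos \<theta>)\<close> is 1-Lipschitz in \<open>\<theta>\<close> on the whole circle.\<close>

definition asin_coeff :: "nat \<Rightarrow> real" where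
  "asin_coeff m = pochhammer (1/2) m / fact m"

definition asin_poly :: "nat \<Rightarrow> real poly" where
  "asin_poly n = (\<Sum>m\<le>n. monom (asin_coeff m / real (2 * m + 1)) (2 * m + 1))"

lemma asin_coeff_nonneg: "0 \<le> asin_coeff m"
  by (simp add: asin_coeff_def pochhammer_nonneg)

lemma poly_pderiv_asin_poly: "poly (pderiv (asin_poly n)) x = (\<Sum>m\<le>n. asin_coeff m * x ^ (2 * m))"
proof -
  have "pderiv (asin_poly n) = (\<Sum>m\<le>n. monom (asin_coeff m) (2 * m))"
    unfolding asin_poly_def higher_pderiv_sum[of 1, simplified]
    by (intro sum.cong refl) (simp add: pderiv_monom add_nonneg_eq_0_iff del: of_nat_Suc of_nat_add)
  then show ?thesis by (simp add: poly_sum poly_monom)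
qed

text \<open>This is the binomial series with exponent -1/2 at -x^2; the two alternating signs
  cancel.\<close>

lemma asin_series:
  assumes "\<bar>x\<bar> < 1"
  shows "(\<lambda>m. asin_coeff m * x ^ (2 * m)) sums (1 / sqrt (1 - x\<^sup>2))"
proof -
  have x: "\<bar>- x\<^sup>2\<bar> < 1" using assms by (simp add: abs_square_less_1)
  have "(\<lambda>m. ((-1/2) gchoose m) * (- x\<^sup>2) ^ m) sums (1 + - x\<^sup>2) powr (-1/2)"
    by (rule gen_binomial_real[OF x])
  moreover have "((-1/2) gchoose m) * (- x\<^sup>2) ^ m = asin_coeff m * x ^ (2 * m)" for m
  proof -
    have "((-1/2) gchoose m) = (-1) ^ m * asin_coeff m" by (simp add: gbinomial_pochhammer asin_coeff_def)
    moreover have "(- x\<^sup>2) ^ m = (-1) ^ m * x ^ (2 * m)"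
      unfolding power_minus[of "x\<^sup>2"] power_mult ..
    moreover have "(-1) ^ m * (-1) ^ m = (1::real)" by (simp flip: power_mult_distrib)
    ultimately show ?thesis by (simp add: mult_ac)
  qed
  moreover have "(1 + - x\<^sup>2) powr (-1/2) = 1 / sqrt (1 - x\<^sup>2)"
    using x by (simp add: powr_minus powr_half_sqrt inverse_eq_divide)
  ultimately show ?thesis by simp
qed

lemma pderiv_asin_poly_nonneg: "0 \<le> poly (pderiv (asin_poly n)) x"
  unfolding poly_pderiv_asin_poly by (intro sum_nonneg mult_nonneg_nonneg asin_coeff_nonneg) (simp add: power_mult)

lemma pderiv_asin_poly_le:
  assumes "\<bar>x\<bar> < 1"
  shows "poly (pderiv (asin_poly n)) x \<le> 1 / sqrt (1 - x\<^sup>2)"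
proof -
  have "(\<Sum>m\<le>n. asin_coeff m * x ^ (2 * m)) \<le> (\<Sum>m. asin_coeff m * x ^ (2 * m))"
    using asin_series[OF assms] asin_coeff_nonneg
    by (intro sum_le_suminf) (auto simp: sums_iff power_mult)
  then show ?thesis using asin_series[OF assms] by (simp add: poly_pderiv_asin_poly sums_iff)
qed

text \<open>In product form the bound also covers x = 1 and x = -1, that is, the eigenvalues 1 and
  -1 of a real part, where the quotient form breaks down.\<close>

lemma pderiv_asin_poly_sqrt:
  assumes "\<bar>x\<bar> \<le> 1"
  shows "poly (pderiv (asin_poly n)) x * sqrt (1 - x\<^sup>2) \<le> 1"
proof (cases "\<bar>x\<bar> = 1")
  case True
  then have "x\<^sup>2 = 1" by (simp add: power2_eq_1_iff abs_if split: if_splits)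
  then show ?thesis by simp
next
  case False
  then have x: "\<bar>x\<bar> < 1" using assms by simp
  then have "sqrt (1 - x\<^sup>2) > 0" by (simp add: abs_square_less_1)
  then show ?thesis using pderiv_asin_poly_le[OF x, of n] by (simp add: field_simps)
qed

lemma asin_poly_mono: "x \<le> y \<Longrightarrow> poly (asin_poly n) x \<le> poly (asin_poly n) y"
  by (rule DERIV_nonneg_imp_nondecreasing[of x y "poly (asin_poly n)"])
    (use poly_DERIV pderiv_asin_poly_nonneg in blast)+

text \<open>The derivative of arcsin minus its Taylor polynomial is the tail of a series in even
  powers with nonnegative coefficients, so on |s| at most r it is largest at r. The factor 2 bounds
  y - x in the mean value theorem.\<close>

lemma asin_poly_diff_lower:
  assumes r: "r < 1" and xy: "- r \<le> x" "x \<le> y" "y \<le> r"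
  shows "arcsin y - arcsin x - 2 * (1 / sqrt (1 - r\<^sup>2) - poly (pderiv (asin_poly n)) r)
    \<le> poly (asin_poly n) y - poly (asin_poly n) x"
proof (cases "x = y")
  case True
  have "\<bar>r\<bar> < 1" using assms by auto
  then show ?thesis using pderiv_asin_poly_le[of r n] True by simp
next
  case False
  let ?t = "\<lambda>s. 1 / sqrt (1 - s\<^sup>2) - poly (pderiv (asin_poly n)) s"
  have tail: "?t s \<le> ?t r" if "\<bar>s\<bar> \<le> r" for s
  proof -
    have s: "\<bar>s\<bar> < 1" and r1: "\<bar>r\<bar> < 1" using that r by auto
    have *: "?t u = (\<Sum>m. asin_coeff (m + Suc n) * u ^ (2 * (m + Suc n)))" "summable (\<lambda>m. asin_coeff (m + Suc n) * u ^ (2 * (m + Suc n)))"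
      if "\<bar>u\<bar> < 1" for u
    proof -
      note se = asin_series[OF that]
      have "suminf (\<lambda>m. asin_coeff m * u ^ (2 * m)) = 1 / sqrt (1 - u\<^sup>2)" using se by (simp add: sums_iff)
      then show "?t u = (\<Sum>m. asin_coeff (m + Suc n) * u ^ (2 * (m + Suc n)))"
        using suminf_minus_initial_segment[of "\<lambda>m. asin_coeff m * u ^ (2 * m)" "Suc n"] se
        by (simp add: sums_iff poly_pderiv_asin_poly lessThan_Suc_atMost del: mult_Suc_right)
      show "summable (\<lambda>m. asin_coeff (m + Suc n) * u ^ (2 * (m + Suc n)))"
        using se by (subst summable_iff_shift) (simp add: sums_iff)
    qed
    show ?thesis unfolding *(1)[OF s] *(1)[OF r1]
    proof (rule suminf_le[OF _ *(2)[OF s] *(2)[OF r1]])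
      fix m
      have "s ^ (2 * (m + Suc n)) \<le> r ^ (2 * (m + Suc n))"
        unfolding power_mult by (rule power_mono) (use that in \<open>auto simp: abs_le_square_iff[symmetric]\<close>)
      then show "asin_coeff (m + Suc n) * s ^ (2 * (m + Suc n)) \<le> asin_coeff (m + Suc n) * r ^ (2 * (m + Suc n))"
        by (rule mult_left_mono) (rule asin_coeff_nonneg)
    qed
  qed
  have "\<exists>s. x < s \<and> s < y \<and> (arcsin y - poly (asin_poly n) y) - (arcsin x - poly (asin_poly n) x) = (y - x) * ?t s"
  proof (rule MVT2)
    show "x < y" using False xy by simp
    fix s assume s: "x \<le> s" "s \<le> y"
    then have "- 1 < s" "s < 1" using r xy by auto
    then show "DERIV (\<lambda>s. arcsin s - poly (asin_poly n) s) s :> ?t s"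
      by (auto intro!: derivative_eq_intros simp: inverse_eq_divide)
  qed
  then obtain s where s: "x < s" "s < y"
    and eq: "(arcsin y - poly (asin_poly n) y) - (arcsin x - poly (asin_poly n) x) = (y - x) * ?t s" by blast
  have sr: "\<bar>s\<bar> \<le> r" using s xy by auto
  have "(y - x) * ?t s \<le> 2 * ?t r"
    using s xy r tail[OF sr] pderiv_asin_poly_le[of s n] sr by (intro mult_mono) auto
  then show ?thesis using eq by linarith
qed

text \<open>The derivative series diverges at 1, so the estimate is made up to some y < 1 with
  arcsin y within \<open>\<epsilon> / 2\<close> of arcsin 1, and monotonicity of the polynomial
  covers the rest. The tail at y below \<open>\<epsilon> / 4\<close> accounts for the other
  half.\<close>

lemma asin_poly_arccos:
  assumes x: "-1 < x" "x \<le> 1" and \<epsilon>: "\<epsilon> > 0"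
  shows "\<forall>\<^sub>F n in sequentially. arccos x - \<epsilon> \<le> poly (asin_poly n) 1 - poly (asin_poly n) x"
proof (cases "x = 1")
  case True
  then show ?thesis using \<epsilon> by simp
next
  case False
  then have x1: "x < 1" using x by simp
  have "(arcsin \<longlongrightarrow> arcsin 1) (at_left 1)"
  proof -
    have "\<forall>x\<in>{-1..1}. (arcsin \<longlongrightarrow> arcsin x) (at x within {-1..1::real})"
      using continuous_on_arcsin' unfolding continuous_on_def .
    then have "(arcsin \<longlongrightarrow> arcsin 1) (at 1 within {-1..1::real})"
      by (rule bspec) simp
    moreover have "at 1 within {-1..1::real} = at_left 1"
      by (rule at_within_Icc_at_left) simp
    ultimately show ?thesis by (simp only:)
  qed
  then have "\<forall>\<^sub>F y in at_left 1. arcsin y > arcsin 1 - \<epsilon> / 2"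
    by (rule order_tendstoD) (use \<epsilon> in simp)
  moreover have "\<forall>\<^sub>F y in at_left 1. y \<in> {max \<bar>x\<bar> 0 <..< 1}"
    by (rule eventually_at_left_real) (use x1 x in auto)
  ultimately have "\<forall>\<^sub>F y in at_left (1::real). arcsin y > arcsin 1 - \<epsilon> / 2 \<and> y \<in> {max \<bar>x\<bar> 0 <..< 1}"
    by (rule eventually_conj)
  from eventually_happens'[OF _ this] obtain y where y: "arcsin y > arcsin 1 - \<epsilon> / 2" "\<bar>x\<bar> < y" "y < 1"
    by auto
  have y1: "\<bar>y\<bar> < 1" using y by auto
  have "(\<lambda>n. \<Sum>m<n. asin_coeff m * y ^ (2 * m)) \<longlonglongrightarrow> 1 / sqrt (1 - y\<^sup>2)"
    using asin_series[OF y1] by (simp add: sums_def)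
  from LIMSEQ_Suc[OF this] have "(\<lambda>n. poly (pderiv (asin_poly n)) y) \<longlonglongrightarrow> 1 / sqrt (1 - y\<^sup>2)"
    by (simp only: poly_pderiv_asin_poly lessThan_Suc_atMost)
  then have "\<forall>\<^sub>F n in sequentially. poly (pderiv (asin_poly n)) y > 1 / sqrt (1 - y\<^sup>2) - \<epsilon> / 4"
    by (rule order_tendstoD) (use \<epsilon> in simp)
  then show ?thesis
  proof eventually_elim
    case (elim n)
    define q where "q = 1 / sqrt (1 - y\<^sup>2) - poly (pderiv (asin_poly n)) y"
    have "q < \<epsilon> / 4" using elim by (simp add: q_def)
    moreover have "arcsin y - arcsin x - 2 * q \<le> poly (asin_poly n) y - poly (asin_poly n) x"
      unfolding q_def by (rule asin_poly_diff_lower) (use y in auto)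
    moreover have "poly (asin_poly n) y \<le> poly (asin_poly n) 1" by (rule asin_poly_mono) (use y in simp)
    moreover have "arccos x = arcsin 1 - arcsin x" using arccos_arcsin_eq[of x] x by simp
    ultimately show ?case using y(1) by linarith
  qed
qed

subsection \<open>Polynomials of operators\<close>

definition op_poly :: "real poly \<Rightarrow> 'a::separable_infinite_hilbert bop \<Rightarrow> 'a bop" where
  "op_poly p x = (\<Sum>i\<le>degree p. coeff p i *\<^sub>R x ^ i)"

lemma sum_bop_apply: "(\<Sum>i\<in>I. f i) \<cdot> v = (\<Sum>i\<in>I. f i \<cdot> v)"
  by (induction I rule: infinite_finite_induct) (simp_all add: plus_bop_apply)

lemma power_bop_eigen:
  fixes x :: "'a::separable_infinite_hilbert bop"
  assumes "x \<cdot> e = m *\<^sub>R e"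
  shows "(x ^ i) \<cdot> e = (m ^ i) *\<^sub>R e"
  by (induction i) (simp_all add: bop_simps assms mult.commute)

lemma op_poly_eigen:
  assumes "x \<cdot> e = m *\<^sub>R e"
  shows "op_poly p x \<cdot> e = poly p m *\<^sub>R e"
  unfolding op_poly_def sum_bop_apply
  by (simp add: bop_simps power_bop_eigen[OF assms] poly_altdef scaleR_sum_left)

lemma hermitian_scaleR: "hermitian x \<Longrightarrow> hermitian (r *\<^sub>R (x::'a::separable_infinite_hilbert bop))"
  by (simp add: hermitian_def adj_simps)
lemma hermitian_diff: "hermitian x \<Longrightarrow> hermitian y \<Longrightarrow> hermitian (x - (y::'a::separable_infinite_hilbert bop))"
  by (simp add: hermitian_def adj_simps)
lemma hermitian_add: "hermitian x \<Longrightarrow> hermitian y \<Longrightarrow> hermitian (x + (y::'a::separable_infinite_hilbert bop))"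
  by (simp add: hermitian_def adj_simps)
lemma hermitian_one: "hermitian (1::'a::separable_infinite_hilbert bop)"
  by (simp add: hermitian_def)
lemma hermitian_zero: "hermitian (0::'a::separable_infinite_hilbert bop)"
  by (simp add: hermitian_cinner)

lemma hermitian_power: "hermitian x \<Longrightarrow> hermitian ((x::'a::separable_infinite_hilbert bop) ^ i)"
  by (induction i) (auto simp: hermitian_def adj_times power_commutes)

lemma hermitian_op_poly: "hermitian x \<Longrightarrow> hermitian (op_poly p x)"
  unfolding op_poly_def
proof -
  assume x: "hermitian x"
  have "hermitian (\<Sum>i\<in>I. coeff p i *\<^sub>R x ^ i)" for I
    by (induction I rule: infinite_finite_induct)
      (simp_all add: hermitian_zero hermitian_add hermitian_scaleR hermitian_power x)
  then show "hermitian (\<Sum>i\<le>degree p. coeff p i *\<^sub>R x ^ i)" .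
qed

lemma (in symmetric_norm) op_poly_norm_ideal:
  assumes "1 - x \<in> norm_ideal N"
  shows "poly p 1 *\<^sub>R 1 - op_poly p x \<in> norm_ideal N"
proof -
  have pw: "1 - x ^ i \<in> norm_ideal N" for i
  proof (induction i)
    case (Suc i)
    have "1 - x ^ Suc i = (1 - x) + x * (1 - x ^ i)" by (simp add: algebra_simps)
    then show ?case using norm_ideal_add[OF assms norm_ideal_mult_left[OF Suc]] by (simp only:)
  qed simp
  have "poly p 1 *\<^sub>R 1 - op_poly p x = (\<Sum>i\<le>degree p. coeff p i *\<^sub>R (1 - x ^ i))"
    by (simp add: op_poly_def poly_altdef scaleR_sum_left sum_subtractf scaleR_right_diff_distrib)
  also have "\<dots> \<in> norm_ideal N"
  proof -
    have "(\<Sum>i\<in>I. coeff p i *\<^sub>R (1 - x ^ i)) \<in> norm_ideal N" for I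
      by (induction I rule: infinite_finite_induct) (simp_all add: norm_ideal_add norm_ideal_scaleR pw)
    then show ?thesis .
  qed
  finally show ?thesis .
qed

text \<open>Powers of noncommuting operators have awkward derivatives, but paired with an
  eigenvector of the Hermitian \<open>x t\<close> every factor \<open>x t\<close> on either side of
  \<open>x'\<close> becomes the scalar m, and the scalar formula remains.\<close>

lemma op_poly_has_derivative:
  fixes x :: "real \<Rightarrow> 'a::separable_infinite_hilbert bop"
  assumes x: "(x has_vector_derivative x') (at t within T)" and h: "hermitian (x t)" and e: "x t \<cdot> e = m *\<^sub>R e"
  shows "((\<lambda>s. Re (cinner (op_poly p (x s) \<cdot> e) e)) has_real_derivative
    poly (pderiv p) m * Re (cinner (x' \<cdot> e) e)) (at t within T)"
proof -
  have pw: "\<exists>d. ((\<lambda>s. x s ^ i) has_vector_derivative d) (at t within T) \<and>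
     cinner (d \<cdot> e) e = of_real (real i * m ^ (i - 1)) * cinner (x' \<cdot> e) e" for i
  proof (induction i)
    case 0
    show ?case by (intro exI[of _ 0]) simp
  next
    case (Suc i)
    then obtain d where d: "((\<lambda>s. x s ^ i) has_vector_derivative d) (at t within T)"
      "cinner (d \<cdot> e) e = of_real (real i * m ^ (i - 1)) * cinner (x' \<cdot> e) e" by blast
    have "((\<lambda>s. x s ^ Suc i) has_vector_derivative (x t * d + x' * x t ^ i)) (at t within T)"
      using bounded_bilinear.has_vector_derivative[OF bounded_bilinear_mult x d(1)] by simp
    moreover have "cinner ((x t * d + x' * x t ^ i) \<cdot> e) e = of_real (real (Suc i) * m ^ (Suc i - 1)) * cinner (x' \<cdot> e) e"
    proof -
      have "cinner (x t \<cdot> d \<cdot> e) e = of_real m * cinner (d \<cdot> e) e"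
        using h by (simp add: hermitian_cinner e cinner_simps)
      then have "cinner ((x t * d + x' * x t ^ i) \<cdot> e) e =
          of_real (m * (real i * m ^ (i - 1)) + m ^ i) * cinner (x' \<cdot> e) e"
        by (simp only: plus_bop_apply times_bop_apply power_bop_eigen[OF e] bop_apply_scaleR cinner_add_left
            cinner_scaleR_left d(2) of_real_add of_real_mult distrib_right mult.assoc)
      moreover have "m * (real i * m ^ (i - 1)) + m ^ i = real (Suc i) * m ^ (Suc i - 1)"
        by (cases i) (simp_all add: algebra_simps)
      ultimately show ?thesis by (simp only:)
    qed
    ultimately show ?case by blast
  qed
  then obtain d where d: "\<And>i. ((\<lambda>s. x s ^ i) has_vector_derivative d i) (at t within T)"
     "\<And>i. cinner (d i \<cdot> e) e = of_real (real i * m ^ (i - 1)) * cinner (x' \<cdot> e) e" by metis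
  have bl: "bounded_linear (\<lambda>y. Re (cinner (y \<cdot> e) e))"
    by (intro bounded_linear_compose[OF bounded_linear_Re] bounded_linear_compose[OF bounded_linear_cinner_left] bounded_linear_eval)
  have "((\<lambda>s. Re (cinner (op_poly p (x s) \<cdot> e) e)) has_vector_derivative
      Re (cinner ((\<Sum>i\<le>degree p. coeff p i *\<^sub>R d i) \<cdot> e) e)) (at t within T)"
    unfolding op_poly_def
    by (rule bounded_linear.has_vector_derivative[OF bl])
       (auto intro!: derivative_eq_intros d(1))
  moreover have "Re (cinner ((\<Sum>i\<le>degree p. coeff p i *\<^sub>R d i) \<cdot> e) e)
      = (\<Sum>i\<le>degree p. coeff p i * (real i * m ^ (i - 1))) * Re (cinner (x' \<cdot> e) e)"
    by (simp add: sum_bop_apply bop_simps cinner_sum_left cinner_simps d(2) sum_distrib_right Re_sum mult.assoc)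
  moreover have "(\<Sum>i\<le>degree p. coeff p i * (real i * m ^ (i - 1))) = poly (pderiv p) m"
  proof (rule DERIV_unique)
    show "((\<lambda>y. \<Sum>i\<le>degree p. coeff p i * y ^ i) has_real_derivative (\<Sum>i\<le>degree p. coeff p i * (real i * m ^ (i - 1)))) (at m)"
      by (auto intro!: derivative_eq_intros sum.cong)
    show "((\<lambda>y. \<Sum>i\<le>degree p. coeff p i * y ^ i) has_real_derivative poly (pderiv p) m) (at m)"
      using poly_DERIV[of p m] by (simp add: poly_altdef)
  qed
  ultimately show ?thesis by (simp add: has_real_derivative_iff_has_vector_derivative)
qed

subsection \<open>Functions with finitely many discontinuities\<close>

text \<open>Monotonicity for a continuous function with no derivative of its own: at each t a
  differentiable h bounds the growth of H from the left. After tilting by \<open>\<epsilon>\<close>,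
  a supposed increase crosses a level y; at the first time t of reaching y the function G was below
  y before, against the slope of h.\<close>

lemma nonincreasing_of_left_bounds:
  fixes H :: "real \<Rightarrow> real"
  assumes ab: "a \<le> b" and H: "continuous_on {a..b} H" and B: "finite B"
    and der: "\<And>t. t \<in> {a<..<b} - B \<Longrightarrow> \<exists>h D. (h has_real_derivative D) (at t within {a..b}) \<and> D \<le> 0 \<and>
       (\<forall>s\<in>{a..<t}. H t - H s \<le> h t - h s)"
  shows "H b \<le> H a"
proof (rule field_le_epsilon)
  fix e :: real assume e: "0 < e"
  define \<epsilon> where "\<epsilon> = e / (b - a + 1)"
  have \<epsilon>: "\<epsilon> > 0" using e ab by (simp add: \<epsilon>_def)
  define G where "G t = H t - \<epsilon> * (t - a)" for t
  have Gc: "continuous_on {a..b} G" unfolding G_def by (intro continuous_intros H)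
  have "G b \<le> G a"
  proof (rule ccontr)
    assume "\<not> G b \<le> G a"
    then have lt: "G a < G b" by simp
    \<comment> \<open>Choosing the level outside the finite set of values on B keeps the crossing
      time away from B.\<close>
    have "infinite ({G a<..<G b} - G ` B)" using lt B by (intro Diff_infinite_finite) auto
    then have "{G a<..<G b} - G ` B \<noteq> {}" by (rule infinite_imp_nonempty)
    then obtain y where "y \<in> {G a<..<G b} - G ` B" by blast
    then have y: "G a < y" "y < G b" "y \<notin> G ` B" unfolding Diff_iff greaterThanLessThan_iff by blast+
    define T where "T = {t\<in>{a..b}. y \<le> G t}"
    have "closed T" unfolding T_def
      using continuous_closed_preimage[OF Gc, of "{y..}"] by (simp add: vimage_def Int_def)
    moreover have "b \<in> T" using y ab by (simp add: T_def)
    moreover have bdd: "bdd_below T" by (rule bdd_belowI[of _ a]) (simp add: T_def)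
    ultimately have tT: "Inf T \<in> T" using closed_contains_Inf[of T] by blast
    define t where "t = Inf T"
    have t: "a \<le> t" "t \<le> b" "y \<le> G t" using tT by (auto simp: T_def t_def)
    have below: "G s < y" if "a \<le> s" "s < t" for s
    proof (rule ccontr)
      assume "\<not> G s < y"
      then have "s \<in> T" using that t(2) by (simp add: T_def)
      from cInf_lower[OF this bdd] show False using that(2) by (simp add: t_def)
    qed
    have "t \<noteq> a" using t(3) y by auto
    then have at: "a < t" using t by simp
    have ne: "at t within {a..<t} \<noteq> bot"
      using at by (simp add: trivial_limit_within islimpt_Ico)
    have ty: "G t = y"
    proof (rule antisym)
      have "((\<lambda>s. G s) \<longlongrightarrow> G t) (at t within {a..<t})"
      proof (rule tendsto_within_subset[of G _ t "{a..b}"])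
        show "(G \<longlongrightarrow> G t) (at t within {a..b})" using Gc t(1,2) by (simp add: continuous_on_def)
        show "{a..<t} \<subseteq> {a..b}" using t(2) by auto
      qed
      moreover have "\<forall>\<^sub>F s in at t within {a..<t}. G s \<le> y"
        unfolding eventually_at_filter by (rule always_eventually) (use below in \<open>simp add: less_imp_le\<close>)
      ultimately show "G t \<le> y" using ne by (rule tendsto_upperbound)
    qed (rule t)
    have "t \<notin> B" using ty y by auto
    moreover have "t \<noteq> b" using ty y by auto
    ultimately obtain h D where h: "(h has_real_derivative D) (at t within {a..b})" "D \<le> 0"
       "\<And>s. s \<in> {a..<t} \<Longrightarrow> H t - H s \<le> h t - h s"
      using der[of t] at t(2) by (metis DiffI greaterThanLessThan_iff order_le_less)
    have "((\<lambda>s. (h s - h t) / (s - t)) \<longlongrightarrow> D) (at t within {a..<t})"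
    proof (rule tendsto_within_subset)
      show "((\<lambda>s. (h s - h t) / (s - t)) \<longlongrightarrow> D) (at t within {a..b})"
        using h(1) by (simp add: has_field_derivative_iff)
      show "{a..<t} \<subseteq> {a..b}" using t(2) by auto
    qed
    then have "\<forall>\<^sub>F s in at t within {a..<t}. (h s - h t) / (s - t) < \<epsilon>"
      by (rule order_tendstoD) (use h(2) \<epsilon> in simp)
    then have "\<forall>\<^sub>F s in at t within {a..<t}. (h s - h t) / (s - t) < \<epsilon> \<and> s \<in> {a..<t}"
      by (rule eventually_conj) (simp add: eventually_at_filter)
    from eventually_happens'[OF ne this]
    obtain s where s: "(h s - h t) / (s - t) < \<epsilon>" "s \<in> {a..<t}" by blast
    have "h t - h s < \<epsilon> * (t - s)" using s by (simp add: field_simps divide_less_eq split: if_splits)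
    then have "G t - G s < 0" using h(3)[OF s(2)] by (simp add: G_def algebra_simps)
    then show False using below[of s] s(2) ty by simp
  qed
  then have "H b \<le> H a + \<epsilon> * (b - a)" by (simp add: G_def)
  also have "\<epsilon> * (b - a) \<le> e" using e ab by (simp add: \<epsilon>_def field_simps)
  finally show "H b \<le> H a + e" by simp
qed

text \<open>Lengths are Lebesgue integrals of extended values, the estimates use gauge integrals of
  real functions. Both agree since B is a null set.\<close>

lemma finitely_discontinuous_integral:
  fixes g :: "real \<Rightarrow> real"
  assumes B: "finite B" and g: "continuous_on ({a..b} - B) g" and bd: "\<And>t. t \<in> {a..b} - B \<Longrightarrow> \<bar>g t\<bar> \<le> M"
  shows "g integrable_on {a..b}"
    and "(\<And>t. t \<in> {a..b} - B \<Longrightarrow> 0 \<le> g t) \<Longrightarrow> (\<And>t. t \<in> {a..b} - B \<Longrightarrow> h t = ennreal (g t)) \<Longrightarrow>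
      (\<integral>\<^sup>+t\<in>{a..b}. h t \<partial>lborel) = ennreal (integral {a..b} g)"
proof -
  define S where "S = {a..b} - B"
  have S: "S \<in> sets borel" unfolding S_def using B by (intro sets.Diff) (auto simp: finite_imp_closed)
  have meas: "(\<lambda>t. indicator S t *\<^sub>R g t) \<in> borel_measurable borel"
    by (rule borel_measurable_continuous_on_indicator[OF S]) (use g in \<open>simp add: S_def\<close>)
  have int: "integrable lborel (\<lambda>t. indicator S t *\<^sub>R g t)"
  proof (rule integrableI_bounded_set[where A="{a..b}" and B="\<bar>M\<bar>"])
    show "(\<lambda>t. indicator S t *\<^sub>R g t) \<in> borel_measurable lborel" using meas by simp
    show "AE x in lborel. x \<in> {a..b} \<longrightarrow> norm (indicator S x *\<^sub>R g x) \<le> \<bar>M\<bar>"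
    proof (rule AE_I'[of B])
      show "B \<in> null_sets lborel" using B by (rule finite_imp_null_set_lborel)
      show "{x \<in> space lborel. \<not> (x \<in> {a..b} \<longrightarrow> norm (indicator S x *\<^sub>R g x) \<le> \<bar>M\<bar>)} \<subseteq> B"
        using bd by (fastforce simp: S_def indicator_def)
    qed
  qed (auto simp: S_def emeasure_lborel_Icc_eq)
  have "((\<lambda>t. indicator S t *\<^sub>R g t) has_integral (integral\<^sup>L lborel (\<lambda>t. indicator S t *\<^sub>R g t))) UNIV"
    by (rule has_integral_integral_lborel[OF int])
  moreover have "(\<lambda>t. indicator S t *\<^sub>R g t) = (\<lambda>t. if t \<in> S then g t else 0)" by auto
  ultimately have "((\<lambda>t. if t \<in> S then g t else 0) has_integral (integral\<^sup>L lborel (\<lambda>t. indicator S t *\<^sub>R g t))) UNIV"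
    by metis
  then have "(g has_integral (integral\<^sup>L lborel (\<lambda>t. indicator S t *\<^sub>R g t))) S"
    by (simp only: has_integral_restrict_UNIV)
  then have hi: "(g has_integral (integral\<^sup>L lborel (\<lambda>t. indicator S t *\<^sub>R g t))) {a..b}"
    by (rule has_integral_spike_set_eq[THEN iffD1, rotated 2])
      (rule negligible_subset[OF negligible_finite[OF B]], auto simp: S_def)+
  then show "g integrable_on {a..b}" by blast
  assume g0: "\<And>t. t \<in> {a..b} - B \<Longrightarrow> 0 \<le> g t" and h: "\<And>t. t \<in> {a..b} - B \<Longrightarrow> h t = ennreal (g t)"
  have "(\<integral>\<^sup>+t\<in>{a..b}. h t \<partial>lborel) = (\<integral>\<^sup>+t. ennreal (indicator S t *\<^sub>R g t) \<partial>lborel)"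
  proof (rule nn_integral_cong_AE, rule AE_I'[of B])
    show "B \<in> null_sets lborel" using B by (rule finite_imp_null_set_lborel)
    show "{x \<in> space lborel. h x * indicator {a..b} x \<noteq> ennreal (indicator S x *\<^sub>R g x)} \<subseteq> B"
      using h by (auto simp: S_def indicator_def)
  qed
  also have "\<dots> = ennreal (integral\<^sup>L lborel (\<lambda>t. indicator S t *\<^sub>R g t))"
    by (rule nn_integral_eq_integral[OF int]) (use g0 in \<open>auto simp: S_def indicator_def\<close>)
  also have "integral\<^sup>L lborel (\<lambda>t. indicator S t *\<^sub>R g t) = integral {a..b} g"
    using hi by (rule integral_unique[symmetric])
  finally show "(\<integral>\<^sup>+t\<in>{a..b}. h t \<partial>lborel) = ennreal (integral {a..b} g)" .
qed

lemma finitely_discontinuous_integral_deriv: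
  fixes g :: "real \<Rightarrow> real"
  assumes B: "finite B" and g: "continuous_on ({a..b} - B) g" "g integrable_on {a..b}" and t: "t \<in> {a..b} - B"
  shows "((\<lambda>s. integral {a..s} g) has_real_derivative g t) (at t within {a..b})"
proof -
  have "open (- B)" using B by (simp add: finite_imp_closed open_Compl)
  then have eq: "at t within {a..b} - B = at t within {a..b}"
    using t by (intro at_within_nhd[of t "-B"]) auto
  have "((\<lambda>s. integral {a..s} g) has_vector_derivative g t) (at t within {a..b} - B)"
    by (rule integral_has_vector_derivative_continuous_at[OF g(2) _ B])
       (use t g(1) in \<open>auto simp: continuous_on_eq_continuous_within\<close>)
  then show ?thesis by (simp add: eq has_real_derivative_iff_has_vector_derivative)
qed

subsection \<open>Exponentials\<close>

lemma power_bop_eigen_complex: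
  fixes x :: "'a::separable_infinite_hilbert bop"
  assumes "x \<cdot> e = m *\<^sub>C e"
  shows "(x ^ i) \<cdot> e = (m ^ i) *\<^sub>C e"
  by (induction i) (simp_all add: bop_simps assms scaleC_scaleC mult.commute)

lemma exp_eigen:
  fixes x :: "'a::separable_infinite_hilbert bop"
  assumes "x \<cdot> e = m *\<^sub>C e"
  shows "exp x \<cdot> e = exp m *\<^sub>C e"
proof (rule sums_unique2)
  show "(\<lambda>n. (x ^ n /\<^sub>R fact n) \<cdot> e) sums (exp x \<cdot> e)"
    by (rule bounded_linear.sums[OF bounded_linear_eval exp_converges])
  have "(\<lambda>n. (m ^ n /\<^sub>R fact n) *\<^sub>C e) sums (exp m *\<^sub>C e)"
    by (rule bounded_linear.sums[OF bounded_linear_scaleC_left exp_converges])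
  moreover have "(m ^ n /\<^sub>R fact n) *\<^sub>C e = (x ^ n /\<^sub>R fact n) \<cdot> e" for n
    by (simp only: scaleR_bop_apply power_bop_eigen_complex[OF assms] scaleR_conv_of_real[of _ "m ^ n"]
        scaleC_scaleC[symmetric] scaleC_of_real)
  ultimately show "(\<lambda>n. (x ^ n /\<^sub>R fact n) \<cdot> e) sums (exp m *\<^sub>C e)" by simp
qed

lemma adj_power: "adj (x ^ n) = adj (x::'a::separable_infinite_hilbert bop) ^ n"
  by (induction n) (simp_all add: adj_times power_commutes)

lemma adj_exp: "adj (exp x) = exp (adj (x::'a::separable_infinite_hilbert bop))"
proof (rule sums_unique2)
  show "(\<lambda>n. adj (x ^ n /\<^sub>R fact n)) sums adj (exp x)"
    by (rule bounded_linear.sums[OF bounded_linear_adj exp_converges])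
  show "(\<lambda>n. adj (x ^ n /\<^sub>R fact n)) sums exp (adj x)"
    using exp_converges[of "adj x"] by (simp add: adj_scaleR adj_power)
qed

lemma scaleC_minus_bop: "(- c) *\<^sub>C (x::'a::complex_hilbert bop) = - (c *\<^sub>C x)"
  by (rule bop_eqI) (simp add: bop_simps complex_vector.scale_minus_left)

lemma adj_exp_i: "hermitian z \<Longrightarrow> adj (exp ((\<i> * complex_of_real r) *\<^sub>C z)) = exp (- ((\<i> * complex_of_real r) *\<^sub>C (z::'a::separable_infinite_hilbert bop)))"
  by (simp add: adj_exp adj_scaleC hermitian_def scaleC_minus_bop)

lemma unitary_exp_i: "hermitian z \<Longrightarrow> unitary (exp ((\<i> * complex_of_real r) *\<^sub>C (z::'a::separable_infinite_hilbert bop)))"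
  unfolding unitary_def adj_exp_i by (simp add: exp_minus_inverse[of "- _", simplified] exp_minus_inverse)

subsection \<open>Real parts of unitaries\<close>

text \<open>Turns an eigenvalue exp (i t) into cos t. As 1 - \<open>re_part g\<close> is compact and
  Hermitian for the unitaries considered, the spectral theorem for such operators is enough.\<close>

definition re_part :: "'a::separable_infinite_hilbert bop \<Rightarrow> 'a bop" where
  "re_part g = (1/2) *\<^sub>R (g + adj g)"

lemma hermitian_re_part: "hermitian (re_part g)"
  by (simp add: hermitian_def re_part_def adj_simps add.commute)

lemma unitary_cinner: "unitary g \<Longrightarrow> cinner (g \<cdot> v) (g \<cdot> w) = cinner v w"
  by (metis cinner_adj_right one_bop_apply times_bop_apply unitary_def)

lemma Re_cinner_re_part: "Re (cinner (re_part g \<cdot> v) v) = Re (cinner (g \<cdot> v) v)"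
  by (simp add: re_part_def bop_simps cinner_simps cinner_adj_left)
    (simp add: cinner_commute[of v])

lemma re_part_bounds:
  assumes "unitary g" "norm e = 1" "re_part g \<cdot> e = x *\<^sub>R e"
  shows "\<bar>x\<bar> \<le> 1"
proof -
  have "x = Re (cinner (re_part g \<cdot> e) e)"
    using assms(2,3) by (simp add: cinner_simps cinner_self)
  also have "\<dots> = Re (cinner (g \<cdot> e) e)" by (rule Re_cinner_re_part)
  finally have "\<bar>x\<bar> \<le> cmod (cinner (g \<cdot> e) e)" using abs_Re_le_cmod by simp
  also have "\<dots> \<le> norm (g \<cdot> e) * norm e" by (rule Cauchy_Schwarz)
  finally show ?thesis using assms by (simp add: unitary_norm)
qed

text \<open>At eigenvectors of the real part of \<open>g\<close>, the derivative of the real part in the direction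
  \<open>\<i> g a\<close> is \<open>- Re \<langle>a e, S e\<rangle>\<close>, where \<open>S\<close> is the imaginary part of \<open>g\<close>; since
  \<open>S\<^sup>2 = 1 - (re_part g)\<^sup>2\<close>, the vectors \<open>S e\<close> are again orthogonal.\<close>
lemma envelope_bound:
  fixes g V :: "'a::separable_infinite_hilbert bop"
  assumes g: "unitary g" and a: "compact_hermitian ((- \<i>) *\<^sub>C (adj g * V))"
    and e: "orthonormal_on {..<k} e" and x: "\<And>j. j < k \<Longrightarrow> re_part g \<cdot> e j = x j *\<^sub>R e j"
    and c: "\<And>j. j < k \<Longrightarrow> 0 \<le> c j" "\<And>j. j < k \<Longrightarrow> c j * sqrt (1 - (x j)\<^sup>2) \<le> 1"
  shows "- (\<Sum>j<k. c j * Re (cinner (re_part V \<cdot> e j) (e j))) \<le> kyfan k ((- \<i>) *\<^sub>C (adj g * V))"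
proof -
  define A where "A = (- \<i>) *\<^sub>C (adj g * V)"
  define S where "S = (- \<i> / 2) *\<^sub>C (g - adj g)"
  have gag: "g \<cdot> adj g \<cdot> v = v" for v using g by (metis one_bop_apply times_bop_apply unitary_def)
  have SS: "cinner (S \<cdot> v) (S \<cdot> w) = cinner v w - cinner (re_part g \<cdot> v) (re_part g \<cdot> w)" for v w
    using unitary_cinner[OF g, of v w] unitary_cinner[OF unitary_adj[OF g], of v w]
    by (simp add: S_def re_part_def bop_simps cinner_simps algebra_simps)
  have Se: "cinner (S \<cdot> e i) (S \<cdot> e j) = of_real (if i = j then 1 - (x i)\<^sup>2 else 0)" if "i < k" "j < k" for i j
    using e that by (simp add: SS x cinner_simps orthonormal_on_def power2_eq_square)
  have nS: "norm (S \<cdot> e j) = sqrt (1 - (x j)\<^sup>2)" if "j < k" for j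
    using Se[OF that that] by (simp add: cinner_self real_sqrt_unique del: of_real_power of_real_diff)
  \<comment> \<open>The hypothesis on c j is exactly that these orthogonal vectors have norm at most
    1, so they may be used in a Ky Fan sum.\<close>
  define h where "h j = c j *\<^sub>R (S \<cdot> e j)" for j
  have h: "suborthonormal_on {..<k} h"
    using c Se nS by (auto simp: suborthonormal_on_def h_def cinner_simps)
  have Re: "- (c j * Re (cinner (re_part V \<cdot> e j) (e j))) = Re (cinner (A \<cdot> e j) (h j))" if "j < k" for j
  proof -
    have VA: "V \<cdot> e j = \<i> *\<^sub>C g \<cdot> A \<cdot> e j"
      by (simp add: A_def bop_simps gag scaleC_scaleC bop_apply_minus
          complex_vector.scale_minus_left complex_vector.scale_minus_right)
    have ag: "adj g \<cdot> e j = x j *\<^sub>R e j - \<i> *\<^sub>C (S \<cdot> e j)"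
    proof -
      have "re_part g \<cdot> e j - \<i> *\<^sub>C (S \<cdot> e j) = (1/2) *\<^sub>R (adj g \<cdot> e j) + (1/2) *\<^sub>R (adj g \<cdot> e j)"
        by (simp add: re_part_def S_def bop_simps scaleC_scaleC complex_vector.scale_right_diff_distrib
            scaleC_of_real[symmetric] scaleC_add_right)
      also have "\<dots> = adj g \<cdot> e j" by (simp add: scaleR_add_left[symmetric])
      finally show ?thesis using x[OF that] by simp
    qed
    have "cinner (V \<cdot> e j) (e j) = \<i> * cinner (A \<cdot> e j) (adj g \<cdot> e j)"
      by (simp add: VA cinner_simps cinner_adj_right)
    also have "\<dots> = \<i> * of_real (x j) * cinner (A \<cdot> e j) (e j) - cinner (A \<cdot> e j) (S \<cdot> e j)"
      by (simp add: ag cinner_simps algebra_simps)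
    finally have "Re (cinner (V \<cdot> e j) (e j)) = - x j * Im (cinner (A \<cdot> e j) (e j)) - Re (cinner (A \<cdot> e j) (S \<cdot> e j))"
      by simp
    \<comment> \<open>Hermiticity of A kills the contribution of the real part of g; only the one of
      S remains.\<close>
    also have "Im (cinner (A \<cdot> e j) (e j)) = 0"
      by (rule hermitian_cinner_real) (use a in \<open>simp add: A_def compact_hermitian_def\<close>)
    finally show ?thesis by (simp add: Re_cinner_re_part h_def cinner_simps)
  qed
  have "- (\<Sum>j<k. c j * Re (cinner (re_part V \<cdot> e j) (e j))) = (\<Sum>j<k. Re (cinner (A \<cdot> e j) (h j)))"
    unfolding sum_negf[symmetric] by (intro sum.cong refl Re) simp
  also have "\<dots> \<le> (\<Sum>j<k. cmod (cinner (A \<cdot> e j) (h j)))"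
    by (intro sum_mono complex_Re_le_cmod)
  also have "\<dots> \<le> kyfan k A"
    by (rule kyfan_upper[OF _ orthonormal_on_imp_suborthonormal_on[OF e] h]) (use a in \<open>simp add: A_def\<close>)
  finally show ?thesis by (simp add: A_def)
qed

lemma tendsto_of_abs_diff_le:
  fixes f g :: "'b \<Rightarrow> real"
  assumes "\<forall>\<^sub>F s in F. \<bar>f s - l\<bar> \<le> g s" "(g \<longlongrightarrow> 0) F"
  shows "(f \<longlongrightarrow> l) F"
  by (rule Lim_null[THEN iffD2], rule Lim_null_comparison[OF _ assms(2)]) (use assms(1) in simp)

section \<open>Polynomials in the real part of a unitary\<close>

context gauge_norm
begin

lemma re_part_norm_ideal:
  assumes "unitary g" "g - 1 \<in> norm_ideal N"
  shows "1 - re_part g \<in> norm_ideal N"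
proof -
  have ag: "adj g - 1 = - (adj g * (g - 1))" using assms(1) by (simp add: unitary_def algebra_simps)
  have "1 - re_part g = (1/2) *\<^sub>R (- (g - 1) - (adj g - 1))"
  proof -
    have "(1/2) *\<^sub>R (2::'h bop) = 1" by (metis scaleR_half_double one_add_one)
    then show ?thesis by (simp add: re_part_def algebra_simps)
  qed
  also have "\<dots> \<in> norm_ideal N"
    unfolding ag
    by (rule norm_ideal_scaleR[OF norm_ideal_diff[OF norm_ideal_uminus[OF assms(2)]
          norm_ideal_uminus[OF norm_ideal_mult_left[OF assms(2)]]]])
  finally show ?thesis .
qed

definition arc_op :: "nat \<Rightarrow> 'h bop \<Rightarrow> 'h bop" where
  "arc_op m g = poly (asin_poly m) 1 *\<^sub>R 1 - op_poly (asin_poly m) (re_part g)"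

lemma arc_op_compact_hermitian:
  assumes "unitary g" "g - 1 \<in> norm_ideal N"
  shows "compact_hermitian (arc_op m g)"
  unfolding arc_op_def
  by (intro norm_ideal_compact_hermitian op_poly_norm_ideal re_part_norm_ideal assms hermitian_diff hermitian_scaleR
      hermitian_one hermitian_op_poly hermitian_re_part)

lemma arc_op_eigen:
  "re_part g \<cdot> e = x *\<^sub>R e \<Longrightarrow> arc_op m g \<cdot> e = (poly (asin_poly m) 1 - poly (asin_poly m) x) *\<^sub>R e"
  by (simp add: arc_op_def bop_simps op_poly_eigen scaleR_left_diff_distrib)

text \<open>The polynomials are increasing, so for every m they keep the order of the eigenvalues:
  one family of eigenvectors computes all Ky Fan sums. The eigenvalues obtained are nonnegative, so
  no signs appear.\<close>

lemma arc_op_eigsys: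
  assumes g: "unitary g" "g - 1 \<in> norm_ideal N"
  obtains e x where "orthonormal_on UNIV e" "\<And>n. re_part g \<cdot> e n = x n *\<^sub>R e n" "\<And>n. \<bar>x n\<bar> \<le> 1"
    "\<And>m k. kyfan k (arc_op m g) = (\<Sum>j<k. Re (cinner (arc_op m g \<cdot> e j) (e j)))"
proof -
  have "compact_hermitian (1 - re_part g)"
    by (intro norm_ideal_compact_hermitian re_part_norm_ideal g hermitian_diff hermitian_one hermitian_re_part)
  then obtain e l where es: "eigsys (1 - re_part g) e l" using compact_hermitian_eigsys by blast
  define x where "x n = 1 - l n" for n
  have x: "re_part g \<cdot> e n = x n *\<^sub>R e n" for n
    using eigsysD(2)[OF es, of n]
    by (simp add: bop_simps x_def scaleC_of_real scaleR_left_diff_distrib algebra_simps)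
  have x1: "\<bar>x n\<bar> \<le> 1" for n by (rule re_part_bounds[OF g(1) eigsysD(8)[OF es] x])
  then have l0: "0 \<le> l n" for n by (metis abs_le_D1 diff_le_eq le_add_same_cancel1 x_def)
  have kf: "kyfan k (arc_op m g) = (\<Sum>j<k. Re (cinner (arc_op m g \<cdot> e j) (e j)))" for m k
  proof -
    define f where "f n = poly (asin_poly m) 1 - poly (asin_poly m) (x n)" for n
    have f0: "f n \<ge> 0" for n using asin_poly_mono[of "x n" 1 m] x1[of n] by (simp add: f_def)
    have ae: "arc_op m g \<cdot> e n = complex_of_real (f n) *\<^sub>C e n" for n
      by (simp add: arc_op_eigen[OF x] f_def scaleC_of_real del: of_real_diff)
    have "eigsys (arc_op m g) e f" unfolding eigsys_def
    proof (intro conjI allI impI)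
      show "orthonormal_on UNIV e" by (rule eigsysD(1)[OF es])
      show "arc_op m g \<cdot> e n = complex_of_real (f n) *\<^sub>C e n" for n by (rule ae)
      fix v assume "\<forall>n. cinner v (e n) = 0"
      then have "(1 - re_part g) \<cdot> v = 0" using eigsysD(3)[OF es, of v] by blast
      then have "re_part g \<cdot> v = 1 *\<^sub>R v" by (simp add: bop_simps)
      from arc_op_eigen[OF this] show "arc_op m g \<cdot> v = 0" by simp
    next
      show "decseq (\<lambda>n. \<bar>f n\<bar>)" unfolding decseq_def
      proof (intro allI impI)
        fix i j :: nat assume "i \<le> j"
        then have "l j \<le> l i" using decseqD[OF eigsysD(4)[OF es], of i j] l0 by simp
        then have "poly (asin_poly m) (x i) \<le> poly (asin_poly m) (x j)"
          by (intro asin_poly_mono) (simp add: x_def)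
        then show "\<bar>f j\<bar> \<le> \<bar>f i\<bar>" using f0[of i] f0[of j] by (simp add: f_def)
      qed
      have "f \<longlonglongrightarrow> poly (asin_poly m) 1 - poly (asin_poly m) (1 - 0)"
        unfolding f_def x_def by (intro tendsto_intros eigsysD(5)[OF es])
      then show "f \<longlonglongrightarrow> 0" by simp
    qed
    then have "singular_values (arc_op m g) = (\<lambda>j. \<bar>f j\<bar>)"
      by (intro singular_values_eigsys) (use arc_op_compact_hermitian[OF g] in \<open>auto simp: compact_hermitian_def\<close>)
    then show ?thesis
      using f0 eigsysD(7)[OF es] by (simp add: kyfan_def ae cinner_simps)
  qed
  show ?thesis by (rule that[OF eigsysD(1)[OF es] x x1 kf])
qed

subsection \<open>Curves of unitaries\<close>

text \<open>Working form of a piecewise smooth curve. \<open>V\<close> matters only off the finite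
  set \<open>B\<close>; there it is the derivative in operator norm, which the spectral arguments
  use, while continuity and boundedness are required in \<open>nu\<close>, which the length
  uses.\<close>

definition regular :: "(real \<Rightarrow> 'h bop) \<Rightarrow> (real \<Rightarrow> 'h bop) \<Rightarrow> real set \<Rightarrow> bool" where
  "regular \<gamma> V B \<longleftrightarrow> finite B \<and> {0, 1} \<subseteq> B \<and>
     (\<forall>t\<in>{0..1}. unitary (\<gamma> t) \<and> \<gamma> t - 1 \<in> norm_ideal N) \<and> continuous_on {0..1} \<gamma> \<and>
     (\<forall>t\<in>{0..1}-B. (\<gamma> has_vector_derivative V t) (at t within {0..1}) \<and> V t \<in> norm_ideal N \<and>
        ((\<lambda>s. nu (V s - V t)) \<longlongrightarrow> 0) (at t within {0..1}-B)) \<and>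
     (\<exists>M. \<forall>t\<in>{0..1}-B. nu (V t) \<le> M)"

text \<open>The operator a in the equation V = i \<open>\<gamma>\<close> a.\<close>

definition angvel :: "(real \<Rightarrow> 'h bop) \<Rightarrow> (real \<Rightarrow> 'h bop) \<Rightarrow> real \<Rightarrow> 'h bop" where
  "angvel \<gamma> V t = (- \<i>) *\<^sub>C (adj (\<gamma> t) * V t)"

lemma N_angvel: "unitary (\<gamma> t) \<Longrightarrow> N (angvel \<gamma> V t) = N (V t)"
  unfolding angvel_def scaleC by (simp add: N_unitary_left unitary_adj)

lemma regularD:
  assumes "regular \<gamma> V B"
  shows "finite B" "0 \<in> B" "1 \<in> B" "t \<in> {0..1} \<Longrightarrow> unitary (\<gamma> t)" "t \<in> {0..1} \<Longrightarrow> \<gamma> t - 1 \<in> norm_ideal N"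
    "continuous_on {0..1} \<gamma>" "t \<in> {0..1}-B \<Longrightarrow> (\<gamma> has_vector_derivative V t) (at t within {0..1})"
    "t \<in> {0..1}-B \<Longrightarrow> V t \<in> norm_ideal N" 
    "t \<in> {0..1}-B \<Longrightarrow> ((\<lambda>s. nu (V s - V t)) \<longlongrightarrow> 0) (at t within {0..1}-B)"
    "\<exists>M. \<forall>t\<in>{0..1}-B. nu (V t) \<le> M"
  using assms unfolding regular_def by auto

text \<open>Differentiating the identity that the adjoint of \<open>\<gamma>\<close> times
  \<open>\<gamma>\<close> is 1 gives hermiticity; membership in the ideal gives compactness.\<close>

lemma angvel_compact_hermitian:
  assumes r: "regular \<gamma> V B" and t: "t \<in> {0..1} - B"
  shows "angvel \<gamma> V t \<in> norm_ideal N" "hermitian (angvel \<gamma> V t)" "compact_hermitian (angvel \<gamma> V t)" "nu (angvel \<gamma> V t) = nu (V t)"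
proof -
  have t01: "t \<in> {0..1}" using t by simp
  note u = regularD(4)[OF r t01]
  show nu: "nu (angvel \<gamma> V t) = nu (V t)" by (simp add: nu_def N_angvel u)
  show I: "angvel \<gamma> V t \<in> norm_ideal N"
    using regularD(8)[OF r t] by (simp add: norm_ideal_def N_angvel u)
  have "((\<lambda>s. adj (\<gamma> s) * \<gamma> s) has_vector_derivative (adj (\<gamma> t) * V t + adj (V t) * \<gamma> t)) (at t within {0..1})"
    by (intro bounded_bilinear.has_vector_derivative[OF bounded_bilinear_mult]
        bounded_linear.has_vector_derivative[OF bounded_linear_adj] regularD(7)[OF r t])
  moreover have "((\<lambda>s. adj (\<gamma> s) * \<gamma> s) has_vector_derivative 0) (at t within {0..1})"
    by (rule has_vector_derivative_transform[OF t01, of _ "\<lambda>_. 1"])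
       (use regularD(4)[OF r] in \<open>auto simp: unitary_def\<close>)
  ultimately have "adj (\<gamma> t) * V t + adj (V t) * \<gamma> t = 0"
    using vector_derivative_unique_within[of t "{0..1}"] t01 by (metis atLeastAtMost_iff trivial_limit_within islimpt_Icc zero_less_one)
  then have *: "adj (V t) * \<gamma> t = - (adj (\<gamma> t) * V t)" by (simp add: eq_neg_iff_add_eq_0 add.commute)
  show h: "hermitian (angvel \<gamma> V t)"
    unfolding hermitian_def angvel_def adj_scaleC adj_times adj_adj * 
    by (rule bop_eqI) (simp add: bop_simps complex_vector.scale_minus_right complex_vector.scale_minus_left)
  show "compact_hermitian (angvel \<gamma> V t)" by (rule norm_ideal_compact_hermitian[OF I h])
qed

lemma nu_velocity_continuous:
  assumes r: "regular \<gamma> V B"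
  shows "continuous_on ({0..1} - B) (\<lambda>t. nu (V t))" "continuous_on ({0..1} - B) V"
  unfolding continuous_on_def
proof (safe del: DiffE)
  fix t assume t: "t \<in> {0..1} - B"
  have ev: "\<forall>\<^sub>F s in at t within {0..1} - B. s \<in> {0..1} - B"
    by (simp add: eventually_at_filter)
  note lim = regularD(9)[OF r t]
  show "((\<lambda>t. nu (V t)) \<longlongrightarrow> nu (V t)) (at t within {0..1} - B)"
  proof (rule tendsto_of_abs_diff_le[OF _ lim])
    show "\<forall>\<^sub>F s in at t within {0..1} - B. \<bar>nu (V s) - nu (V t)\<bar> \<le> nu (V s - V t)"
      using ev by eventually_elim (intro nu_diff_le regularD(8)[OF r] t)
  qed
  show "(V \<longlongrightarrow> V t) (at t within {0..1} - B)"
  proof (rule Lim_null_comparison[THEN Lim_null[THEN iffD2]])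
    show "((\<lambda>s. embed_const * nu (V s - V t)) \<longlongrightarrow> 0) (at t within {0..1} - B)"
      using tendsto_mult_left[OF lim, of embed_const] by simp
    show "\<forall>\<^sub>F s in at t within {0..1} - B. norm (V s - V t) \<le> embed_const * nu (V s - V t)"
      using ev by eventually_elim (intro norm_le_nu norm_ideal_diff regularD(8)[OF r] t)
  qed
qed

lemma norm_scaleC_bop: "norm (c *\<^sub>C (x::'h bop)) \<le> cmod c * norm x"
  by (rule norm_bop_bound)
    (use mult_left_mono[OF norm_bop_apply, of "cmod c" x] in \<open>auto simp: bop_simps norm_scaleC ac_simps\<close>)

lemma bounded_linear_scaleC_bop: "bounded_linear (\<lambda>x::'h bop. c *\<^sub>C x)"
proof (rule bounded_linear_intro[where K="cmod c"])
  fix x y :: "'h bop" and r :: real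
  show "c *\<^sub>C (x + y) = c *\<^sub>C x + c *\<^sub>C y" by (rule bop_eqI) (simp add: bop_simps scaleC_add_right)
  show "c *\<^sub>C r *\<^sub>R x = r *\<^sub>R c *\<^sub>C x"
    by (rule bop_eqI) (simp add: bop_simps scaleC_of_real[symmetric] scaleC_scaleC mult.commute)
  show "norm (c *\<^sub>C x) \<le> norm x * cmod c"
    using norm_scaleC_bop[of c x] by (simp add: mult.commute)
qed

lemma angvel_continuous:
  assumes r: "regular \<gamma> V B"
  shows "continuous_on ({0..1} - B) (angvel \<gamma> V)"
  unfolding angvel_def[abs_def]
  by (intro bounded_linear.continuous_on[OF bounded_linear_scaleC_bop] continuous_on_mult
      bounded_linear.continuous_on[OF bounded_linear_adj] nu_velocity_continuous[OF r]
      continuous_on_subset[OF regularD(6)[OF r]]) auto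

lemma kyfan_continuous_on:
  assumes "continuous_on S x" "\<And>t. t \<in> S \<Longrightarrow> compact_hermitian (x t)"
  shows "continuous_on S (\<lambda>t. kyfan k (x t))"
  unfolding continuous_on_def
proof
  fix t assume t: "t \<in> S"
  have "((\<lambda>s. x s - x t) \<longlongrightarrow> 0) (at t within S)"
    using assms(1) t Lim_null by (auto simp: continuous_on_def)
  then have lim: "((\<lambda>s. k * norm (x s - x t)) \<longlongrightarrow> 0) (at t within S)"
    using tendsto_mult_left[OF tendsto_norm_zero, of "\<lambda>s. x s - x t" _ "real k"] by simp
  have ev: "\<forall>\<^sub>F s in at t within S. s \<in> S" by (simp add: eventually_at_filter)
  show "((\<lambda>t. kyfan k (x t)) \<longlongrightarrow> kyfan k (x t)) (at t within S)"
  proof (rule tendsto_of_abs_diff_le[OF _ lim])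
    show "\<forall>\<^sub>F s in at t within S. \<bar>kyfan k (x s) - kyfan k (x t)\<bar> \<le> k * norm (x s - x t)"
      using ev by eventually_elim (intro kyfan_lipschitz assms(2) t)
  qed
qed

lemma kyfan_angvel_bound:
  assumes r: "regular \<gamma> V B"
  obtains M where "\<And>t k. t \<in> {0..1} - B \<Longrightarrow> \<bar>kyfan k (angvel \<gamma> V t)\<bar> \<le> real k * M"
    "\<And>t j. t \<in> {0..1} - B \<Longrightarrow> \<bar>singular_values (angvel \<gamma> V t) j\<bar> \<le> M"
proof -
  obtain M where M: "\<And>t. t \<in> {0..1} - B \<Longrightarrow> nu (V t) \<le> M" using regularD(10)[OF r] by blast
  have s: "\<bar>singular_values (angvel \<gamma> V t) j\<bar> \<le> embed_const * M" if t: "t \<in> {0..1} - B" for t j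
  proof -
    note a = angvel_compact_hermitian[OF r t]
    have "singular_values (angvel \<gamma> V t) j \<le> norm (angvel \<gamma> V t)" by (rule compact_hermitian_singular_values(4)[OF a(3)])
    also have "\<dots> \<le> embed_const * nu (angvel \<gamma> V t)" by (rule norm_le_nu[OF a(1)])
    also have "\<dots> \<le> embed_const * M" unfolding a(4) using M[OF t] embed_const(1) by simp
    finally show ?thesis using compact_hermitian_singular_values(3)[OF a(3), of j] by simp
  qed
  have "\<bar>kyfan k (angvel \<gamma> V t)\<bar> \<le> k * (embed_const * M)" if t: "t \<in> {0..1} - B" for t k
    unfolding kyfan_def
    by (rule order_trans[OF sum_abs], rule order_trans[OF sum_mono[of _ _ "\<lambda>_. embed_const * M"]])
      (use s[OF t] in simp_all)
  then show ?thesis using that s by blast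
qed

lemma kyfan_angvel_integrable:
  assumes r: "regular \<gamma> V B"
  shows "(\<lambda>t. kyfan k (angvel \<gamma> V t)) integrable_on {0..1}"
    "continuous_on ({0..1} - B) (\<lambda>t. kyfan k (angvel \<gamma> V t))"
proof -
  show c: "continuous_on ({0..1} - B) (\<lambda>t. kyfan k (angvel \<gamma> V t))"
    by (rule kyfan_continuous_on[OF angvel_continuous[OF r] angvel_compact_hermitian(3)[OF r]])
  obtain M where M: "\<And>t k. t \<in> {0..1} - B \<Longrightarrow> \<bar>kyfan k (angvel \<gamma> V t)\<bar> \<le> real k * M"
    using kyfan_angvel_bound[OF r] by metis
  show "(\<lambda>t. kyfan k (angvel \<gamma> V t)) integrable_on {0..1}"
    by (rule finitely_discontinuous_integral(1)[OF regularD(1)[OF r] c]) (rule M)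
qed

lemma kyfan_zero: "kyfan k (0::'h bop) = 0"
proof -
  have "compact_hermitian (0::'h bop)" by (intro norm_ideal_compact_hermitian norm_ideal_zero hermitian_zero)
  then obtain v w where "kyfan k (0::'h bop) = (\<Sum>j<k. Re (cinner ((0::'h bop) \<cdot> v j) (w j)))"
    by (rule kyfan_attained)
  then show ?thesis by simp
qed

lemma op_poly_one: "op_poly p 1 = poly p 1 *\<^sub>R (1::'h bop)"
  by (simp add: op_poly_def poly_altdef scaleR_sum_left)

lemma kyfan_arc_op_le_integral:
  assumes r: "regular \<gamma> V B" and \<gamma>0: "\<gamma> 0 = 1"
  shows "kyfan k (arc_op m (\<gamma> 1)) \<le> integral {0..1} (\<lambda>t. kyfan k (angvel \<gamma> V t))"
proof -
  let ?K = "\<lambda>t. kyfan k (angvel \<gamma> V t)"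
  let ?P = "asin_poly m"
  define H where "H t = kyfan k (arc_op m (\<gamma> t)) - integral {0..t} ?K" for t
  note I = kyfan_angvel_integrable[OF r, of k]
  have ch: "compact_hermitian (arc_op m (\<gamma> t))" if "t \<in> {0..1}" for t
    by (intro arc_op_compact_hermitian regularD(4,5)[OF r] that)
  have "H 1 \<le> H 0"
  proof (rule nonincreasing_of_left_bounds[where H=H and a=0 and b=1 and B=B])
    have "continuous_on {0..1} (\<lambda>t. arc_op m (\<gamma> t))"
      unfolding arc_op_def re_part_def op_poly_def
      by (intro continuous_intros regularD(6)[OF r] bounded_linear.continuous_on[OF bounded_linear_adj])
    then show "continuous_on {0..1} H" unfolding H_def
      by (intro continuous_on_diff kyfan_continuous_on ch indefinite_integral_continuous_1 I) auto
    fix t assume "t \<in> {0<..<1} - B"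
    then have t: "t \<in> {0..1} - B" and t01: "t \<in> {0..1}" by auto
    obtain e x where e: "orthonormal_on UNIV e" "\<And>n. re_part (\<gamma> t) \<cdot> e n = x n *\<^sub>R e n" "\<And>n. \<bar>x n\<bar> \<le> 1"
      and kf: "\<And>m k. kyfan k (arc_op m (\<gamma> t)) = (\<Sum>j<k. Re (cinner (arc_op m (\<gamma> t) \<cdot> e j) (e j)))"
      using arc_op_eigsys[OF regularD(4,5)[OF r t01]] by metis
    \<comment> \<open>With the eigenvectors frozen at time t, R equals the Ky Fan sum at s = t and
      is at most the Ky Fan sum at every other s: it is the differentiable comparison
      function.\<close>
    define R where "R s = (\<Sum>j<k. Re (cinner (arc_op m (\<gamma> s) \<cdot> e j) (e j)))" for s
    have ek: "orthonormal_on {..<k} e" by (rule orthonormal_on_subset[OF e(1)]) simp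
    define D where "D = - (\<Sum>j<k. poly (pderiv ?P) (x j) * Re (cinner (re_part (V t) \<cdot> e j) (e j)))"
    have "(R has_real_derivative D) (at t within {0..1})"
    proof -
      have "((\<lambda>s. re_part (\<gamma> s)) has_vector_derivative re_part (V t)) (at t within {0..1})"
        unfolding re_part_def
        by (intro bounded_linear.has_vector_derivative[OF bounded_linear_scaleR_right] has_vector_derivative_add
            bounded_linear.has_vector_derivative[OF bounded_linear_adj] regularD(7)[OF r t])
      from op_poly_has_derivative[OF this hermitian_re_part e(2)]
      have *: "((\<lambda>s. Re (cinner (op_poly ?P (re_part (\<gamma> s)) \<cdot> e j) (e j))) has_real_derivative
         poly (pderiv ?P) (x j) * Re (cinner (re_part (V t) \<cdot> e j) (e j))) (at t within {0..1})" for j .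
      have "R = (\<lambda>s. \<Sum>j<k. Re (cinner (poly ?P 1 *\<^sub>R e j) (e j)) - Re (cinner (op_poly ?P (re_part (\<gamma> s)) \<cdot> e j) (e j)))"
        by (simp add: R_def arc_op_def bop_simps cinner_simps fun_eq_iff)
      moreover have "(\<dots> has_real_derivative (\<Sum>j<k. 0 - poly (pderiv ?P) (x j) * Re (cinner (re_part (V t) \<cdot> e j) (e j)))) (at t within {0..1})"
        by (intro DERIV_sum DERIV_diff DERIV_const *)
      ultimately show ?thesis by (simp add: D_def sum_negf)
    qed
    moreover have "((\<lambda>s. integral {0..s} ?K) has_real_derivative ?K t) (at t within {0..1})"
      by (rule finitely_discontinuous_integral_deriv[OF regularD(1)[OF r] I(2,1) t])
    ultimately have "((\<lambda>s. R s - integral {0..s} ?K) has_real_derivative D - ?K t) (at t within {0..1})"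
      by (rule DERIV_diff)
    \<comment> \<open>The weights are the derivative of the polynomial at the eigenvalues
      \<open>x j\<close>; its 1-Lipschitz property in the angle is the condition of
      \<open>envelope_bound\<close>.\<close>
    moreover have "D - ?K t \<le> 0"
      using envelope_bound[OF regularD(4)[OF r t01] angvel_compact_hermitian(3)[OF r t, unfolded angvel_def] ek e(2),
          where c="\<lambda>j. poly (pderiv ?P) (x j)"] pderiv_asin_poly_nonneg pderiv_asin_poly_sqrt[OF e(3)]
      by (simp add: D_def angvel_def)
    moreover have "H t - H s \<le> (R t - integral {0..t} ?K) - (R s - integral {0..s} ?K)" if s: "s \<in> {0..<t}" for s
    proof -
      have s01: "s \<in> {0..1}" using s t01 by auto
      note sub = orthonormal_on_imp_suborthonormal_on[OF ek]
      have "R s \<le> (\<Sum>j<k. cmod (cinner (arc_op m (\<gamma> s) \<cdot> e j) (e j)))"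
        unfolding R_def by (intro sum_mono complex_Re_le_cmod)
      also have "\<dots> \<le> kyfan k (arc_op m (\<gamma> s))" by (rule kyfan_upper[OF ch[OF s01] sub sub])
      finally show ?thesis by (simp add: H_def R_def kf)
    qed
    ultimately show "\<exists>h D. (h has_real_derivative D) (at t within {0..1}) \<and> D \<le> 0 \<and> (\<forall>s\<in>{0..<t}. H t - H s \<le> h t - h s)"
      by blast
  qed (use regularD(1)[OF r] in auto)
  moreover have "arc_op m (\<gamma> 0) = 0"
  proof -
    have "re_part (\<gamma> 0) = 1" by (simp add: \<gamma>0 re_part_def scaleR_2[symmetric])
    then show ?thesis by (simp add: arc_op_def op_poly_one)
  qed
  ultimately show ?thesis by (simp add: H_def kyfan_zero)
qed

text \<open>At the end point the eigenvectors of \<open>z\<close> are eigenvectors of the real part,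
  with eigenvalues cos (l j). Since |l j| < pi, arccos recovers |l j|, and the polynomials
  approximate it simultaneously for the k indices.\<close>

theorem curve_weak_majorization:
  assumes r: "regular \<gamma> V B" and \<gamma>: "\<gamma> 0 = 1" "\<gamma> 1 = exp (\<i> *\<^sub>C z)"
    and z: "hermitian z" "eigsys z e l" "norm z < pi"
  shows "(\<Sum>j<k. \<bar>l j\<bar>) \<le> integral {0..1} (\<lambda>t. kyfan k (angvel \<gamma> V t))"
proof (rule field_le_epsilon)
  fix \<epsilon> :: real assume \<epsilon>: "\<epsilon> > 0"
  \<comment> \<open>An error d for each of k indices adds up to at most \<open>\<epsilon>\<close>;
    the summand 1 covers k = 0.\<close>
  define d where "d = \<epsilon> / (real k + 1)"
  have d: "d > 0" using \<epsilon> by (simp add: d_def)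
  have lpi: "\<bar>l j\<bar> < pi" for j
    using norm_bop_apply[of z "e j"] z(3) by (simp add: eigsysD(2,8)[OF z(2)] norm_scaleC)
  have cosl: "-1 < cos (l j)" for j
    using cos_monotone_0_pi[of "\<bar>l j\<bar>" pi] lpi[of j] by simp
  have "\<forall>\<^sub>F m in sequentially. \<forall>j\<in>{..<k}. arccos (cos (l j)) - d \<le> poly (asin_poly m) 1 - poly (asin_poly m) (cos (l j))"
    by (intro eventually_ball_finite ballI asin_poly_arccos cosl d) auto
  then obtain m where m: "\<And>j. j < k \<Longrightarrow> arccos (cos (l j)) - d \<le> poly (asin_poly m) 1 - poly (asin_poly m) (cos (l j))"
    unfolding eventually_sequentially by (meson lessThan_iff order_refl)
  have re: "re_part (\<gamma> 1) \<cdot> e j = cos (l j) *\<^sub>R e j" for j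
  proof -
    have ze: "z \<cdot> e j = complex_of_real (l j) *\<^sub>C e j" by (rule eigsysD(2)[OF z(2)])
    have "exp (\<i> *\<^sub>C z) \<cdot> e j = exp (\<i> * complex_of_real (l j)) *\<^sub>C e j"
      by (rule exp_eigen) (simp add: bop_simps ze scaleC_scaleC)
    moreover have "adj (exp (\<i> *\<^sub>C z)) = exp ((- \<i>) *\<^sub>C z)"
      using adj_exp_i[OF z(1), of 1] by (simp add: scaleC_minus_bop)
    moreover have "exp ((- \<i>) *\<^sub>C z) \<cdot> e j = exp (- \<i> * complex_of_real (l j)) *\<^sub>C e j"
      by (rule exp_eigen) (simp add: bop_simps ze scaleC_scaleC)
    ultimately have "re_part (\<gamma> 1) \<cdot> e j = ((exp (\<i> * complex_of_real (l j)) + exp (- \<i> * complex_of_real (l j))) / 2) *\<^sub>C e j"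
      by (simp add: re_part_def \<gamma>(2) bop_simps scaleC_of_real[symmetric] scaleC_add_left[symmetric] scaleC_scaleC scaleC_add_right[symmetric])
    also have "(exp (\<i> * complex_of_real (l j)) + exp (- \<i> * complex_of_real (l j))) / 2 = complex_of_real (cos (l j))"
      by (simp add: cos_exp_eq cos_of_real[symmetric])
    finally show ?thesis by (simp add: scaleC_of_real)
  qed
  have ek: "suborthonormal_on {..<k} e"
    by (intro orthonormal_on_imp_suborthonormal_on orthonormal_on_subset[OF eigsysD(1)[OF z(2)]]) simp
  have "(\<Sum>j<k. \<bar>l j\<bar>) - d * k = (\<Sum>j<k. arccos (cos (l j)) - d)"
    using lpi by (simp add: arccos_cos_eq_abs less_imp_le sum_subtractf)
  also have "\<dots> \<le> (\<Sum>j<k. cmod (cinner (arc_op m (\<gamma> 1) \<cdot> e j) (e j)))"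
  proof (rule sum_mono)
    fix j assume "j \<in> {..<k}"
    then show "arccos (cos (l j)) - d \<le> cmod (cinner (arc_op m (\<gamma> 1) \<cdot> e j) (e j))"
      using m[of j] eigsysD(7)[OF z(2), of j j] by (simp add: arc_op_eigen[OF re] cinner_simps norm_mult abs_le_iff flip: of_real_diff)
  qed
  also have "\<dots> \<le> kyfan k (arc_op m (\<gamma> 1))"
    by (rule kyfan_upper[OF _ ek ek]) (intro arc_op_compact_hermitian regularD(4,5)[OF r], auto)
  also have "\<dots> \<le> integral {0..1} (\<lambda>t. kyfan k (angvel \<gamma> V t))"
    by (rule kyfan_arc_op_le_integral[OF r \<gamma>(1)])
 finally have "(\<Sum>j<k. \<bar>l j\<bar>) - d * k \<le> integral {0..1} (\<lambda>t. kyfan k (angvel \<gamma> V t))" .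
  moreover have "d * k \<le> \<epsilon>" using \<epsilon> by (simp add: d_def field_simps)
  ultimately show "(\<Sum>j<k. \<bar>l j\<bar>) \<le> integral {0..1} (\<lambda>t. kyfan k (angvel \<gamma> V t)) + \<epsilon>"
    by linarith
qed

end

subsection \<open>The lower bound for the length\<close>

context gauge_norm
begin

text \<open>These sequences are the singular value sequences of the positive diagonal operators used
  below.\<close>

definition rearranged :: "(nat \<Rightarrow> real) \<Rightarrow> bool" where
  "rearranged s \<longleftrightarrow> decseq s \<and> (\<forall>j. 0 \<le> s j) \<and> s \<longlonglongrightarrow> 0"

lemma rearranged_diag:
  assumes e: "orthonormal_on UNIV e" and s: "rearranged s"
  shows "compact_hermitian (diag e s)" "N (diag e s) = (SUP n. ennreal (\<phi> (trunc n s)))"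
    "\<And>j. diag e s \<cdot> e j = complex_of_real (s j) *\<^sub>C e j"
proof -
  have a: "(\<lambda>n. \<bar>s n\<bar>) = s" using s by (auto simp: rearranged_def)
  have es: "eigsys (diag e s) e s" and ch: "compact_hermitian (diag e s)"
    using diag_eigsys[OF e, of s] s a by (auto simp: rearranged_def)
  show "compact_hermitian (diag e s)" by (rule ch)
  have "singular_values (diag e s) = s"
    using singular_values_eigsys[OF _ es] ch a by (simp add: compact_hermitian_def)
  then show "N (diag e s) = (SUP n. ennreal (\<phi> (trunc n s)))"
    using N_compact_hermitian[OF ch] by simp
  show "\<And>j. diag e s \<cdot> e j = complex_of_real (s j) *\<^sub>C e j" by (rule eigsysD(2)[OF es])
qed

lemma rearranged_diag_le:
  assumes e: "orthonormal_on UNIV e" and s: "rearranged s" and C: "\<And>n. \<phi> (trunc n s) \<le> C"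
  shows "diag e s \<in> norm_ideal N" "nu (diag e s) \<le> C"
proof -
  have C0: "0 \<le> C" using C[of 0] gauge.trunc_nonneg[of 0 s] by linarith
  have "N (diag e s) \<le> ennreal C"
    unfolding rearranged_diag(2)[OF e s] by (intro SUP_least ennreal_leI C)
  then show I: "diag e s \<in> norm_ideal N" by (auto simp: norm_ideal_def intro: le_less_trans)
  show "nu (diag e s) \<le> C" using \<open>N (diag e s) \<le> ennreal C\<close> norm_ideal_nu[OF I] C0 by (simp add: nu_nonneg)
qed

lemma rearranged_diag_ge:
  assumes e: "orthonormal_on UNIV e" and s: "rearranged s" and I: "diag e s \<in> norm_ideal N"
  shows "\<phi> (trunc n s) \<le> nu (diag e s)"
proof -
  have "ennreal (\<phi> (trunc n s)) \<le> N (diag e s)"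
    unfolding rearranged_diag(2)[OF e s] by (rule SUP_upper) simp
  then show ?thesis using norm_ideal_nu[OF I] by (simp add: nu_nonneg)
qed

lemma rearranged_add: "rearranged s \<Longrightarrow> rearranged t \<Longrightarrow> rearranged (\<lambda>j. s j + t j)"
  unfolding rearranged_def decseq_def by (auto intro: add_mono tendsto_add_zero)

lemma rearranged_bound: "rearranged s \<Longrightarrow> \<bar>s n\<bar> \<le> s 0"
  unfolding rearranged_def decseq_def by simp

lemma diag_rearranged_add:
  assumes e: "orthonormal_on UNIV e" and s: "rearranged s" and t: "rearranged t"
  shows "diag e (\<lambda>j. s j + t j) = diag e s + diag e t"
proof (rule diag_add[OF e])
  show "\<bar>s n\<bar> \<le> max (s 0) (t 0)" "\<bar>t n\<bar> \<le> max (s 0) (t 0)" for n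
    using rearranged_bound[OF s, of n] rearranged_bound[OF t, of n] by auto
qed

lemma diag_proportional:
  assumes e: "orthonormal_on UNIV e" and s: "rearranged s" and t: "rearranged t"
    and I: "diag e s \<in> norm_ideal N" "diag e t \<in> norm_ideal N" and k: "0 \<le> k" and st: "\<And>j. s j = k * t j"
  shows "nu (diag e s) = k * nu (diag e t)"
proof -
  have "diag e s = k *\<^sub>R diag e t"
  proof (rule diag_eq[OF e, of _ "s 0", symmetric])
    show "\<bar>s n\<bar> \<le> s 0" for n by (rule rearranged_bound[OF s])
    have b: "\<bar>t n\<bar> \<le> t 0" for n by (rule rearranged_bound[OF t])
    show "(k *\<^sub>R diag e t) \<cdot> e n = complex_of_real (s n) *\<^sub>C e n" for n
      by (simp add: bop_simps diag(1)[OF e b] st scaleC_of_real flip: of_real_mult)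
    show "(k *\<^sub>R diag e t) \<cdot> v = 0" if "\<And>n. cinner v (e n) = 0" for v
      by (simp add: bop_simps diag(2)[OF e b that])
  qed
  then show ?thesis using k by (simp add: nu_def N_scaleR enn2real_mult)
qed

text \<open>Rotundity gives a complex factor; comparing norms on each eigenvector replaces it by its
  modulus, because the entries are nonnegative.\<close>

lemma rotund_diag:
  assumes rot: "rotund N" and e: "orthonormal_on UNIV e" and s: "rearranged s" and t: "rearranged t"
    and I: "diag e s \<in> norm_ideal N" "diag e t \<in> norm_ideal N"
    and nz: "s i \<noteq> 0" "t j \<noteq> 0"
    and eq: "nu (diag e (\<lambda>j. s j + t j)) = nu (diag e s) + nu (diag e t)"
  obtains c where "c \<ge> 0" "\<And>j. s j = c * t j"
proof -
  note ds = rearranged_diag(3)[OF e s] and dt = rearranged_diag(3)[OF e t]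
  have e1: "norm (e j) = 1" for j by (rule orthonormal_on_norm[OF e]) simp
  have s0: "diag e s \<noteq> 0"
  proof
    assume "diag e s = 0"
    then show False using ds[of i] nz(1) e1[of i] by (auto simp: complex_vector.scale_eq_0_iff)
  qed
  have t0: "diag e t \<noteq> 0"
  proof
    assume "diag e t = 0"
    then show False using dt[of j] nz(2) e1[of j] by (auto simp: complex_vector.scale_eq_0_iff)
  qed
  have "N (diag e s + diag e t) = N (diag e s) + N (diag e t)"
    using eq norm_ideal_nu[OF I(1)] norm_ideal_nu[OF I(2)] norm_ideal_nu[OF norm_ideal_add[OF I]]
    by (simp add: diag_rearranged_add[OF e s t] nu_nonneg)
  then obtain c where c: "diag e s = c *\<^sub>C diag e t"
    using rot I s0 t0 unfolding rotund_def by blast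
  have "s j = cmod c * t j" for j
  proof -
    have "complex_of_real (s j) *\<^sub>C e j = c *\<^sub>C complex_of_real (t j) *\<^sub>C e j"
      using ds[of j] unfolding c scaleC_bop_apply dt by (rule sym)
    then have "norm (complex_of_real (s j) *\<^sub>C e j) = norm (c *\<^sub>C complex_of_real (t j) *\<^sub>C e j)" by (rule arg_cong)
    then show ?thesis using s t by (simp add: norm_scaleC e1 rearranged_def norm_mult)
  qed
  then show ?thesis using that[of "cmod c"] by simp
qed

end

section \<open>Length and integrated singular values of a curve\<close>

locale unitary_curve = gauge_norm N \<phi>
  for N :: "'h::separable_infinite_hilbert bop \<Rightarrow> ennreal" and \<phi> +
  fixes \<gamma> V :: "real \<Rightarrow> 'h bop" and B
  assumes reg: "regular \<gamma> V B"
begin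

text \<open>Both are set to 0 at the exceptional points, where \<open>V\<close> is arbitrary.\<close>

definition sv :: "real \<Rightarrow> nat \<Rightarrow> real" where
  "sv t j = (if t \<in> {0..1} - B then singular_values (angvel \<gamma> V t) j else 0)"

definition speed :: "real \<Rightarrow> real" where
  "speed t = (if t \<in> {0..1} - B then nu (V t) else 0)"

definition arclen :: "real \<Rightarrow> real \<Rightarrow> real" where
  "arclen a b = integral {a..b} speed"

text \<open>Integrating the ordered singular values index by index keeps the order, so the result is
  again \<open>rearranged\<close> and is additive over adjacent intervals.\<close>

definition \<sigma> :: "real \<Rightarrow> real \<Rightarrow> nat \<Rightarrow> real" where
  "\<sigma> a b j = integral {a..b} (\<lambda>t. sv t j)"

lemmas finB = regularD(1)[OF reg]
lemmas angvel_facts = angvel_compact_hermitian[OF reg]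

lemma speed_nonneg: "0 \<le> speed t" by (simp add: speed_def nu_nonneg)

lemma speed_cont: "continuous_on ({0..1} - B) speed"
  using nu_velocity_continuous(1)[OF reg] by (rule continuous_on_eq) (simp add: speed_def)

lemma speed_int: "speed integrable_on {0..1}"
proof -
  obtain M where "\<And>t. t \<in> {0..1} - B \<Longrightarrow> nu (V t) \<le> M" using regularD(10)[OF reg] by blast
  then show ?thesis
    by (intro finitely_discontinuous_integral(1)[OF finB speed_cont, of M]) (simp add: speed_def nu_nonneg)
qed

lemma speed_int_sub: "0 \<le> a \<Longrightarrow> b \<le> 1 \<Longrightarrow> speed integrable_on {a..b}"
  by (rule integrable_subinterval_real[OF speed_int]) auto

lemma sv_nonneg: "0 \<le> sv t j"
  using compact_hermitian_singular_values(3)[OF angvel_facts(3)] by (simp add: sv_def)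

lemma sv_dec: "i \<le> j \<Longrightarrow> sv t j \<le> sv t i"
  using compact_hermitian_singular_values(1)[OF angvel_facts(3)] by (simp add: sv_def decseqD)

lemma sv_cont: "continuous_on ({0..1} - B) (\<lambda>t. sv t j)"
proof -
  have "continuous_on ({0..1} - B) (\<lambda>t. kyfan (Suc j) (angvel \<gamma> V t) - kyfan j (angvel \<gamma> V t))"
    by (intro continuous_on_diff kyfan_angvel_integrable(2)[OF reg])
  then show ?thesis by (rule continuous_on_eq) (simp add: sv_def singular_values_kyfan)
qed

lemma sv_bound: obtains M where "\<And>t j. \<bar>sv t j\<bar> \<le> M"
proof -
  obtain M where "\<And>t j. t \<in> {0..1} - B \<Longrightarrow> \<bar>singular_values (angvel \<gamma> V t) j\<bar> \<le> M"
    using kyfan_angvel_bound[OF reg] by metis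
  then have "\<bar>sv t j\<bar> \<le> \<bar>M\<bar>" for t j
    using abs_ge_self[of M] by (cases "t \<in> {0..1} - B") (auto simp: sv_def intro: order_trans)
  then show ?thesis using that by blast
qed

lemma sv_int: "(\<lambda>t. sv t j) integrable_on {0..1}"
proof -
  obtain M where M: "\<And>t j. \<bar>sv t j\<bar> \<le> M" using sv_bound by blast
  show ?thesis by (rule finitely_discontinuous_integral(1)[OF finB sv_cont]) (rule M)
qed

lemma sv_int_sub: "0 \<le> a \<Longrightarrow> b \<le> 1 \<Longrightarrow> (\<lambda>t. sv t j) integrable_on {a..b}"
  by (rule integrable_subinterval_real[OF sv_int]) auto

lemma sum_\<sigma>:
  assumes "0 \<le> a" "b \<le> 1"
  shows "(\<Sum>j\<in>J. w j * \<sigma> a b j) = integral {a..b} (\<lambda>t. \<Sum>j\<in>J. w j * sv t j)"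
proof (cases "finite J")
  case True
  have "integral {a..b} (\<lambda>t. \<Sum>j\<in>J. w j * sv t j) = (\<Sum>j\<in>J. integral {a..b} (\<lambda>t. w j * sv t j))"
    using assms by (intro integral_sum True integrable_on_mult_right sv_int_sub)
  then show ?thesis by (simp add: \<sigma>_def)
qed simp

lemma \<sigma>_rearranged:
  assumes "0 \<le> a" "b \<le> 1"
  shows "rearranged (\<sigma> a b)"
  unfolding rearranged_def
proof (intro conjI allI)
  show "decseq (\<sigma> a b)" unfolding decseq_def \<sigma>_def
    using assms by (intro allI impI integral_le sv_int_sub sv_dec)
  show "0 \<le> \<sigma> a b j" for j unfolding \<sigma>_def
    using assms by (intro integral_nonneg sv_int_sub sv_nonneg)
  obtain M where M: "\<And>t j. \<bar>sv t j\<bar> \<le> M" using sv_bound by blast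
  have "(\<lambda>j. integral {a..b} (\<lambda>t. sv t j)) \<longlonglongrightarrow> integral {a..b} (\<lambda>t. 0)"
  proof (rule dominated_convergence(2))
    show "(\<lambda>t. sv t j) integrable_on {a..b}" for j using assms by (rule sv_int_sub)
    show "(\<lambda>t. M) integrable_on {a..b}" by (rule integrable_const_ivl)
    show "norm (sv t j) \<le> M" for t j using M by simp
    show "(\<lambda>j. sv t j) \<longlonglongrightarrow> 0" if "t \<in> {a..b}" for t
      using compact_hermitian_singular_values(2)[OF angvel_facts(3), of t] by (cases "t \<in> {0..1} - B") (auto simp: sv_def)
  qed
  then show "\<sigma> a b \<longlonglongrightarrow> 0" by (simp add: \<sigma>_def[abs_def])
qed

text \<open>Jensen's inequality for the gauge by duality: weights norming the integrated sequence
  are pulled inside the integral, where they are bounded by the gauge of the singular values, hence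
  by the speed.\<close>

lemma gauge_\<sigma>_le:
  assumes "0 \<le> a" "b \<le> 1"
  shows "\<phi> (trunc n (\<sigma> a b)) \<le> arclen a b"
proof -
  obtain w where w: "(\<Sum>j<n. w j * \<sigma> a b j) = \<phi> (trunc n (\<sigma> a b))" "\<And>c. (\<Sum>j<n. w j * c j) \<le> \<phi> (trunc n c)"
    using gauge.exists_norming_weights by blast
  have "(\<Sum>j<n. w j * sv t j) \<le> speed t" for t
  proof (cases "t \<in> {0..1} - B")
    case True
    have "sv t = singular_values (angvel \<gamma> V t)" using True by (simp add: sv_def fun_eq_iff)
    then have "\<phi> (trunc n (sv t)) \<le> nu (angvel \<gamma> V t)" using gauge_le_nu[OF angvel_facts(1,2)[OF True]] by simp
    with w(2) have "(\<Sum>j<n. w j * sv t j) \<le> nu (angvel \<gamma> V t)" by (rule order_trans)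
    also have "\<dots> = speed t" using True angvel_facts(4)[OF True] by (simp add: speed_def)
    finally show ?thesis .
  qed (auto simp: sv_def speed_def)
  then have "integral {a..b} (\<lambda>t. \<Sum>j<n. w j * sv t j) \<le> arclen a b" unfolding arclen_def
    using assms by (intro integral_le integrable_sum integrable_on_mult_right sv_int_sub speed_int_sub) auto
  then show ?thesis using sum_\<sigma>[OF assms, of w "{..<n}"] w(1) by simp
qed

lemma weak_majorization_\<sigma>:
  assumes \<gamma>: "\<gamma> 0 = 1" "\<gamma> 1 = exp (\<i> *\<^sub>C z)" and z: "hermitian z" "eigsys z e l" "norm z < pi"
  shows "(\<Sum>j<k. \<bar>l j\<bar>) \<le> (\<Sum>j<k. \<sigma> 0 1 j)"
proof -
  have "(\<Sum>j<k. \<bar>l j\<bar>) \<le> integral {0..1} (\<lambda>t. kyfan k (angvel \<gamma> V t))"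
    by (rule curve_weak_majorization[OF reg \<gamma> z])
  also have "\<dots> = integral {0..1} (\<lambda>t. \<Sum>j<k. 1 * sv t j)"
    by (rule integral_spike[OF negligible_finite[OF finB]]) (simp add: sv_def kyfan_def)
  also have "\<dots> = (\<Sum>j<k. 1 * \<sigma> 0 1 j)" by (rule sum_\<sigma>[symmetric]) auto
  finally show ?thesis by simp
qed

lemma eigsys_rearranged: "eigsys z e l \<Longrightarrow> rearranged (\<lambda>j. \<bar>l j\<bar>)"
  using eigsysD(4,6)[of z e l] by (simp add: rearranged_def)

lemma gauge_le_arclen:
  assumes \<gamma>: "\<gamma> 0 = 1" "\<gamma> 1 = exp (\<i> *\<^sub>C z)" and z: "hermitian z" "eigsys z e l" "norm z < pi"
  shows "\<phi> (trunc n (\<lambda>j. \<bar>l j\<bar>)) \<le> \<phi> (trunc n (\<sigma> 0 1))"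
  by (rule gauge.weak_majorization)
    (use eigsys_rearranged[OF z(2)] weak_majorization_\<sigma>[OF assms] in \<open>auto simp: rearranged_def decseq_Suc_iff\<close>)

theorem norm_le_arclen:
  assumes \<gamma>: "\<gamma> 0 = 1" "\<gamma> 1 = exp (\<i> *\<^sub>C z)" and z: "hermitian z" "z \<in> norm_ideal N" "norm z < pi"
  shows "nu z \<le> arclen 0 1"
proof -
  have ch: "compact_hermitian z" by (rule norm_ideal_compact_hermitian[OF z(2,1)])
  obtain e l where es: "eigsys z e l" and s: "singular_values z = (\<lambda>j. \<bar>l j\<bar>)"
    using compact_hermitian_eigsys[OF ch] by blast
  have "N z \<le> ennreal (arclen 0 1)" unfolding N_compact_hermitian[OF ch] s
    using gauge_le_arclen[OF \<gamma> z(1) es z(3)] gauge_\<sigma>_le[of 0 1]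
    by (intro SUP_least ennreal_leI) (meson order_trans order_refl)
  then show ?thesis using norm_ideal_nu[OF z(2)] speed_nonneg
    by (simp add: nu_nonneg arclen_def integral_nonneg speed_int)
qed

subsection \<open>The equality case\<close>

lemma arclen_add: "0 \<le> t \<Longrightarrow> t \<le> 1 \<Longrightarrow> arclen 0 t + arclen t 1 = arclen 0 1"
  unfolding arclen_def by (rule Henstock_Kurzweil_Integration.integral_combine[OF _ _ speed_int])

lemma \<sigma>_add: "0 \<le> t \<Longrightarrow> t \<le> 1 \<Longrightarrow> \<sigma> 0 t j + \<sigma> t 1 j = \<sigma> 0 1 j"
  unfolding \<sigma>_def by (rule Henstock_Kurzweil_Integration.integral_combine[OF _ _ sv_int])

text \<open>Rotundity is used twice: first for m and \<open>\<sigma> 0 1\<close>, which shows that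
  they coincide, then for the splitting of m into \<open>\<sigma> 0 t\<close> and
  \<open>\<sigma> t 1\<close>, whose norms add up because they are bounded by arc lengths with total
  \<open>nu z\<close>. The factor is found by taking norms.\<close>

lemma \<sigma>_proportional:
  assumes rot: "rotund N" and \<gamma>: "\<gamma> 0 = 1" "\<gamma> 1 = exp (\<i> *\<^sub>C z)"
    and z: "hermitian z" "z \<in> norm_ideal N" "norm z < pi" "z \<noteq> 0" and es: "eigsys z e l"
    and eq: "arclen 0 1 = nu z" and t: "0 \<le> t" "t \<le> 1"
  shows "\<sigma> 0 t j = arclen 0 t / nu z * \<bar>l j\<bar>"
proof -
  note e = eigsysD(1)[OF es]
  define m where "m = (\<lambda>j. \<bar>l j\<bar>)"
  have ch: "compact_hermitian z" by (rule norm_ideal_compact_hermitian[OF z(2,1)])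
  have sz: "singular_values z = m" using singular_values_eigsys[OF z(1) es] by (simp add: m_def)
  have m: "rearranged m" unfolding m_def by (rule eigsys_rearranged[OF es])
  have Nm: "N (diag e m) = N z" unfolding rearranged_diag(2)[OF e m] N_compact_hermitian[OF ch] sz ..
  then have Im: "diag e m \<in> norm_ideal N" and num: "nu (diag e m) = nu z"
    using z(2) by (simp_all add: norm_ideal_def nu_def)
  have nz: "nu z > 0" by (rule nu_pos[OF z(2,4)])
  obtain i where mi: "m i \<noteq> 0"
  proof -
    have "\<exists>i. m i \<noteq> 0"
    proof (rule ccontr)
      assume "\<not> (\<exists>i. m i \<noteq> 0)"
      then have "l i = 0" for i by (simp add: m_def)
      then have "(0::'h bop) = diag e l" by (intro diag_eq[OF e, of _ 0]) simp_all
      then show False using eigsys_diag[OF es] z(4) by simp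
    qed
    then show ?thesis using that by blast
  qed
  have r01: "rearranged (\<sigma> 0 1)" and r1: "rearranged (\<sigma> 0 t)" and r2: "rearranged (\<sigma> t 1)"
    using \<sigma>_rearranged t by auto
  note d01 = rearranged_diag_le[OF e r01 gauge_\<sigma>_le, simplified]
    and d1 = rearranged_diag_le[OF e r1 gauge_\<sigma>_le, OF order_refl t(2)]
    and d2 = rearranged_diag_le[OF e r2 gauge_\<sigma>_le, OF t(1) order_refl]
  have maj: "\<phi> (trunc n m) \<le> \<phi> (trunc n (\<sigma> 0 1))" for n
    unfolding m_def by (rule gauge_le_arclen[OF \<gamma> z(1) es z(3)])
  \<comment> \<open>Squeezed between the length, which equals \<open>nu z\<close>, and the majorized
    sequence m.\<close>
  have nu01: "nu (diag e (\<sigma> 0 1)) = nu z"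
  proof (rule antisym)
    show "nu (diag e (\<sigma> 0 1)) \<le> nu z" using d01(2) eq by simp
    show "nu z \<le> nu (diag e (\<sigma> 0 1))" unfolding num[symmetric]
      by (rule rearranged_diag_le(2)[OF e m]) (rule order_trans[OF maj rearranged_diag_ge[OF e r01 d01(1)]])
  qed
  have \<sigma>m: "\<sigma> 0 1 j = m j" for j
  proof -
    obtain k where k: "\<sigma> 0 1 k \<noteq> 0"
    proof -
      have "\<exists>k. \<sigma> 0 1 k \<noteq> 0"
      proof (rule ccontr)
        assume "\<not> (\<exists>k. \<sigma> 0 1 k \<noteq> 0)"
        then have "\<sigma> 0 1 j = 0 * m j" for j by simp
        from diag_proportional[OF e r01 m d01(1) Im order_refl this] show False using nu01 nz by simp
      qed
      then show ?thesis using that by blast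
    qed
    have rs: "rearranged (\<lambda>j. m j + \<sigma> 0 1 j)" by (rule rearranged_add[OF m r01])
    have Is: "diag e (\<lambda>j. m j + \<sigma> 0 1 j) \<in> norm_ideal N"
      unfolding diag_rearranged_add[OF e m r01] by (rule norm_ideal_add[OF Im d01(1)])
    \<comment> \<open>Partial sums of 2 m are at most those of m + \<open>\<sigma> 0 1\<close>.
      Together with the triangle inequality this yields the equality that rotundity asks
      for.\<close>
    have "2 * nu (diag e m) \<le> nu (diag e (\<lambda>j. m j + \<sigma> 0 1 j))"
    proof -
      have "\<phi> (trunc n (\<lambda>j. 2 * m j)) \<le> \<phi> (trunc n (\<lambda>j. m j + \<sigma> 0 1 j))" for n
        by (rule gauge.weak_majorization)
          (use m weak_majorization_\<sigma>[OF \<gamma> z(1) es z(3)] in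
            \<open>auto simp: rearranged_def decseq_Suc_iff m_def sum.distrib sum_distrib_left[symmetric]\<close>)
      note two = order_trans[OF this rearranged_diag_ge[OF e rs Is]]
      have "\<phi> (trunc n m) \<le> nu (diag e (\<lambda>j. m j + \<sigma> 0 1 j)) / 2" for n
        using two[of n] unfolding gauge.trunc_scale by (simp add: mult.commute)
      from rearranged_diag_le(2)[OF e m this] show ?thesis by simp
    qed
    moreover have "nu (diag e (\<lambda>j. m j + \<sigma> 0 1 j)) \<le> nu (diag e m) + nu (diag e (\<sigma> 0 1))"
      unfolding diag_rearranged_add[OF e m r01] by (rule nu_triangle[OF Im d01(1)])
    ultimately have "nu (diag e (\<lambda>j. m j + \<sigma> 0 1 j)) = nu (diag e m) + nu (diag e (\<sigma> 0 1))"
      using nu01 num by simp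
    from rotund_diag[OF rot e m r01 Im d01(1) mi k this]
    obtain c where c: "c \<ge> 0" "\<And>j. m j = c * \<sigma> 0 1 j" by blast
    have "nu z = c * nu z" using diag_proportional[OF e m r01 Im d01(1) c] num nu01 by simp
    then have "c = 1" using nz by simp
    then show ?thesis using c(2) by simp
  qed
  have sum_m: "\<sigma> 0 t j + \<sigma> t 1 j = m j" for j using \<sigma>_add[OF t, of j] \<sigma>m by simp
  have "(\<lambda>j. \<sigma> 0 t j + \<sigma> t 1 j) = m" using sum_m by auto
  then have tri: "nu z \<le> nu (diag e (\<sigma> 0 t)) + nu (diag e (\<sigma> t 1))"
    using nu_triangle[OF d1(1) d2(1)] diag_rearranged_add[OF e r1 r2] num by simp
  then have n1: "nu (diag e (\<sigma> 0 t)) = arclen 0 t"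
    and n12: "nu (diag e (\<lambda>j. \<sigma> 0 t j + \<sigma> t 1 j)) = nu (diag e (\<sigma> 0 t)) + nu (diag e (\<sigma> t 1))"
    using d1(2) d2(2) arclen_add[OF t] eq num \<open>(\<lambda>j. \<sigma> 0 t j + \<sigma> t 1 j) = m\<close> by auto
  have "\<exists>\<kappa>\<ge>0. \<forall>j. \<sigma> 0 t j = \<kappa> * m j"
  \<comment> \<open>Rotundity speaks about nonzero elements only; if one part vanishes, the factor
    is 0 or 1.\<close>
  proof (cases "(\<forall>j. \<sigma> 0 t j = 0) \<or> (\<forall>j. \<sigma> t 1 j = 0)")
    case True
    then show ?thesis
    proof
      assume "\<forall>j. \<sigma> 0 t j = 0"
      then show ?thesis by (intro exI[of _ 0]) simp
    next
      assume "\<forall>j. \<sigma> t 1 j = 0"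
      then show ?thesis using sum_m by (intro exI[of _ 1]) simp
    qed
  next
    case False
    then obtain p q where "\<sigma> 0 t p \<noteq> 0" "\<sigma> t 1 q \<noteq> 0" by blast
    from rotund_diag[OF rot e r1 r2 d1(1) d2(1) this n12]
    obtain c where c: "c \<ge> 0" "\<And>j. \<sigma> 0 t j = c * \<sigma> t 1 j" by blast
    have "\<sigma> 0 t j = c / (1 + c) * m j" for j
      using c(1) sum_m[of j, symmetric] c(2)[of j] by (simp add: field_simps)
    then show ?thesis using c(1) by (intro exI[of _ "c / (1 + c)"]) simp
  qed
  then obtain \<kappa> where \<kappa>: "\<kappa> \<ge> 0" "\<And>j. \<sigma> 0 t j = \<kappa> * m j" by blast
  have "arclen 0 t = \<kappa> * nu z" using diag_proportional[OF e r1 m d1(1) Im \<kappa>] n1 num by simp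
  then show ?thesis using \<kappa>(2)[of j] nz by (simp add: m_def)
qed

end

subsection \<open>Curves on the unit sphere\<close>

text \<open>In the limit over m the hypothesis says arccos x is at most \<open>\<rho>\<close>. As
  the limit statement excludes x = -1, an intermediate y between x and cos \<open>\<rho>\<close> is
  used.\<close>

lemma cos_le_of_asin_poly:
  assumes P: "\<And>m. poly (asin_poly m) 1 - poly (asin_poly m) x \<le> \<rho>" and \<rho>: "0 \<le> \<rho>" "\<rho> \<le> pi" and x: "-1 \<le> x"
  shows "cos \<rho> \<le> x"
proof (rule ccontr)
  assume "\<not> cos \<rho> \<le> x"
  then obtain y where y: "x < y" "y < cos \<rho>" using dense[of x "cos \<rho>"] by auto
  have y1: "-1 < y" "y < 1" using x y cos_le_one[of \<rho>] by linarith+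
  have "arccos (cos \<rho>) < arccos y" by (rule arccos_less_arccos) (use y y1 in auto)
  then have "\<rho> < arccos y" using \<rho> by (simp add: arccos_cos)
  then have pos: "(arccos y - \<rho>) / 2 > 0" by simp
  obtain m where m: "arccos y - (arccos y - \<rho>) / 2 \<le> poly (asin_poly m) 1 - poly (asin_poly m) y"
    using eventually_happens'[OF _ asin_poly_arccos[OF y1(1) _ pos]] y1 by auto
  have "poly (asin_poly m) x \<le> poly (asin_poly m) y" by (rule asin_poly_mono) (use y in simp)
  then have "arccos y - (arccos y - \<rho>) / 2 \<le> \<rho>" using m P[of m] by linarith
  then show False using pos by (simp add: field_simps)
qed

text \<open>The same polynomials tame the angle to a fixed unit vector w. As the velocity c' is
  orthogonal to c over the reals, the derivative of h only sees the part of w orthogonal to c, of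
  norm sqrt (1 - h^2), which the derivative of the polynomial compensates even at h = 1 or
  -1.\<close>

lemma sphere_asin_poly:
  fixes c :: "real \<Rightarrow> 'a::complex_hilbert"
  assumes ab: "a \<le> b" and c: "continuous_on {a..b} c" "\<And>t. t \<in> {a..b} \<Longrightarrow> norm (c t) = 1"
    and B: "finite B" and \<rho>: "continuous_on {a..b} \<rho>" and w: "norm w = 1"
    and der: "\<And>t. t \<in> {a<..<b} - B \<Longrightarrow> \<exists>c' \<rho>'. (c has_vector_derivative c') (at t within {a..b}) \<and>
       (\<rho> has_real_derivative \<rho>') (at t within {a..b}) \<and> norm c' \<le> \<rho>'"
  shows "\<bar>poly (asin_poly m) (Re (cinner (c b) w)) - poly (asin_poly m) (Re (cinner (c a) w))\<bar> \<le> \<rho> b - \<rho> a"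
proof -
  let ?P = "asin_poly m"
  define h where "h t = Re (cinner (c t) w)" for t
  have bl: "bounded_linear (\<lambda>v. Re (cinner v w))"
    by (intro bounded_linear_compose[OF bounded_linear_Re] bounded_linear_cinner_left)
  \<comment> \<open>The signs s = 1 and s = -1 give the two halves of the absolute value.\<close>
  have main: "s * poly ?P (h b) - \<rho> b \<le> s * poly ?P (h a) - \<rho> a" if s: "\<bar>s\<bar> = 1" for s
  proof (rule nonincreasing_of_left_bounds[where H="\<lambda>t. s * poly ?P (h t) - \<rho> t" and B=B, OF ab _ B])
    show "continuous_on {a..b} (\<lambda>t. s * poly ?P (h t) - \<rho> t)" unfolding h_def
      by (intro continuous_intros \<rho> bounded_linear.continuous_on[OF bl] c)
    fix t assume t: "t \<in> {a<..<b} - B"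
    then obtain c' \<rho>' where d: "(c has_vector_derivative c') (at t within {a..b})"
      "(\<rho> has_real_derivative \<rho>') (at t within {a..b})" "norm c' \<le> \<rho>'" using der by blast
    have tab: "t \<in> {a..b}" using t by auto
    have ct: "norm (c t) = 1" by (rule c(2)[OF tab])
    have "((\<lambda>s. cinner (c s) (c s)) has_vector_derivative (cinner (c t) c' + cinner c' (c t))) (at t within {a..b})"
      by (rule bounded_bilinear.has_vector_derivative[OF bounded_bilinear_cinner d(1) d(1)])
    moreover have "((\<lambda>s. cinner (c s) (c s)) has_vector_derivative 0) (at t within {a..b})"
      by (rule has_vector_derivative_transform[OF tab, of _ "\<lambda>_. 1"]) (use c(2) in \<open>auto simp: cinner_self\<close>)
    moreover have "at t within {a..b} \<noteq> bot" using t by (auto simp: trivial_limit_within islimpt_Icc)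
    ultimately have "cinner (c t) c' + cinner c' (c t) = 0"
      by (rule vector_derivative_unique_within[rotated])
    from arg_cong[OF this, of Re] have orth: "Re (cinner c' (c t)) = 0"
      by (simp add: cinner_commute[of "c t"])
    have h1: "\<bar>h t\<bar> \<le> 1"
      using abs_Re_le_cmod[of "cinner (c t) w"] Cauchy_Schwarz[of "c t" w] ct w by (simp add: h_def)
    have "(norm (w - h t *\<^sub>R c t))\<^sup>2 = 1 - (h t)\<^sup>2"
    proof -
      have cc: "cinner (c t) (c t) = 1" and ww: "cinner w w = 1" using ct w by (simp_all add: cinner_self)
      show ?thesis unfolding norm_eq_Re_cinner
        by (simp add: cinner_simps cc ww cinner_commute[of w "c t"] power2_eq_square) (simp add: h_def)
    qed
    then have nw: "norm (w - h t *\<^sub>R c t) = sqrt (1 - (h t)\<^sup>2)" by (simp add: real_sqrt_unique)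
    have "\<bar>Re (cinner c' w)\<bar> = \<bar>Re (cinner c' (w - h t *\<^sub>R c t))\<bar>" using orth by (simp add: cinner_simps)
    also have "\<dots> \<le> norm c' * sqrt (1 - (h t)\<^sup>2)"
      using abs_Re_le_cmod[of "cinner c' (w - h t *\<^sub>R c t)"] Cauchy_Schwarz[of c' "w - h t *\<^sub>R c t"] nw by simp
    finally have hc: "\<bar>Re (cinner c' w)\<bar> \<le> norm c' * sqrt (1 - (h t)\<^sup>2)" .
    define D where "D = s * (poly (pderiv ?P) (h t) * Re (cinner c' w)) - \<rho>'"
    have "\<bar>poly (pderiv ?P) (h t) * Re (cinner c' w)\<bar> \<le> poly (pderiv ?P) (h t) * (norm c' * sqrt (1 - (h t)\<^sup>2))"
      unfolding abs_mult using hc pderiv_asin_poly_nonneg[of m "h t"] by (simp add: mult_left_mono)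
    also have "\<dots> = norm c' * (poly (pderiv ?P) (h t) * sqrt (1 - (h t)\<^sup>2))" by (simp add: mult_ac)
    also have "\<dots> \<le> norm c' * 1" by (intro mult_left_mono pderiv_asin_poly_sqrt h1) simp
    finally have "D \<le> 0" using d(3) s unfolding D_def by (cases "s = 1") (auto simp: abs_if split: if_splits)
    moreover have "((\<lambda>t. s * poly ?P (h t) - \<rho> t) has_real_derivative D) (at t within {a..b})"
    proof -
      have "(h has_real_derivative Re (cinner c' w)) (at t within {a..b})"
        using bounded_linear.has_vector_derivative[OF bl d(1)]
        unfolding h_def[abs_def] has_real_derivative_iff_has_vector_derivative .
      from DERIV_chain2[OF poly_DERIV this] show ?thesis unfolding D_def
        by (intro DERIV_diff DERIV_cmult d(2))
    qed
    ultimately show "\<exists>g D. (g has_real_derivative D) (at t within {a..b}) \<and> D \<le> 0 \<and>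
       (\<forall>r\<in>{a..<t}. (s * poly ?P (h t) - \<rho> t) - (s * poly ?P (h r) - \<rho> r) \<le> g t - g r)"
      by (intro exI[of _ "\<lambda>t. s * poly ?P (h t) - \<rho> t"] exI[of _ D]) simp
  qed
  show ?thesis using main[of 1] main[of "-1"] by (simp add: h_def abs_le_iff)
qed

text \<open>The angles from \<open>c t\<close> to both end points are bounded by the lengths of the two parts of the curve, and
  \<open>sin l\<close> times the point of the great circle arc is the combination of the end points with
  coefficients \<open>sin ((1 - r) l)\<close> and \<open>sin (r l)\<close>.  Hence the inner product of the two unit vectors is 1.\<close>
lemma great_circle:
  fixes c :: "real \<Rightarrow> 'a::complex_hilbert"
  assumes c: "continuous_on {0..1} c" "\<And>t. t \<in> {0..1} \<Longrightarrow> norm (c t) = 1"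
    and B: "finite B" and r: "continuous_on {0..1} r" "r 0 = 0" "r 1 = 1" "\<And>t. t \<in> {0..1} \<Longrightarrow> r t \<in> {0..1}"
    and l: "\<bar>l\<bar> < pi"
    and der: "\<And>t. t \<in> {0<..<1} - B \<Longrightarrow> \<exists>c' r'. (c has_vector_derivative c') (at t within {0..1}) \<and>
       (r has_real_derivative r') (at t within {0..1}) \<and> norm c' \<le> r' * \<bar>l\<bar>"
    and c1: "c 1 = exp (\<i> * complex_of_real l) *\<^sub>C c 0" and t: "t \<in> {0..1}"
  shows "c t = exp (\<i> * complex_of_real (r t * l)) *\<^sub>C c 0"
proof -
  define \<rho> where "\<rho> t = r t * \<bar>l\<bar>" for t
  have t01: "0 \<le> t" "t \<le> 1" using t by auto
  have der': "\<exists>c' \<rho>'. (c has_vector_derivative c') (at s within {a..b}) \<and>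
       (\<rho> has_real_derivative \<rho>') (at s within {a..b}) \<and> norm c' \<le> \<rho>'"
    if sB: "s \<in> {a<..<b} - B" "0 \<le> a" "b \<le> 1" for s a b
  proof -
    obtain c' r' where d: "(c has_vector_derivative c') (at s within {0..1})"
       "(r has_real_derivative r') (at s within {0..1})" "norm c' \<le> r' * \<bar>l\<bar>"
    proof -
      have "s \<in> {0<..<1} - B" using sB by auto
      from der[OF this] show ?thesis using that by blast
    qed
    have sub: "{a..b} \<subseteq> {0..1}" using that by auto
    have "(c has_vector_derivative c') (at s within {a..b})" by (rule has_vector_derivative_within_subset[OF d(1) sub])
    moreover have "(\<rho> has_real_derivative r' * \<bar>l\<bar>) (at s within {a..b})" unfolding \<rho>_def
      by (rule DERIV_cmult_right[OF DERIV_subset[OF d(2) sub]])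
    ultimately show ?thesis using d(3) by blast
  qed
  have cont: "continuous_on {a..b} c" "continuous_on {a..b} \<rho>" if "0 \<le> a" "b \<le> 1" for a b
    unfolding \<rho>_def by (intro continuous_intros continuous_on_subset[OF c(1)] continuous_on_subset[OF r(1)]; use that in auto)+
  define X where "X = Re (cinner (c t) (c 0))"
  define Y where "Y = Re (cinner (c t) (c 1))"
  have n0: "norm (c 0) = 1" and n1: "norm (c 1) = 1" and nt: "norm (c t) = 1" using c(2) t by auto
  have self: "Re (cinner (c 0) (c 0)) = 1" "Re (cinner (c 1) (c 1)) = 1" using n0 n1 by (simp_all add: cinner_self)
  have lb: "-1 \<le> X" "-1 \<le> Y"
    using abs_Re_le_cmod[of "cinner (c t) (c 0)"] Cauchy_Schwarz[of "c t" "c 0"]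
      abs_Re_le_cmod[of "cinner (c t) (c 1)"] Cauchy_Schwarz[of "c t" "c 1"] n0 n1 nt
    by (auto simp: X_def Y_def abs_le_iff)
  have rt: "0 \<le> r t" "r t \<le> 1" using r(4)[OF t] by auto
  have \<rho>: "0 \<le> r t * \<bar>l\<bar>" "r t * \<bar>l\<bar> \<le> pi" "0 \<le> (1 - r t) * \<bar>l\<bar>" "(1 - r t) * \<bar>l\<bar> \<le> pi"
    using rt l mult_left_le_one_le[of "\<bar>l\<bar>" "r t"] mult_left_le_one_le[of "\<bar>l\<bar>" "1 - r t"] by auto
  have X: "cos (r t * \<bar>l\<bar>) \<le> X"
  proof (rule cos_le_of_asin_poly[OF _ \<rho>(1,2) lb(1)])
    fix m
    show "poly (asin_poly m) 1 - poly (asin_poly m) X \<le> r t * \<bar>l\<bar>"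
      using sphere_asin_poly[OF t01(1) cont(1) _ B cont(2) n0 der', of m] c(2) t01 r(2)
      by (simp add: self X_def \<rho>_def)
  qed
  have Y: "cos ((1 - r t) * \<bar>l\<bar>) \<le> Y"
  proof (rule cos_le_of_asin_poly[OF _ \<rho>(3,4) lb(2)])
    fix m
    show "poly (asin_poly m) 1 - poly (asin_poly m) Y \<le> (1 - r t) * \<bar>l\<bar>"
      using sphere_asin_poly[OF t01(2) cont(1) _ B cont(2) n1 der', of m] c(2) t01 r(3)
      by (simp add: self Y_def \<rho>_def algebra_simps)
  qed
  define w where "w = exp (\<i> * complex_of_real (r t * l)) *\<^sub>C c 0"
  have nw: "norm w = 1" using n0 by (simp add: w_def norm_scaleC)
  have "1 \<le> Re (cinner (c t) w)"
  \<comment> \<open>The general argument divides by sin |l|; for l = 0 the bound on X already is the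
    claim.\<close>
  proof (cases "l = 0")
    case True
    then show ?thesis using X by (simp add: w_def X_def)
  next
    case False
    define A where "A = cinner (c t) (c 0)"
    have X': "X = Re A" and W': "Re (cinner (c t) w) = cos (r t * l) * Re A + sin (r t * l) * Im A"
      and Y': "Y = cos l * Re A + sin l * Im A"
      by (simp_all add: X_def Y_def A_def w_def c1 cinner_simps exp_Euler cos_of_real sin_of_real
          cis_conv_exp[symmetric] flip: of_real_mult)
    have id: "sin ((1 - r t) * l) + sin (r t * l) * cos l = sin l * cos (r t * l)"
    proof -
      have "sin ((1 - r t) * l) = sin (l - r t * l)" by (simp add: algebra_simps)
      then show ?thesis by (simp add: sin_diff)
    qed
    have sl: "0 < sin \<bar>l\<bar>" using False l by (intro sin_gt_zero) auto
    \<comment> \<open>The angle bounds X and Y involve |l|, whereas the arc itself turns by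
      l.\<close>
    have sg: "sin (x * \<bar>l\<bar>) = sgn l * sin (x * l)" "cos (x * \<bar>l\<bar>) = cos (x * l)" for x
      by (auto simp: abs_if sgn_if)
    have "sin \<bar>l\<bar> = sin ((1 - r t) * \<bar>l\<bar> + r t * \<bar>l\<bar>)" by (simp add: algebra_simps)
    also have "\<dots> = sin ((1 - r t) * \<bar>l\<bar>) * cos (r t * \<bar>l\<bar>) + sin (r t * \<bar>l\<bar>) * cos ((1 - r t) * \<bar>l\<bar>)"
      by (simp only: sin_add mult.commute)
    also have "\<dots> \<le> sin ((1 - r t) * \<bar>l\<bar>) * X + sin (r t * \<bar>l\<bar>) * Y"
      using \<rho> by (intro add_mono mult_left_mono X Y sin_ge_zero)
    also have "\<dots> = sgn l * ((sin ((1 - r t) * l) + sin (r t * l) * cos l) * Re A + sin l * sin (r t * l) * Im A)"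
    proof -
      have lin: "(g * a) * x + (g * b) * (cl * x + sl * y) = g * ((a + b * cl) * x + sl * b * y)"
        for g a b cl sl x y :: real by (simp add: algebra_simps)
      show ?thesis unfolding sg X' Y' by (rule lin)
    qed
    also have "\<dots> = sin \<bar>l\<bar> * Re (cinner (c t) w)"
    proof -
      have lin: "g * (sl * cr * x + sl * sr * y) = g * sl * (cr * x + sr * y)"
        for g sl cr sr x y :: real by (simp add: algebra_simps)
      have "sin \<bar>l\<bar> = sgn l * sin l" using sg(1)[of 1] by simp
      then show ?thesis unfolding id W' lin by simp
    qed
    finally show ?thesis using sl by simp
  qed
  moreover have "cinner (c t) (c t) = 1" "cinner w w = 1" using nt nw by (simp_all add: cinner_self)
  ultimately have "(norm (c t - w))\<^sup>2 \<le> 0"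
    unfolding norm_eq_Re_cinner[of "_ - _"]
    by (simp add: cinner_diff_left cinner_diff_right cinner_commute[of w "c t"])
  then show ?thesis by (simp add: w_def)
qed

subsection \<open>Uniqueness\<close>

text \<open>Add the normalized v and a v as an extra pair to the first n eigenvectors. The resulting
  n + 1 inner products are bounded by the Ky Fan sum of order n + 1, which leaves exactly the n-th
  singular value for the extra pair.\<close>

lemma norm_on_eigen_complement:
  fixes a :: "'a::separable_infinite_hilbert bop"
  assumes a: "compact_hermitian a" and e: "orthonormal_on {..<n} e"
    and ae: "\<And>i. i < n \<Longrightarrow> a \<cdot> e i = complex_of_real (\<mu> i) *\<^sub>C e i" "\<And>i. i < n \<Longrightarrow> \<bar>\<mu> i\<bar> = singular_values a i"
    and v: "\<And>i. i < n \<Longrightarrow> cinner v (e i) = 0"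
  shows "norm (a \<cdot> v) \<le> singular_values a n * norm v"
proof (cases "v = 0 \<or> a \<cdot> v = 0")
  case True
  then show ?thesis using compact_hermitian_singular_values(3)[OF a, of n] by auto
next
  case False
  define V where "V i = (if i < n then e i else complex_of_real (1 / norm v) *\<^sub>C v)" for i
  define W where "W i = (if i < n then complex_of_real (sgn (\<mu> i)) *\<^sub>C e i
    else complex_of_real (1 / norm (a \<cdot> v)) *\<^sub>C (a \<cdot> v))" for i
  have av: "cinner (a \<cdot> v) (e i) = 0" if "i < n" for i
    using a v[OF that] ae(1)[OF that] by (simp add: compact_hermitian_def hermitian_cinner cinner_simps)
  have e1: "norm (e i) = 1" if "i < n" for i using orthonormal_on_norm[OF e] that by simp
  have V: "suborthonormal_on {..<Suc n} V"
    using False e1 v e by (auto simp: suborthonormal_on_def V_def norm_scaleC norm_divide cinner_simps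
        cinner_eq_0_commute[of "e _"] orthonormal_on_def)
  have W: "suborthonormal_on {..<Suc n} W"
    using False e1 av e by (auto simp: suborthonormal_on_def W_def norm_scaleC norm_divide cinner_simps
        cinner_eq_0_commute[of "e _"] orthonormal_on_def sgn_if)
  have i: "cmod (cinner (a \<cdot> V i) (W i)) = singular_values a i" if "i < n" for i
    using e that unfolding ae(2)[OF that, symmetric]
    by (simp add: V_def W_def ae(1) cinner_simps orthonormal_on_def norm_mult sgn_if)
  have "cmod (cinner (a \<cdot> V n) (W n)) = norm (a \<cdot> v) / norm v"
    using False by (simp add: V_def W_def bop_simps cinner_simps cinner_self norm_mult norm_divide power2_eq_square)
  then have "kyfan n a + norm (a \<cdot> v) / norm v = (\<Sum>j<Suc n. cmod (cinner (a \<cdot> V j) (W j)))"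
    by (simp add: kyfan_def i)
  also have "\<dots> \<le> kyfan (Suc n) a" by (rule kyfan_upper[OF a V W])
  finally show ?thesis using False by (simp add: kyfan_def field_simps)
qed

context unitary_curve
begin

lemma arclen_deriv: "t \<in> {0..1} - B \<Longrightarrow> ((\<lambda>t. arclen 0 t) has_real_derivative nu (V t)) (at t within {0..1})"
  using finitely_discontinuous_integral_deriv[OF finB speed_cont speed_int, of t]
  by (simp add: arclen_def[abs_def] speed_def)

lemma arclen_cont: "continuous_on {0..1} (\<lambda>t. arclen 0 t)"
  unfolding arclen_def by (rule indefinite_integral_continuous_1[OF speed_int])

lemma arclen_mono: "0 \<le> a \<Longrightarrow> a \<le> b \<Longrightarrow> b \<le> 1 \<Longrightarrow> arclen 0 a \<le> arclen 0 b"
  unfolding arclen_def by (rule integral_subset_le) (auto intro!: speed_int_sub simp: speed_nonneg)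

lemma arclen_0 [simp]: "arclen 0 0 = 0"
  by (simp add: arclen_def)

lemma \<sigma>_deriv: "t \<in> {0..1} - B \<Longrightarrow>
    ((\<lambda>t. \<sigma> 0 t j) has_real_derivative singular_values (angvel \<gamma> V t) j) (at t within {0..1})"
  using finitely_discontinuous_integral_deriv[OF finB sv_cont sv_int, of t]
  by (simp add: \<sigma>_def[abs_def] sv_def)

lemma within_nontrivial: "t \<in> {0..1::real} \<Longrightarrow> at t within {0..1} \<noteq> bot"
  by (auto simp: trivial_limit_within islimpt_Icc)

lemma velocity_angvel:
  assumes "t \<in> {0..1} - B"
  shows "V t \<cdot> v = \<i> *\<^sub>C \<gamma> t \<cdot> angvel \<gamma> V t \<cdot> v"
proof -
  have "\<gamma> t \<cdot> adj (\<gamma> t) \<cdot> w = w" for w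
    using regularD(4)[OF reg, of t] assms by (metis DiffD1 one_bop_apply times_bop_apply unitary_def)
  then show ?thesis
    by (simp add: angvel_def bop_simps bop_apply_minus scaleC_scaleC
        complex_vector.scale_minus_left complex_vector.scale_minus_right)
qed

lemma eval_deriv:
  assumes "t \<in> {0..1} - B"
  shows "((\<lambda>t. \<gamma> t \<cdot> v) has_vector_derivative V t \<cdot> v) (at t within {0..1})"
  by (rule bounded_linear.has_vector_derivative[OF bounded_linear_eval regularD(7)[OF reg assms]])

lemma eval_cont: "continuous_on {0..1} (\<lambda>t. \<gamma> t \<cdot> v)"
  by (rule bounded_linear.continuous_on[OF bounded_linear_eval regularD(6)[OF reg]])

lemma eval_const:
  assumes "\<And>t. t \<in> {0..1} - B \<Longrightarrow> V t \<cdot> v = 0" and "t \<in> {0..1}"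
  shows "\<gamma> t \<cdot> v = \<gamma> 0 \<cdot> v"
proof (rule has_derivative_zero_unique_strong_interval[OF finB eval_cont refl _ assms(2)])
  fix s assume s: "s \<in> {0..1} - B"
  show "((\<lambda>t. \<gamma> t \<cdot> v) has_derivative (\<lambda>h. 0)) (at s within {0..1})"
    using eval_deriv[OF s, of v] by (simp add: has_vector_derivative_def assms(1)[OF s])
qed

text \<open>Comparing the derivative of the known rotation of e with i \<open>\<gamma>\<close> a e
  identifies a e. This turns the motion of e into spectral information about
  \<open>angvel\<close>.\<close>

lemma angvel_eigenvector:
  assumes t: "t \<in> {0..1} - B" and r': "(r has_real_derivative r') (at t within {0..1})"
    and \<gamma>e: "\<And>t. t \<in> {0..1} \<Longrightarrow> \<gamma> t \<cdot> e = exp (\<i> * complex_of_real (r t * m)) *\<^sub>C e"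
  shows "angvel \<gamma> V t \<cdot> e = complex_of_real (r' * m) *\<^sub>C e"
proof -
  have t01: "t \<in> {0..1}" using t by simp
  have "((\<lambda>t. exp (\<i> * complex_of_real (r t * m))) has_vector_derivative
      (\<i> * complex_of_real (r' * m) * exp (\<i> * complex_of_real (r t * m)))) (at t within {0..1})"
  proof -
    have "((\<lambda>t. \<i> * complex_of_real (r t * m)) has_vector_derivative \<i> * complex_of_real (r' * m)) (at t within {0..1})"
      by (intro bounded_linear.has_vector_derivative[OF bounded_linear_mult_right]
          bounded_linear.has_vector_derivative[OF bounded_linear_of_real]
          has_real_derivative_iff_has_vector_derivative[THEN iffD1] DERIV_cmult_right r')
    from field_vector_diff_chain_within[OF this, of exp "exp (\<i> * complex_of_real (r t * m))"]
    show ?thesis by (simp add: o_def DERIV_subset[OF DERIV_exp])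
  qed
  from bounded_linear.has_vector_derivative[OF bounded_linear_scaleC_left this, of "e"]
  have "((\<lambda>t. \<gamma> t \<cdot> e) has_vector_derivative
      (\<i> * complex_of_real (r' * m) * exp (\<i> * complex_of_real (r t * m))) *\<^sub>C e) (at t within {0..1})"
    by (rule has_vector_derivative_transform[OF t01, rotated]) (simp add: \<gamma>e)
  from vector_derivative_unique_within[OF within_nontrivial[OF t01] eval_deriv[OF t] this]
  have "V t \<cdot> e = (\<i> * complex_of_real (r' * m)) *\<^sub>C \<gamma> t \<cdot> e"
    by (simp add: \<gamma>e[OF t01] scaleC_scaleC)
  then have "\<i> *\<^sub>C \<gamma> t \<cdot> angvel \<gamma> V t \<cdot> e = (\<i> * complex_of_real (r' * m)) *\<^sub>C \<gamma> t \<cdot> e"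
    unfolding velocity_angvel[OF t] .
  then have "(- \<i>) *\<^sub>C adj (\<gamma> t) \<cdot> (\<i> *\<^sub>C \<gamma> t \<cdot> angvel \<gamma> V t \<cdot> e) =
      (- \<i>) *\<^sub>C adj (\<gamma> t) \<cdot> ((\<i> * complex_of_real (r' * m)) *\<^sub>C \<gamma> t \<cdot> e)" by simp
  moreover have "adj (\<gamma> t) \<cdot> \<gamma> t \<cdot> w = w" for w
    using regularD(4)[OF reg t01] by (metis one_bop_apply times_bop_apply unitary_def)
  ultimately show ?thesis
    by (simp add: bop_apply_scaleC scaleC_scaleC del: of_real_mult)
qed

text \<open>By induction \<open>e i\<close> for i < n are eigenvectors of a(t) with eigenvalues r' l
  i, whose moduli are its first n singular values. Hence \<open>e n\<close> moves with speed at most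
  r' |l n|, in total |l n|, the angle between its end points, and \<open>great_circle\<close>
  applies.\<close>

lemma eigenvector_rotates:
  assumes r: "continuous_on {0..1} r" "r 0 = 0" "r 1 = 1" "\<And>t. t \<in> {0..1} \<Longrightarrow> r t \<in> {0..1}"
    and rd: "\<And>t. t \<in> {0..1} - B \<Longrightarrow> \<exists>r'\<ge>0. (r has_real_derivative r') (at t within {0..1}) \<and>
       (\<forall>j. singular_values (angvel \<gamma> V t) j = r' * \<bar>l j\<bar>)"
    and \<gamma>: "\<gamma> 0 = 1" "\<gamma> 1 = exp (\<i> *\<^sub>C z)" and es: "eigsys z e l" and l: "\<And>j. \<bar>l j\<bar> < pi"
    and t: "t \<in> {0..1}"
  shows "\<gamma> t \<cdot> e n = exp (\<i> * complex_of_real (r t * l n)) *\<^sub>C e n"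
  using t
proof (induction n arbitrary: t rule: less_induct)
  case (less n)
  have speed: "norm (V t \<cdot> v) \<le> singular_values (angvel \<gamma> V t) n * norm v"
    if t: "t \<in> {0..1} - B" and v: "\<And>i. i < n \<Longrightarrow> cinner v (e i) = 0" for t v
  proof -
    have t01: "t \<in> {0..1}" using t by simp
    obtain r' where r': "r' \<ge> 0" "(r has_real_derivative r') (at t within {0..1})"
      "\<And>j. singular_values (angvel \<gamma> V t) j = r' * \<bar>l j\<bar>" using rd[OF t] by blast
    have "norm (V t \<cdot> v) = norm (angvel \<gamma> V t \<cdot> v)"
      unfolding velocity_angvel[OF t] by (simp add: norm_scaleC unitary_norm[OF regularD(4)[OF reg t01]])
    also have "\<dots> \<le> singular_values (angvel \<gamma> V t) n * norm v"
    proof (rule norm_on_eigen_complement[OF angvel_facts(3)[OF t], where \<mu>="\<lambda>i. r' * l i" and e=e])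
      show "orthonormal_on {..<n} e" by (rule orthonormal_on_subset[OF eigsysD(1)[OF es]]) simp
      fix i assume i: "i < n"
      show "\<bar>r' * l i\<bar> = singular_values (angvel \<gamma> V t) i" using r'(1,3) by (simp add: abs_mult)
      show "cinner v (e i) = 0" by (rule v[OF i])
      show "angvel \<gamma> V t \<cdot> e i = complex_of_real (r' * l i) *\<^sub>C e i"
        by (rule angvel_eigenvector[OF t r'(2) less.IH[OF i]])
    qed
    finally show ?thesis .
  qed
  have e1: "norm (e n) = 1" by (rule eigsysD(8)[OF es])
  have "\<gamma> t \<cdot> e n = exp (\<i> * complex_of_real (r t * l n)) *\<^sub>C (\<gamma> 0 \<cdot> e n)"
  proof (rule great_circle[OF eval_cont _ finB r(1,2,3,4) l _ _ less.prems])
    show "norm (\<gamma> t \<cdot> e n) = 1" if "t \<in> {0..1}" for t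
      using unitary_norm[OF regularD(4)[OF reg that]] e1 by simp
    show "\<gamma> 1 \<cdot> e n = exp (\<i> * complex_of_real (l n)) *\<^sub>C \<gamma> 0 \<cdot> e n"
      unfolding \<gamma> one_bop_apply
      by (rule exp_eigen) (simp add: bop_simps eigsysD(2)[OF es] scaleC_scaleC)
    fix t assume "t \<in> {0<..<1} - B"
    then have t: "t \<in> {0..1} - B" by auto
    obtain r' where r': "r' \<ge> 0" "(r has_real_derivative r') (at t within {0..1})"
      "\<And>j. singular_values (angvel \<gamma> V t) j = r' * \<bar>l j\<bar>" using rd[OF t] by blast
    have "norm (V t \<cdot> e n) \<le> r' * \<bar>l n\<bar>"
      using speed[OF t, of "e n"] eigsysD(7)[OF es] e1 r'(3)[of n] by simp
    then show "\<exists>c' r'. ((\<lambda>t. \<gamma> t \<cdot> e n) has_vector_derivative c') (at t within {0..1}) \<and>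
       (r has_real_derivative r') (at t within {0..1}) \<and> norm c' \<le> r' * \<bar>l n\<bar>"
      using eval_deriv[OF t] r'(2) by blast
  qed auto
  then show ?case by (simp add: \<gamma>(1) bop_simps)
qed

theorem minimal_curve_unique:
  assumes rot: "rotund N" and \<gamma>: "\<gamma> 0 = 1" "\<gamma> 1 = exp (\<i> *\<^sub>C z)"
    and z: "hermitian z" "z \<in> norm_ideal N" "norm z < pi"
    and eq: "arclen 0 1 = nu z"
  shows "\<exists>s. continuous_on {0..1} s \<and> mono_on {0..1} s \<and> s ` {0..1} = {0..1} \<and>
     (\<forall>t\<in>{0..1}. \<gamma> t = exp ((\<i> * complex_of_real (s t)) *\<^sub>C z))"
proof (cases "z = 0")
  case True
  have "nu z = 0" unfolding nu_def True zero_iff[THEN iffD2, OF refl] by simp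
  \<comment> \<open>A curve of length 0 has zero velocity off B and is constant, so any
    parametrization serves.\<close>
  have zero: "arclen 0 t = 0" if "t \<in> {0..1}" for t
    using arclen_mono[of 0 t] arclen_mono[of t 1] eq \<open>nu z = 0\<close> that by simp
  have V0: "V t = 0" if t: "t \<in> {0..1} - B" for t
  proof -
    have t01: "t \<in> {0..1}" using t by simp
    have "((\<lambda>t. arclen 0 t) has_real_derivative 0) (at t within {0..1})"
      by (rule has_field_derivative_transform_within[of "\<lambda>_. 0" _ _ _ 1]) (use zero t01 in auto)
    from vector_derivative_unique_within[OF within_nontrivial[OF t01]
        arclen_deriv[OF t, unfolded has_real_derivative_iff_has_vector_derivative]
        this[unfolded has_real_derivative_iff_has_vector_derivative]]
    have "N (V t) = 0" using norm_ideal_nu[OF regularD(8)[OF reg t]] by simp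
    then show ?thesis by (simp add: zero_iff)
  qed
  have "\<gamma> t = 1" if "t \<in> {0..1}" for t
    using eval_const[OF _ that] V0 \<gamma>(1) by (intro bop_eqI) simp
  then show ?thesis using True by (intro exI[of _ "\<lambda>t. t"]) (simp add: mono_on_def scaleC_zero_bop)
next
  case False
  have nz: "nu z > 0" by (rule nu_pos[OF z(2) False])
  obtain e l where es: "eigsys z e l" 
    using compact_hermitian_eigsys[OF norm_ideal_compact_hermitian[OF z(2,1)]] by blast
  have l: "\<bar>l j\<bar> < pi" for j
    using norm_bop_apply[of z "e j"] z(3) by (simp add: eigsysD(2,8)[OF es] norm_scaleC)
  define r where "r t = arclen 0 t / nu z" for t
  have r0: "r 0 = 0" and r1: "r 1 = 1" using nz eq by (simp_all add: r_def)
  have rc: "continuous_on {0..1} r" unfolding r_def by (intro continuous_intros arclen_cont) (use nz in auto)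
  have rm: "r a \<le> r b" if "0 \<le> a" "a \<le> b" "b \<le> 1" for a b
    using arclen_mono[OF that] nz by (simp add: r_def divide_right_mono)
  have r01: "r t \<in> {0..1}" if "t \<in> {0..1}" for t using rm[of 0 t] rm[of t 1] that r0 r1 by auto
  have \<sigma>r: "\<sigma> 0 t j = r t * \<bar>l j\<bar>" if "t \<in> {0..1}" for t j
    unfolding r_def using that by (intro \<sigma>_proportional[OF rot \<gamma> z False es eq]) auto
  have rd: "\<exists>r'\<ge>0. (r has_real_derivative r') (at t within {0..1}) \<and>
       (\<forall>j. singular_values (angvel \<gamma> V t) j = r' * \<bar>l j\<bar>)" if t: "t \<in> {0..1} - B" for t
  proof (intro exI conjI allI)
    have t01: "t \<in> {0..1}" using t by simp
    let ?r' = "nu (V t) / nu z"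
    show "0 \<le> ?r'" using nz nu_nonneg by simp
    show rdv: "(r has_real_derivative ?r') (at t within {0..1})" unfolding r_def
      by (rule DERIV_cdivide[OF arclen_deriv[OF t]])
    fix j
    have "((\<lambda>t. \<sigma> 0 t j) has_vector_derivative ?r' * \<bar>l j\<bar>) (at t within {0..1})"
      by (rule has_vector_derivative_transform[OF t01 _ DERIV_cmult_right[OF rdv, of "\<bar>l j\<bar>",
            unfolded has_real_derivative_iff_has_vector_derivative]]) (simp add: \<sigma>r)
    from vector_derivative_unique_within[OF within_nontrivial[OF t01]
        \<sigma>_deriv[OF t, unfolded has_real_derivative_iff_has_vector_derivative] this]
    show "singular_values (angvel \<gamma> V t) j = ?r' * \<bar>l j\<bar>" .
  qed
  have rot: "\<gamma> t = exp ((\<i> * complex_of_real (r t)) *\<^sub>C z)" if t: "t \<in> {0..1}" for t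
  proof (rule bop_eq_on_orthonormal[OF eigsysD(1)[OF es]])
    fix n
    have "exp ((\<i> * complex_of_real (r t)) *\<^sub>C z) \<cdot> e n = exp (\<i> * complex_of_real (r t * l n)) *\<^sub>C e n"
      by (rule exp_eigen) (simp add: bop_simps eigsysD(2)[OF es] scaleC_scaleC mult.assoc)
    then show "\<gamma> t \<cdot> e n = exp ((\<i> * complex_of_real (r t)) *\<^sub>C z) \<cdot> e n"
      using eigenvector_rotates[OF rc r0 r1 r01 rd \<gamma> es l t] by simp
  next
    \<comment> \<open>Such v is fixed by both sides: its velocity is bounded by every singular value
      of a, and these tend to 0, while z v = 0.\<close>
    fix v assume v: "\<And>n. cinner v (e n) = 0"
    have "V s \<cdot> v = 0" if s: "s \<in> {0..1} - B" for s
    proof -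
      have s01: "s \<in> {0..1}" using s by simp
      note a = angvel_facts(3)[OF s]
      obtain r' where r': "r' \<ge> 0" "\<And>j. singular_values (angvel \<gamma> V s) j = r' * \<bar>l j\<bar>"
        "(r has_real_derivative r') (at s within {0..1})" using rd[OF s] by blast
      have ae: "angvel \<gamma> V s \<cdot> e i = complex_of_real (r' * l i) *\<^sub>C e i" for i
        by (rule angvel_eigenvector[OF s r'(3) eigenvector_rotates[OF rc r0 r1 r01 rd \<gamma> es l]])
      have "norm (angvel \<gamma> V s \<cdot> v) \<le> singular_values (angvel \<gamma> V s) n * norm v" for n
        by (rule norm_on_eigen_complement[OF a orthonormal_on_subset[OF eigsysD(1)[OF es] subset_UNIV], where \<mu>="\<lambda>i. r' * l i"])
          (use ae r' v in \<open>auto simp: abs_mult\<close>)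
      moreover have "(\<lambda>n. singular_values (angvel \<gamma> V s) n * norm v) \<longlonglongrightarrow> 0 * norm v"
        by (intro tendsto_intros compact_hermitian_singular_values(2)[OF a])
      ultimately have "norm (angvel \<gamma> V s \<cdot> v) \<le> 0 * norm v" by (intro LIMSEQ_le_const) auto
      then show ?thesis unfolding velocity_angvel[OF s] by (simp add: complex_vector.scale_zero_right)
    qed
    then have "\<gamma> t \<cdot> v = v" using eval_const[OF _ t] \<gamma>(1) by (simp add: bop_simps)
    moreover have "exp ((\<i> * complex_of_real (r t)) *\<^sub>C z) \<cdot> v = exp 0 *\<^sub>C v"
      by (rule exp_eigen) (simp add: bop_simps eigsysD(3)[OF es v] complex_vector.scale_zero_right complex_vector.scale_zero_left)
    ultimately show "\<gamma> t \<cdot> v = exp ((\<i> * complex_of_real (r t)) *\<^sub>C z) \<cdot> v" by simp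
  qed
  have img: "r ` {0..1} = {0..1}"
  proof
    show "r ` {0..1} \<subseteq> {0..1}" using r01 by auto
    show "{0..1} \<subseteq> r ` {0..1}"
    proof
      fix y :: real assume "y \<in> {0..1}"
      then show "y \<in> r ` {0..1}" using IVT'[of r 0 y 1] rc r0 r1 by fastforce
    qed
  qed
  show ?thesis
    by (rule exI[of _ r]) (use rc rm img rot in \<open>auto simp: mono_on_def\<close>)
qed

end

subsection \<open>Piecewise smooth curves\<close>

lemma tendsto_0_of_ennreal_le:
  fixes f :: "'b \<Rightarrow> real" and g :: "'b \<Rightarrow> ennreal"
  assumes "(g \<longlongrightarrow> 0) F" "\<And>x. 0 \<le> f x" "\<And>x. ennreal (f x) \<le> ennreal C * g x"
  shows "(f \<longlongrightarrow> 0) F"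
proof -
  have "((\<lambda>x. ennreal C * g x) \<longlongrightarrow> ennreal C * 0) F"
    by (rule ennreal_tendsto_cmult[OF ennreal_less_top assms(1)])
  then have lim: "((\<lambda>x. ennreal C * g x) \<longlongrightarrow> 0) F" by simp
  have "((\<lambda>x. ennreal (f x)) \<longlongrightarrow> 0) F"
    by (rule tendsto_sandwich[OF _ _ tendsto_const lim]) (simp_all add: assms(3))
  then show ?thesis using tendsto_ennreal_iff[of f F 0] assms(2) by simp
qed

lemma tendsto_ennreal_0_of_le:
  fixes f :: "'b \<Rightarrow> ennreal" and g :: "'b \<Rightarrow> real"
  assumes "(g \<longlongrightarrow> 0) F" "\<forall>\<^sub>F x in F. f x \<le> ennreal (g x)"
  shows "(f \<longlongrightarrow> 0) F"
proof -
  have "((\<lambda>x. ennreal (g x)) \<longlongrightarrow> 0) F" using tendsto_ennrealI[OF assms(1)] by simp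
  then show ?thesis by (rule tendsto_sandwich[OF _ assms(2) tendsto_const, rotated]) simp
qed

context symmetric_norm
begin

lemma has_deriv_wrt_unique:
  assumes "has_deriv_wrt N \<gamma> D t A" "has_deriv_wrt N \<gamma> E t A" and nt: "at t within A \<noteq> bot"
  shows "D = E"
proof -
  let ?q = "\<lambda>s. (1 / (s - t)) *\<^sub>R (\<gamma> s - \<gamma> t)"
  have lim: "((\<lambda>s. N (?q s - D) + N (?q s - E)) \<longlongrightarrow> 0 + 0) (at t within A)"
    using assms(1,2) unfolding has_deriv_wrt_def by (intro tendsto_add)
  have "N (D - E) \<le> N (?q s - D) + N (?q s - E)" for s
    using triangle[of "D - ?q s" "?q s - E"] by (simp add: N_minus_commute[of D])
  then have "N (D - E) \<le> 0 + 0"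
    by (intro tendsto_lowerbound[OF lim] nt always_eventually) auto
  then show ?thesis using zero_iff[of "D - E"] by simp
qed

text \<open>A difference quotient, which lies in the ideal, is at finite distance from the
  derivative.\<close>

lemma has_deriv_wrt_norm_ideal:
  assumes d: "has_deriv_wrt N \<gamma> D t A" and nt: "at t within A \<noteq> bot"
    and \<gamma>: "\<And>s. s \<in> A \<Longrightarrow> \<gamma> s - 1 \<in> norm_ideal N" "t \<in> A"
  shows "D \<in> norm_ideal N"
proof -
  let ?q = "\<lambda>s. (1 / (s - t)) *\<^sub>R (\<gamma> s - \<gamma> t)"
  have "\<forall>\<^sub>F s in at t within A. N (?q s - D) < 1"
    using d unfolding has_deriv_wrt_def by (rule order_tendstoD) simp
  then have "\<forall>\<^sub>F s in at t within A. N (?q s - D) < 1 \<and> s \<in> A"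
    by (rule eventually_conj) (simp add: eventually_at_filter)
  from eventually_happens'[OF nt this] obtain s where s: "N (?q s - D) < 1" "s \<in> A" by blast
  have "?q s \<in> norm_ideal N"
    using norm_ideal_diff[OF \<gamma>(1)[OF s(2)] \<gamma>(1)[OF \<gamma>(2)]] by (intro norm_ideal_scaleR) simp
  moreover have "?q s - D \<in> norm_ideal N" using s(1) by (auto simp: norm_ideal_def intro: less_trans)
  ultimately show ?thesis using norm_ideal_diff[of "?q s" "?q s - D"] by simp
qed

lemma has_C1_deriv_on_cong:
  assumes "has_C1_deriv_on N \<gamma> g A" "\<And>t. t \<in> A \<Longrightarrow> \<gamma>' t = \<gamma> t"
  shows "has_C1_deriv_on N \<gamma>' g A"
proof -
  have "has_deriv_wrt N \<gamma>' (g t) t A" if "t \<in> A" for t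
  proof -
    have "\<forall>\<^sub>F s in at t within A. N ((1 / (s - t)) *\<^sub>R (\<gamma>' s - \<gamma>' t) - g t) = N ((1 / (s - t)) *\<^sub>R (\<gamma> s - \<gamma> t) - g t)"
      using assms(2) that by (simp add: eventually_at_filter)
    then show ?thesis unfolding has_deriv_wrt_def
      using assms(1) that by (subst tendsto_cong) (auto simp: has_C1_deriv_on_def has_deriv_wrt_def)
  qed
  then show ?thesis using assms(1) by (simp add: has_C1_deriv_on_def)
qed

lemma velocity_piece:
  assumes g: "has_C1_deriv_on N \<gamma> g {a..b}" and t: "a < t" "t < b" and ab: "{a..b} \<subseteq> {0..1}"
  shows "at t within {0..1} = at t within {a..b}" "has_deriv_wrt N \<gamma> (g t) t {0..1}" "velocity N \<gamma> t = g t"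
proof -
  have a0: "0 \<le> a" "b \<le> 1" using ab t by auto
  have "at t within {0..1} = at t" by (rule at_within_interior) (use t a0 in simp)
  moreover have "at t within {a..b} = at t" by (rule at_within_interior) (use t in simp)
  ultimately show eq: "at t within {0..1} = at t within {a..b}" by simp
  show d: "has_deriv_wrt N \<gamma> (g t) t {0..1}"
    using g t unfolding has_C1_deriv_on_def has_deriv_wrt_def eq by simp
  show "velocity N \<gamma> t = g t" unfolding velocity_def
  proof (rule the_equality)
    show "has_deriv_wrt N \<gamma> (g t) t {0..1}" by (rule d)
    fix D assume "has_deriv_wrt N \<gamma> D t {0..1}"
    then show "D = g t" using d
      by (rule has_deriv_wrt_unique) (use t a0 in \<open>auto simp: trivial_limit_within islimpt_Icc\<close>)
  qed
qed

end

context gauge_norm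
begin

lemma has_deriv_wrt_imp_has_vector_derivative:
  assumes "has_deriv_wrt N \<gamma> D t A"
  shows "(\<gamma> has_vector_derivative D) (at t within A)"
proof -
  have "((\<lambda>s. norm ((1 / (s - t)) *\<^sub>R (\<gamma> s - \<gamma> t) - D)) \<longlongrightarrow> 0) (at t within A)"
    by (rule tendsto_0_of_ennreal_le[OF assms[unfolded has_deriv_wrt_def] norm_ge_zero embed_const(2)])
  then have *: "((\<lambda>s. norm ((1 / \<bar>s - t\<bar>) *\<^sub>R (\<gamma> s - (\<gamma> t + (s - t) *\<^sub>R D)))) \<longlongrightarrow> 0) (at t within A)"
  proof (rule Lim_transform_eventually)
    have "norm ((1 / (s - t)) *\<^sub>R (\<gamma> s - \<gamma> t) - D) = norm ((1 / \<bar>s - t\<bar>) *\<^sub>R (\<gamma> s - (\<gamma> t + (s - t) *\<^sub>R D)))"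
      if "s \<noteq> t" for s
    proof -
      have "(1 / (s - t)) *\<^sub>R (\<gamma> s - \<gamma> t) - D = (1 / (s - t)) *\<^sub>R (\<gamma> s - (\<gamma> t + (s - t) *\<^sub>R D))"
        using that by (simp add: scaleR_diff_right scaleR_add_right)
      then show ?thesis by simp
    qed
    then show "\<forall>\<^sub>F s in at t within A. norm ((1 / (s - t)) *\<^sub>R (\<gamma> s - \<gamma> t) - D) =
        norm ((1 / \<bar>s - t\<bar>) *\<^sub>R (\<gamma> s - (\<gamma> t + (s - t) *\<^sub>R D)))"
      by (simp add: eventually_at_filter)
  qed
  show ?thesis
    unfolding has_vector_derivative_def has_derivative_within
    using tendsto_norm_zero_cancel[OF *] by (simp add: bounded_linear_scaleR_left)
qed

text \<open>The extra point in the first inclusion accounts for n = 0.\<close>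

lemma partition_covers:
  fixes \<tau> :: "nat \<Rightarrow> real"
  assumes "\<And>i. i < n \<Longrightarrow> \<tau> i < \<tau> (Suc i)"
  shows "{\<tau> 0..\<tau> n} \<subseteq> (\<Union>i<n. {\<tau> i..\<tau> (Suc i)}) \<union> {\<tau> 0}" "\<And>i. i < n \<Longrightarrow> {\<tau> i..\<tau> (Suc i)} \<subseteq> {\<tau> 0..\<tau> n}"
proof -
  show "{\<tau> 0..\<tau> n} \<subseteq> (\<Union>i<n. {\<tau> i..\<tau> (Suc i)}) \<union> {\<tau> 0}"
    using assms
  proof (induction n)
    case (Suc n)
    have "{\<tau> 0..\<tau> (Suc n)} \<subseteq> {\<tau> 0..\<tau> n} \<union> {\<tau> n..\<tau> (Suc n)}" by auto
    also have "\<dots> \<subseteq> ((\<Union>i<n. {\<tau> i..\<tau> (Suc i)}) \<union> {\<tau> 0}) \<union> {\<tau> n..\<tau> (Suc n)}"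
      using Suc by (intro Un_mono) auto
    finally show ?case by (auto simp: lessThan_Suc)
  qed auto
  have mono: "\<tau> i \<le> \<tau> j" if "i \<le> j" "j \<le> n" for i j
    using that
  proof (induction j rule: dec_induct)
    case (step m)
    then show ?case using assms[of m] by linarith
  qed simp
  fix i assume "i < n"
  then show "{\<tau> i..\<tau> (Suc i)} \<subseteq> {\<tau> 0..\<tau> n}" using mono[of 0 i] mono[of "Suc i" n] by auto
qed

text \<open>Inside a piece \<open>velocity\<close> is the derivative of that piece; all partition
  points go into B. The bound comes from continuity of each piece derivative on its compact
  interval.\<close>

lemma piecewise_C1_regular:
  assumes \<gamma>: "\<gamma> \<in> piecewise_C1_curves N u v"
  obtains B where "regular \<gamma> (velocity N \<gamma>) B"
proof -
  have un: "\<And>t. t \<in> {0..1} \<Longrightarrow> unitary (\<gamma> t)" "\<And>t. t \<in> {0..1} \<Longrightarrow> \<gamma> t - 1 \<in> norm_ideal N"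
    using \<gamma> by (auto simp: piecewise_C1_curves_def unitaries_def)
  obtain n \<tau> where \<tau>: "\<tau> 0 = 0" "\<tau> n = 1" "\<And>i. i < n \<Longrightarrow> \<tau> i < \<tau> (Suc i)"
    "\<And>i. i < n \<Longrightarrow> C1_on N \<gamma> {\<tau> i..\<tau> (Suc i)}"
    using \<gamma> unfolding piecewise_C1_curves_def piecewise_def by blast
  obtain g where g: "\<And>i. i < n \<Longrightarrow> has_C1_deriv_on N \<gamma> (g i) {\<tau> i..\<tau> (Suc i)}"
    using \<tau>(4) unfolding C1_on_def by metis
  define P where "P i = {\<tau> i..\<tau> (Suc i)}" for i
  have n0: "n \<noteq> 0" using \<tau>(1,2) by (metis zero_neq_one)
  have sub: "P i \<subseteq> {0..1}" if "i < n" for i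
    using partition_covers(2)[where n=n and \<tau>=\<tau>, OF \<tau>(3) that] \<tau>(1,2) by (simp add: P_def)
  have cov: "{0..1} = (\<Union>i<n. P i)"
  proof
    have "(0::real) \<in> P 0" using \<tau>(1) \<tau>(3)[of 0] n0 by (simp add: P_def)
    then have "0 \<in> (\<Union>i<n. P i)" using n0 by blast
    moreover have "{0..1} \<subseteq> (\<Union>i<n. P i) \<union> {0}"
      using partition_covers(1)[where n=n and \<tau>=\<tau>, OF \<tau>(3)] unfolding \<tau>(1,2) P_def .
    ultimately show "{0..1} \<subseteq> (\<Union>i<n. P i)" by blast
  qed (use sub in blast)
  have nt: "at t within P i \<noteq> bot" if "i < n" "t \<in> P i" for i t
    using \<tau>(3)[OF that(1)] that(2) by (auto simp: P_def trivial_limit_within islimpt_Icc)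
  have gI: "g i t \<in> norm_ideal N" if "i < n" "t \<in> P i" for i t
  proof (rule has_deriv_wrt_norm_ideal[OF _ nt[OF that] un(2) that(2)])
    show "has_deriv_wrt N \<gamma> (g i t) t (P i)" using g[OF that(1)] that(2) by (simp add: has_C1_deriv_on_def P_def)
  qed (use sub that in blast)
  have gc: "((\<lambda>s. nu (g i s - g i t)) \<longlongrightarrow> 0) (at t within P i)" if "i < n" "t \<in> P i" for i t
  proof (rule tendsto_0_of_ennreal_le[where C=1])
    show "((\<lambda>s. N (g i s - g i t)) \<longlongrightarrow> 0) (at t within P i)"
      using g[OF that(1)] that(2) by (simp add: has_C1_deriv_on_def P_def)
    show "ennreal (nu (g i s - g i t)) \<le> ennreal 1 * N (g i s - g i t)" for s
      using norm_ideal_nu[of "g i s - g i t"] by (cases "g i s - g i t \<in> norm_ideal N") (auto simp: norm_ideal_def nu_def less_top[symmetric])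
  qed (rule nu_nonneg)
  define B where "B = \<tau> ` {..n}"
  have fB: "finite B" by (simp add: B_def)
  have B01: "0 \<in> B" "1 \<in> B" unfolding B_def
    using image_eqI[of 0 \<tau> 0 "{..n}"] image_eqI[of 1 \<tau> n "{..n}"] \<tau>(1,2) by simp_all
  have piece: "\<exists>i<n. \<tau> i < t \<and> t < \<tau> (Suc i)" if "t \<in> {0..1} - B" for t
  proof -
    have "t \<in> (\<Union>i<n. P i)" using that unfolding cov[symmetric] by simp
    then obtain i where i: "i < n" "t \<in> P i" by blast
    have "\<tau> i \<in> B" "\<tau> (Suc i) \<in> B" using i(1) by (simp_all add: B_def)
    then have "t \<noteq> \<tau> i" "t \<noteq> \<tau> (Suc i)" using that by auto
    then show ?thesis using i by (auto simp: P_def)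
  qed
  note vp = velocity_piece[OF g, folded P_def, OF _ _ _ sub]
  have "continuous_on (\<Union>i<n. P i) \<gamma>"
  proof (rule continuous_on_closed_Union)
    fix i assume "i \<in> {..<n}"
    then show "continuous_on (P i) \<gamma>"
      using g[of i] has_vector_derivative_continuous[OF has_deriv_wrt_imp_has_vector_derivative]
      by (force simp: continuous_on_eq_continuous_within has_C1_deriv_on_def P_def)
  qed (auto simp: P_def)
  then have cont: "continuous_on {0..1} \<gamma>" using cov by simp
  have "\<exists>M. \<forall>t\<in>P i. nu (g i t) \<le> M" if "i < n" for i
  proof -
    have "continuous_on (P i) (\<lambda>t. nu (g i t))" unfolding continuous_on_def
    proof
      fix t assume t: "t \<in> P i"
      have ev: "\<forall>\<^sub>F s in at t within P i. s \<in> P i" by (simp add: eventually_at_filter)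
      show "((\<lambda>s. nu (g i s)) \<longlongrightarrow> nu (g i t)) (at t within P i)"
        by (rule tendsto_of_abs_diff_le[OF _ gc[OF that t]])
          (use ev in \<open>eventually_elim, intro nu_diff_le gI that t\<close>)
    qed
    then have "bounded ((\<lambda>t. nu (g i t)) ` P i)"
      by (intro compact_imp_bounded compact_continuous_image) (simp_all add: P_def)
    then show ?thesis by (auto simp: bounded_iff abs_le_iff)
  qed
  then obtain M where M: "\<And>i t. i < n \<Longrightarrow> t \<in> P i \<Longrightarrow> nu (g i t) \<le> M i" by metis
  have "regular \<gamma> (velocity N \<gamma>) B" unfolding regular_def
  proof (intro conjI ballI)
    show "\<exists>M. \<forall>t\<in>{0..1} - B. nu (velocity N \<gamma> t) \<le> M"
    proof (intro exI ballI)
      fix t assume "t \<in> {0..1} - B"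
      then obtain i where i: "i < n" "\<tau> i < t" "t < \<tau> (Suc i)" using piece by blast
      then have "nu (velocity N \<gamma> t) \<le> M i" unfolding vp(3)[OF i(1,2,3) i(1)] by (intro M) (auto simp: P_def)
      also have "\<dots> \<le> Max (M ` {..<n})" using i(1) by simp
      finally show "nu (velocity N \<gamma> t) \<le> Max (M ` {..<n})" .
    qed
  next
    fix t assume t: "t \<in> {0..1} - B"
    then obtain i where i: "i < n" "\<tau> i < t" "t < \<tau> (Suc i)" using piece by blast
    note v = vp[OF i(1,2,3) i(1)]
    have tP: "t \<in> P i" using i by (simp add: P_def)
    show "(\<gamma> has_vector_derivative velocity N \<gamma> t) (at t within {0..1})"
      unfolding v(3) by (rule has_deriv_wrt_imp_has_vector_derivative[OF v(2)])
    show "velocity N \<gamma> t \<in> norm_ideal N" unfolding v(3) by (rule gI[OF i(1) tP])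
    have "((\<lambda>s. nu (g i s - g i t)) \<longlongrightarrow> 0) (at t within {0..1} - B)"
      by (rule tendsto_within_subset[OF gc[OF i(1) tP, folded v(1)]]) simp
    moreover have "\<forall>\<^sub>F s in at t within {0..1} - B. nu (g i s - g i t) = nu (velocity N \<gamma> s - velocity N \<gamma> t)"
    proof -
      have "\<forall>\<^sub>F s in at t within {0..1} - B. s \<in> {\<tau> i<..<\<tau> (Suc i)}"
        unfolding eventually_at_topological using i(2,3)
        by (intro exI[of _ "{\<tau> i<..<\<tau> (Suc i)}"]) simp
      then show ?thesis
      proof eventually_elim
        case (elim s)
        then show ?case using vp(3)[OF i(1) _ _ i(1), of s] v(3) by simp
      qed
    qed
    ultimately show "((\<lambda>s. nu (velocity N \<gamma> s - velocity N \<gamma> t)) \<longlongrightarrow> 0) (at t within {0..1} - B)"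
      by (rule Lim_transform_eventually)
  qed (use un fB B01 cont in auto)
  then show ?thesis by (rule that)
qed

lemma unitaries_mult: "u \<in> unitaries N \<Longrightarrow> v \<in> unitaries N \<Longrightarrow> u * v \<in> unitaries N"
proof -
  assume u: "u \<in> unitaries N" and v: "v \<in> unitaries N"
  have "u * v - 1 = u * (v - 1) + (u - 1)" by (simp add: algebra_simps)
  moreover have "u * (v - 1) + (u - 1) \<in> norm_ideal N"
    by (rule norm_ideal_add[OF norm_ideal_mult_left]) (use u v in \<open>simp_all add: unitaries_def\<close>)
  ultimately show "u * v \<in> unitaries N"
    using u v unitary_mult[of u v] unfolding unitaries_def by (simp only: mem_Collect_eq)
qed

lemma unitaries_adj: "u \<in> unitaries N \<Longrightarrow> adj u \<in> unitaries N"
proof -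
  assume u: "u \<in> unitaries N"
  then have "adj u - 1 = - (adj u * (u - 1))" by (simp add: unitaries_def unitary_def algebra_simps)
  then show "adj u \<in> unitaries N"
    using u norm_ideal_uminus[OF norm_ideal_mult_left[of "u - 1" "adj u"]] by (simp add: unitaries_def unitary_adj)
qed

lemma regular_left_translate:
  assumes w: "w \<in> unitaries N" and r: "regular \<gamma> V B"
  shows "regular (\<lambda>t. w * \<gamma> t) (\<lambda>t. w * V t) B"
proof -
  have nuw: "nu (w * x) = nu x" for x using w by (simp add: nu_def N_unitary_left unitaries_def)
  have un: "w * \<gamma> t \<in> unitaries N" if "t \<in> {0..1}" for t
    by (rule unitaries_mult[OF w]) (use regularD(4,5)[OF r that] in \<open>simp add: unitaries_def\<close>)
  show ?thesis unfolding regular_def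
  proof (intro conjI ballI)
    fix t assume t: "t \<in> {0..1} - B"
    show "((\<lambda>t. w * \<gamma> t) has_vector_derivative w * V t) (at t within {0..1})"
      by (rule bounded_linear.has_vector_derivative[OF bounded_linear_mult_right regularD(7)[OF r t]])
    show "w * V t \<in> norm_ideal N" by (rule norm_ideal_mult_left[OF regularD(8)[OF r t]])
    show "((\<lambda>s. nu (w * V s - w * V t)) \<longlongrightarrow> 0) (at t within {0..1} - B)"
      using regularD(9)[OF r t] by (simp add: right_diff_distrib[symmetric] nuw)
  next
    show "\<exists>M. \<forall>t\<in>{0..1} - B. nu (w * V t) \<le> M" using regularD(10)[OF r] by (simp add: nuw)
    show "continuous_on {0..1} (\<lambda>t. w * \<gamma> t)" by (intro continuous_intros regularD(6)[OF r])
  qed (use un regularD(1,2,3)[OF r] in \<open>auto simp: unitaries_def\<close>)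
qed

lemma piecewise_C1_curve:
  assumes u: "u \<in> unitaries N" and \<gamma>: "\<gamma> \<in> piecewise_C1_curves N u v"
  obtains V B where "unitary_curve N \<phi> (\<lambda>t. adj u * \<gamma> t) V B"
    "curve_length N \<gamma> = ennreal (unitary_curve.arclen N V B 0 1)"
proof -
  obtain B where r: "regular \<gamma> (velocity N \<gamma>) B" using piecewise_C1_regular[OF \<gamma>] by blast
  define V where "V = (\<lambda>t. adj u * velocity N \<gamma> t)"
  have r': "regular (\<lambda>t. adj u * \<gamma> t) V B"
    unfolding V_def by (rule regular_left_translate[OF unitaries_adj[OF u] r])
  interpret c: unitary_curve N \<phi> "\<lambda>t. adj u * \<gamma> t" V B by unfold_locales (rule r')
  have Nv: "N (velocity N \<gamma> t) = N (V t)" for t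
    using u unfolding V_def by (simp add: N_unitary_left unitary_adj unitaries_def)
  obtain M where M: "\<And>t. t \<in> {0..1} - B \<Longrightarrow> nu (V t) \<le> M" using regularD(10)[OF r'] by blast
  have "curve_length N \<gamma> = ennreal (integral {0..1} c.speed)" unfolding curve_length_def
  proof (rule finitely_discontinuous_integral(2)[OF regularD(1)[OF r] c.speed_cont])
    fix t assume t: "t \<in> {0..1} - B"
    show "\<bar>c.speed t\<bar> \<le> M" using M[OF t] t by (simp add: c.speed_def nu_nonneg)
    show "N (velocity N \<gamma> t) = ennreal (c.speed t)"
      unfolding Nv using t norm_ideal_nu[OF regularD(8)[OF r' t]] by (simp add: c.speed_def)
  qed (rule c.speed_nonneg)
  then have "curve_length N \<gamma> = ennreal (c.arclen 0 1)" by (simp add: c.arclen_def)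
  then show ?thesis using that c.unitary_curve_axioms by blast
qed

subsection \<open>One-parameter subgroups\<close>

lemma scaleC_bop_mult_left: "(c *\<^sub>C x) * y = c *\<^sub>C (x * (y::'h bop))"
  by (rule bop_eqI) (simp add: bop_simps)

lemma scaleC_bop_mult_right: "x * (c *\<^sub>C y) = c *\<^sub>C (x * (y::'h bop))"
  by (rule bop_eqI) (simp add: bop_simps)

text \<open>The remainder is w times (w q): one factor is measured by N, the other in operator norm,
  which makes it of second order. This yields both that exp w - 1 lies in the ideal and that
  one-parameter groups are differentiable with respect to N.\<close>

lemma exp_remainder:
  fixes w :: "'h bop"
  shows "N (exp w - 1 - w) \<le> N w * ennreal (norm w * exp (norm w))"
proof -
  define q where "q = (\<Sum>n. inverse (fact (n + 2)) *\<^sub>R w ^ n)"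
  have le: "norm (inverse (fact (n + 2)) *\<^sub>R w ^ n) \<le> inverse (fact n) *\<^sub>R norm w ^ n" for n
  proof -
    have "inverse (fact (n + 2)) \<le> (inverse (fact n) :: real)" by (intro le_imp_inverse_le fact_mono) auto
    then show ?thesis by (simp add: mult_mono norm_power_ineq del: fact_Suc add_2_eq_Suc')
  qed
  have s: "summable (\<lambda>n. inverse (fact n) *\<^sub>R norm w ^ n)" by (rule summable_exp_generic)
  have sq: "summable (\<lambda>n. inverse (fact (n + 2)) *\<^sub>R w ^ n)"
    by (rule summable_comparison_test'[OF s, of 0]) (rule le)
  have nq: "norm q \<le> exp (norm w)"
  proof -
    have sn: "summable (\<lambda>n. norm (inverse (fact (n + 2)) *\<^sub>R w ^ n))"
      by (rule summable_comparison_test'[OF s, of 0]) (use le in simp)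
    have "norm q \<le> (\<Sum>n. norm (inverse (fact (n + 2)) *\<^sub>R w ^ n))" unfolding q_def by (rule summable_norm[OF sn])
    also have "\<dots> \<le> (\<Sum>n. inverse (fact n) *\<^sub>R norm w ^ n)" by (rule suminf_le[OF le sn s])
    finally show ?thesis by (simp add: exp_def)
  qed
  have "(\<Sum>n. inverse (fact (n + 2)) *\<^sub>R w ^ (n + 2)) = (\<Sum>n. (w * w) * (inverse (fact (n + 2)) *\<^sub>R w ^ n))"
    by (intro suminf_cong) (simp add: mult.assoc del: fact_Suc)
  also have "\<dots> = (w * w) * q" unfolding q_def by (rule suminf_mult[OF sq])
  finally have "exp w - 1 - w = w * (w * q)"
    unfolding exp_first_two_terms by (simp add: mult.assoc)
  then have "N (exp w - 1 - w) \<le> N w * ennreal (norm (w * q))" by (simp add: N_mult_right)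
  also have "\<dots> \<le> N w * ennreal (norm w * exp (norm w))"
    by (intro mult_left_mono ennreal_leI order_trans[OF norm_mult_ineq] mult_left_mono nq) auto
  finally show ?thesis .
qed

definition expi :: "'h bop \<Rightarrow> real \<Rightarrow> 'h bop" where
  "expi z r = exp ((\<i> * complex_of_real r) *\<^sub>C z)"

lemma expi_unitaries:
  assumes z: "hermitian z" "z \<in> norm_ideal N"
  shows "expi z r \<in> unitaries N"
proof -
  define w where "w = (\<i> * complex_of_real r) *\<^sub>C z"
  have w: "w \<in> norm_ideal N" unfolding w_def by (rule norm_ideal_scaleC[OF z(2)])
  have "N (exp w - 1 - w) < \<infinity>"
    by (rule le_less_trans[OF exp_remainder]) (use w in \<open>simp add: norm_ideal_def ennreal_mult_less_top\<close>)
  then have "exp w - 1 - w \<in> norm_ideal N" by (simp add: norm_ideal_def)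
  from norm_ideal_add[OF this w] have "exp w - 1 \<in> norm_ideal N" by simp
  then show ?thesis using unitary_exp_i[OF z(1), of r] by (simp add: unitaries_def expi_def w_def)
qed

lemma expi_add: "expi z (r + s) = expi z r * expi z s"
proof -
  let ?w = "\<lambda>r. (\<i> * complex_of_real r) *\<^sub>C z"
  have add: "?w (r + s) = ?w r + ?w s" by (rule bop_eqI) (simp add: bop_simps distrib_left scaleC_add_left)
  have "?w r * ?w s = ?w s * ?w r"
    by (simp add: scaleC_bop_mult_left scaleC_bop_mult_right) (rule bop_eqI, simp add: bop_simps scaleC_scaleC mult.commute)
  then show ?thesis unfolding expi_def add by (rule exp_add_commuting)
qed

text \<open>An affine parameter covers the geodesic itself and both halves of the loops that go
  forth and back.\<close>

lemma expi_line_has_C1_deriv: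
  assumes u: "unitary u" and z: "hermitian z" "z \<in> norm_ideal N"
  shows "has_C1_deriv_on N (\<lambda>t. u * expi z (\<alpha> * t + \<beta>)) (\<lambda>t. (\<i> * complex_of_real \<alpha>) *\<^sub>C (u * expi z (\<alpha> * t + \<beta>) * z)) A"
  unfolding has_C1_deriv_on_def
proof (intro ballI conjI)
  fix t
  define g where "g t = u * expi z (\<alpha> * t + \<beta>)" for t
  have ug: "unitary (g t)" for t unfolding g_def
    using u expi_unitaries[OF z] by (simp add: unitary_mult unitaries_def)
  \<comment> \<open>This is the bound of \<open>exp_remainder\<close> for the increment
    \<open>\<alpha> * (s - t)\<close>, divided by |s - t|; one factor |s - t| survives.\<close>
  define C where "C s = \<bar>\<alpha>\<bar> * nu z * (\<bar>\<alpha>\<bar> * \<bar>s - t\<bar> * norm z * exp (\<bar>\<alpha>\<bar> * \<bar>s - t\<bar> * norm z))" for s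
  have C0: "(C \<longlongrightarrow> 0) (at t within A)"
  proof -
    have "(C \<longlongrightarrow> C t) (at t within A)" unfolding C_def by (intro tendsto_intros)
    then show ?thesis by (simp add: C_def)
  qed
  show deriv: "has_deriv_wrt N (\<lambda>t. u * expi z (\<alpha> * t + \<beta>)) ((\<i> * complex_of_real \<alpha>) *\<^sub>C (u * expi z (\<alpha> * t + \<beta>) * z)) t A"
    unfolding has_deriv_wrt_def g_def[symmetric]
  proof (rule tendsto_ennreal_0_of_le[OF C0])
    have "N ((1 / (s - t)) *\<^sub>R (g s - g t) - (\<i> * complex_of_real \<alpha>) *\<^sub>C (g t * z)) \<le> ennreal (C s)" if st: "s \<noteq> t" for s
    proof -
      define x where "x = \<alpha> * (s - t)"
      define w where "w = (\<i> * complex_of_real x) *\<^sub>C z"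
      have wI: "w \<in> norm_ideal N" unfolding w_def by (rule norm_ideal_scaleC[OF z(2)])
      have nw: "norm w \<le> \<bar>x\<bar> * norm z" unfolding w_def by (rule order_trans[OF norm_scaleC_bop]) (simp add: norm_mult)
      have gs: "g s = g t * exp w"
      proof -
        have "\<alpha> * s + \<beta> = (\<alpha> * t + \<beta>) + x" by (simp add: x_def algebra_simps)
        then show ?thesis unfolding g_def by (simp only: expi_add mult.assoc) (simp only: expi_def[of z x] w_def)
      qed
      have "(1 / (s - t)) *\<^sub>R w = (\<i> * complex_of_real \<alpha>) *\<^sub>C z"
        by (rule bop_eqI) (use st in \<open>simp add: w_def x_def bop_simps scaleC_of_real[symmetric] scaleC_scaleC\<close>)
      then have "(\<i> * complex_of_real \<alpha>) *\<^sub>C (g t * z) = (1 / (s - t)) *\<^sub>R (g t * w)"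
        by (metis mult_scaleR_right scaleC_bop_mult_right)
      then have "(1 / (s - t)) *\<^sub>R (g s - g t) - (\<i> * complex_of_real \<alpha>) *\<^sub>C (g t * z) =
          (1 / (s - t)) *\<^sub>R (g t * (exp w - 1 - w))"
        by (simp add: gs algebra_simps)
      then have "N ((1 / (s - t)) *\<^sub>R (g s - g t) - (\<i> * complex_of_real \<alpha>) *\<^sub>C (g t * z)) =
          ennreal (1 / \<bar>s - t\<bar>) * N (exp w - 1 - w)"
        by (simp add: N_scaleR N_unitary_left[OF ug])
      also have "\<dots> \<le> ennreal (1 / \<bar>s - t\<bar>) * (N w * ennreal (norm w * exp (norm w)))"
        by (intro mult_left_mono exp_remainder) simp
      also have "N w = ennreal (\<bar>x\<bar> * nu z)" unfolding w_def scaleC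
        using norm_ideal_nu[OF z(2)] by (simp add: norm_mult ennreal_mult nu_nonneg)
      also have "ennreal (1 / \<bar>s - t\<bar>) * (ennreal (\<bar>x\<bar> * nu z) * ennreal (norm w * exp (norm w)))
          = ennreal (1 / \<bar>s - t\<bar> * ((\<bar>x\<bar> * nu z) * (norm w * exp (norm w))))"
        by (simp add: ennreal_mult[symmetric] nu_nonneg)
      also have "\<dots> \<le> ennreal (1 / \<bar>s - t\<bar> * ((\<bar>x\<bar> * nu z) * ((\<bar>x\<bar> * norm z) * exp (\<bar>x\<bar> * norm z))))"
        using nw by (intro ennreal_leI mult_left_mono mult_mono) (auto simp: nu_nonneg)
      also have "1 / \<bar>s - t\<bar> * ((\<bar>x\<bar> * nu z) * ((\<bar>x\<bar> * norm z) * exp (\<bar>x\<bar> * norm z))) = C s"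
      proof -
        have ax: "\<bar>x\<bar> = \<bar>\<alpha>\<bar> * \<bar>s - t\<bar>" by (simp add: x_def abs_mult)
        have "1 / d * ((a * d * p) * ((a * d * q) * E)) = a * p * (a * d * q * E)" if "d \<noteq> 0" for a d p q E :: real
          using that by (simp add: field_simps)
        then show ?thesis unfolding ax C_def using st by simp
      qed
      finally show ?thesis .
    qed
    then show "\<forall>\<^sub>F s in at t within A. N ((1 / (s - t)) *\<^sub>R (g s - g t) - (\<i> * complex_of_real \<alpha>) *\<^sub>C (g t * z)) \<le> ennreal (C s)"
      by (simp add: eventually_at_filter)
  qed
  have gcont: "(g \<longlongrightarrow> g t) (at t within A)"
  proof -
    have "(g has_vector_derivative (\<i> * complex_of_real \<alpha>) *\<^sub>C (g t * z)) (at t within A)"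
      using has_deriv_wrt_imp_has_vector_derivative[OF deriv] unfolding g_def[abs_def] .
    from has_vector_derivative_continuous[OF this] show ?thesis by (simp add: continuous_within)
  qed
  define E where "E s = \<bar>\<alpha>\<bar> * (norm (g s - g t) * nu z)" for s
  have E0: "(E \<longlongrightarrow> 0) (at t within A)"
  proof -
    have "((\<lambda>s. \<bar>\<alpha>\<bar> * (norm (g s - g t) * nu z)) \<longlongrightarrow> \<bar>\<alpha>\<bar> * (norm (g t - g t) * nu z)) (at t within A)"
      by (intro tendsto_intros gcont)
    then show ?thesis by (simp add: E_def[abs_def])
  qed
  show "((\<lambda>s. N ((\<i> * complex_of_real \<alpha>) *\<^sub>C (u * expi z (\<alpha> * s + \<beta>) * z) -
      (\<i> * complex_of_real \<alpha>) *\<^sub>C (u * expi z (\<alpha> * t + \<beta>) * z))) \<longlongrightarrow> 0) (at t within A)"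
    unfolding g_def[symmetric]
  proof (rule tendsto_ennreal_0_of_le[OF E0], intro always_eventually allI)
    fix s
    have "(\<i> * complex_of_real \<alpha>) *\<^sub>C (g s * z) - (\<i> * complex_of_real \<alpha>) *\<^sub>C (g t * z)
        = (\<i> * complex_of_real \<alpha>) *\<^sub>C ((g s - g t) * z)"
      by (rule bop_eqI) (simp add: bop_simps complex_vector.scale_right_diff_distrib)
    then have "N ((\<i> * complex_of_real \<alpha>) *\<^sub>C (g s * z) - (\<i> * complex_of_real \<alpha>) *\<^sub>C (g t * z))
        = ennreal \<bar>\<alpha>\<bar> * N ((g s - g t) * z)" by (simp add: scaleC norm_mult)
    also have "\<dots> \<le> ennreal \<bar>\<alpha>\<bar> * (ennreal (norm (g s - g t)) * N z)"
      by (intro mult_left_mono N_mult_left) simp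
    also have "\<dots> = ennreal (E s)"
      using norm_ideal_nu[OF z(2)] by (simp add: E_def ennreal_mult nu_nonneg)
    finally show "N ((\<i> * complex_of_real \<alpha>) *\<^sub>C (g s * z) - (\<i> * complex_of_real \<alpha>) *\<^sub>C (g t * z)) \<le> ennreal (E s)" .
  qed
qed

lemma N_expi_velocity:
  "unitary u \<Longrightarrow> hermitian z \<Longrightarrow> N ((\<i> * complex_of_real \<alpha>) *\<^sub>C (u * expi z r * z)) = ennreal \<bar>\<alpha>\<bar> * N z"
proof -
  assume "unitary u" "hermitian z"
  then have "unitary (u * expi z r)" unfolding expi_def by (intro unitary_mult unitary_exp_i)
  then show ?thesis by (simp add: scaleC norm_mult N_unitary_left)
qed

lemma expi_zero: "expi z 0 = 1"
proof -
  have "(\<i> * complex_of_real 0) *\<^sub>C z = 0" by (rule bop_eqI) (simp add: bop_simps complex_vector.scale_zero_left)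
  then show ?thesis by (simp only: expi_def exp_zero)
qed

lemma geodesic_in_curves:
  assumes u: "u \<in> unitaries N" and z: "hermitian z" "z \<in> norm_ideal N"
  shows "(\<lambda>t. u * expi z t) \<in> piecewise_C1_curves N u (u * expi z 1)"
    "z \<noteq> 0 \<Longrightarrow> (\<lambda>t. u * expi z t) \<in> piecewise_smooth_curves N u (u * expi z 1)"
    "curve_length N (\<lambda>t. u * expi z t) = N z"
proof -
  have uu: "unitary u" using u by (simp add: unitaries_def)
  define g where "g t = (\<i> * complex_of_real 1) *\<^sub>C (u * expi z (1 * t + 0) * z)" for t
  have d: "has_C1_deriv_on N (\<lambda>t. u * expi z t) g A" for A
    using expi_line_has_C1_deriv[OF uu z, of 1 0 A] by (simp add: g_def[abs_def])
  have Ng: "N (g t) = N z" for t unfolding g_def N_expi_velocity[OF uu z(1)] by simp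
  have pw: "piecewise P" if "P {0..1}" for P
    unfolding piecewise_def using that by (intro exI[of _ 1] exI[of _ "\<lambda>i. real i"]) simp
  have base: "\<forall>t\<in>{0..1}. u * expi z t \<in> unitaries N" "u * expi z 0 = u"
    using unitaries_mult[OF u expi_unitaries[OF z]] by (simp_all add: expi_zero)
  show "(\<lambda>t. u * expi z t) \<in> piecewise_C1_curves N u (u * expi z 1)"
  proof -
    have "C1_on N (\<lambda>t. u * expi z t) {0..1}" unfolding C1_on_def using d by blast
    then show ?thesis unfolding piecewise_C1_curves_def using base by (simp add: pw)
  qed
  show "(\<lambda>t. u * expi z t) \<in> piecewise_smooth_curves N u (u * expi z 1)" if "z \<noteq> 0"
  proof -
    have "g t \<noteq> 0" for t using Ng[of t] that zero_iff by metis
    then have "smooth_on N (\<lambda>t. u * expi z t) {0..1}" unfolding smooth_on_def using d by blast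
    then show ?thesis unfolding piecewise_smooth_curves_def using base by (simp add: pw)
  qed
  have "curve_length N (\<lambda>t. u * expi z t) = (\<integral>\<^sup>+t. N z * indicator {0..1::real} t \<partial>lborel)"
    unfolding curve_length_def
  proof (rule nn_integral_cong_AE, rule AE_I'[of "{0,1}"])
    show "{0, 1::real} \<in> null_sets lborel" by (rule finite_imp_null_set_lborel) simp
    have "N (velocity N (\<lambda>t. u * expi z t) t) = N z" if "0 < t" "t < 1" for t
      using velocity_piece(3)[OF d that] Ng by simp
    then show "{t \<in> space lborel. N (velocity N (\<lambda>t. u * expi z t) t) * indicator {0..1} t \<noteq> N z * indicator {0..1} t} \<subseteq> {0, 1}"
      by (auto simp: indicator_def split: if_splits) (metis order_le_less)
  qed
  then show "curve_length N (\<lambda>t. u * expi z t) = N z" by (simp add: nn_integral_cmult_indicator)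
qed

text \<open>Going back and forth along a short one-parameter subgroup gives loops of arbitrarily small length.\<close>
lemma curve_dist_self:
  assumes u: "u \<in> unitaries N"
  shows "curve_dist N u u = 0"
proof -
  have uu: "unitary u" using u by (simp add: unitaries_def)
  obtain p where p: "p \<noteq> 0" "p \<in> norm_ideal N" "hermitian p" using rank_one_norm by metis
  have small: "curve_dist N u u \<le> ennreal (\<epsilon> * nu p)" if \<epsilon>: "\<epsilon> > 0" for \<epsilon>
  proof -
    \<comment> \<open>Both branches have the value \<open>\<epsilon> / 2\<close> at 1/2, so each
      half is an affine piece on its closed interval.\<close>
    define \<gamma> where "\<gamma> t = u * expi p (if t \<le> 1/2 then \<epsilon> * t + 0 else - \<epsilon> * t + \<epsilon>)" for t
    define g1 where "g1 t = (\<i> * complex_of_real \<epsilon>) *\<^sub>C (u * expi p (\<epsilon> * t + 0) * p)" for t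
    define g2 where "g2 t = (\<i> * complex_of_real (- \<epsilon>)) *\<^sub>C (u * expi p (- \<epsilon> * t + \<epsilon>) * p)" for t
    have d1: "has_C1_deriv_on N \<gamma> g1 {0..1/2}"
      unfolding g1_def
      by (rule has_C1_deriv_on_cong[OF expi_line_has_C1_deriv[OF uu p(3,2)]]) (simp add: \<gamma>_def)
    have d2: "has_C1_deriv_on N \<gamma> g2 {1/2..1}"
      unfolding g2_def
    proof (rule has_C1_deriv_on_cong[OF expi_line_has_C1_deriv[OF uu p(3,2)]])
      show "\<gamma> t = u * expi p (- \<epsilon> * t + \<epsilon>)" if "t \<in> {1/2..1}" for t
      proof (cases "t = 1/2")
        case True
        show ?thesis unfolding \<gamma>_def True by simp
      qed (use that in \<open>simp add: \<gamma>_def\<close>)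
    qed
    have N12: "N (g1 t) = ennreal (\<epsilon> * nu p)" "N (g2 t) = ennreal (\<epsilon> * nu p)" for t
      unfolding g1_def g2_def N_expi_velocity[OF uu p(3)]
      using \<epsilon> norm_ideal_nu[OF p(2)] by (simp_all add: ennreal_mult nu_nonneg)
    have "nu p > 0" by (rule nu_pos[OF p(2,1)])
    then have "N (g1 t) \<noteq> 0" "N (g2 t) \<noteq> 0" for t using \<epsilon> unfolding N12 by (simp_all add: mult_le_0_iff not_le)
    then have nz: "g1 t \<noteq> 0" "g2 t \<noteq> 0" for t using zero_iff by metis+
    have "piecewise (smooth_on N \<gamma>)" unfolding piecewise_def
    proof (intro exI conjI allI impI)
      fix i :: nat assume "i < 2"
      then have i: "i = 0 \<or> i = 1" by auto
      then show "real i / 2 < real (Suc i) / 2" by auto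
      show "smooth_on N \<gamma> {real i / 2..real (Suc i) / 2}"
        using i d1 d2 nz unfolding smooth_on_def by auto
    qed simp_all
    then have "\<gamma> \<in> piecewise_smooth_curves N u u" unfolding piecewise_smooth_curves_def
      using unitaries_mult[OF u expi_unitaries[OF p(3,2)]] by (simp add: \<gamma>_def expi_zero)
    then have "curve_dist N u u \<le> curve_length N \<gamma>" unfolding curve_dist_def by (rule INF_lower)
    also have "curve_length N \<gamma> = (\<integral>\<^sup>+t. ennreal (\<epsilon> * nu p) * indicator {0..1::real} t \<partial>lborel)"
      unfolding curve_length_def
    proof (rule nn_integral_cong_AE, rule AE_I'[of "{0,1/2,1}"])
      show "{0, 1/2, 1::real} \<in> null_sets lborel" by (rule finite_imp_null_set_lborel) simp
      have vel: "N (velocity N \<gamma> t) = ennreal (\<epsilon> * nu p)" if "0 \<le> t" "t \<le> 1" "t \<notin> {0, 1/2, 1}" for t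
      proof (cases "t < 1/2")
        case True
        then show ?thesis using velocity_piece(3)[OF d1, of t] that N12 by auto
      next
        case False
        then show ?thesis using velocity_piece(3)[OF d2, of t] that N12 by auto
      qed
      show "{t \<in> space lborel. N (velocity N \<gamma> t) * indicator {0..1} t \<noteq> ennreal (\<epsilon> * nu p) * indicator {0..1} t} \<subseteq> {0, 1/2, 1}"
      proof (rule subsetI, rule ccontr)
        fix t assume t: "t \<in> {t \<in> space lborel. N (velocity N \<gamma> t) * indicator {0..1} t \<noteq> ennreal (\<epsilon> * nu p) * indicator {0..1} t}"
          and "t \<notin> {0, 1/2, 1}"
        then show False using vel[of t] by (cases "t \<in> {0..1}") simp_all
      qed
    qed
    also have "\<dots> = ennreal (\<epsilon> * nu p)" by (simp add: nn_integral_cmult_indicator)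
    finally show ?thesis .
  qed
  have "((\<lambda>\<epsilon>. ennreal (\<epsilon> * nu p)) \<longlongrightarrow> ennreal (0 * nu p)) (at_right 0)"
    by (intro tendsto_ennrealI tendsto_intros)
  then have "curve_dist N u u \<le> ennreal (0 * nu p)"
    by (rule tendsto_lowerbound) (auto simp: eventually_at_filter intro!: always_eventually small)
  then show ?thesis by simp
qed

theorem geodesic_minimal_unique:
  assumes u: "u \<in> unitaries N" and z: "hermitian z" "z \<in> norm_ideal N" "norm z < pi"
  shows "curve_dist N u (u * expi z 1) = N z"
    and "rotund N \<Longrightarrow> \<gamma> \<in> piecewise_C1_curves N u (u * expi z 1) \<Longrightarrow> curve_length N \<gamma> = N z \<Longrightarrow>
      \<exists>s. continuous_on {0..1} s \<and> mono_on {0..1} s \<and> s ` {0..1} = {0..1} \<and> (\<forall>t\<in>{0..1}. \<gamma> t = u * expi z (s t))"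
proof -
  let ?v = "u * expi z 1"
  have uu: "adj u * u = 1" "u * adj u = 1" using u by (auto simp: unitaries_def unitary_def)
  have ends: "adj u * \<gamma> 0 = 1" "adj u * \<gamma> 1 = exp (\<i> *\<^sub>C z)" if "\<gamma> \<in> piecewise_C1_curves N u ?v" for \<gamma>
    using that uu by (simp_all add: piecewise_C1_curves_def mult.assoc[symmetric] expi_def)
  have lower: "N z \<le> curve_length N \<gamma>" if \<gamma>: "\<gamma> \<in> piecewise_C1_curves N u ?v" for \<gamma>
  proof -
    obtain V B where c: "unitary_curve N \<phi> (\<lambda>t. adj u * \<gamma> t) V B"
      "curve_length N \<gamma> = ennreal (unitary_curve.arclen N V B 0 1)"
      using piecewise_C1_curve[OF u \<gamma>] by blast
    interpret c: unitary_curve N \<phi> "\<lambda>t. adj u * \<gamma> t" V B by (rule c(1))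
    show ?thesis unfolding c(2) norm_ideal_nu[OF z(2)]
      by (rule ennreal_leI, rule c.norm_le_arclen[OF ends[OF \<gamma>] z])
  qed
  have sub: "piecewise_smooth_curves N u ?v \<subseteq> piecewise_C1_curves N u ?v"
    unfolding piecewise_smooth_curves_def piecewise_C1_curves_def piecewise_def smooth_on_def C1_on_def by blast
  show "curve_dist N u ?v = N z"
  proof (rule antisym)
    show "N z \<le> curve_dist N u ?v" unfolding curve_dist_def
      using lower sub by (intro INF_greatest) blast
    show "curve_dist N u ?v \<le> N z"
    \<comment> \<open>For z = 0 the geodesic has zero velocity and is no admissible smooth curve;
      the distance then comes from short loops.\<close>
    proof (cases "z = 0")
      case True
      have "?v = u" using True by (simp add: expi_def scaleC_zero_bop)
      then show ?thesis using curve_dist_self[OF u] by simp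
    next
      case False
      show ?thesis unfolding curve_dist_def
        using geodesic_in_curves(2)[OF u z(1,2) False] geodesic_in_curves(3)[OF u z(1,2)]
        by (metis INF_lower)
    qed
  qed
  assume rot: "rotund N" and \<gamma>: "\<gamma> \<in> piecewise_C1_curves N u ?v" and len: "curve_length N \<gamma> = N z"
  obtain V B where c: "unitary_curve N \<phi> (\<lambda>t. adj u * \<gamma> t) V B"
    "curve_length N \<gamma> = ennreal (unitary_curve.arclen N V B 0 1)"
    using piecewise_C1_curve[OF u \<gamma>] by blast
  interpret c: unitary_curve N \<phi> "\<lambda>t. adj u * \<gamma> t" V B by (rule c(1))
  have "c.arclen 0 1 \<ge> 0" unfolding c.arclen_def by (intro integral_nonneg c.speed_int c.speed_nonneg)
  then have "c.arclen 0 1 = nu z" using len c(2) norm_ideal_nu[OF z(2)] by (simp add: nu_nonneg)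
  from c.minimal_curve_unique[OF rot ends[OF \<gamma>] z this]
  obtain s where s: "continuous_on {0..1} s" "mono_on {0..1} s" "s ` {0..1} = {0..1}"
    "\<And>t. t \<in> {0..1} \<Longrightarrow> adj u * \<gamma> t = expi z (s t)" unfolding expi_def by blast
  have "\<gamma> t = u * expi z (s t)" if "t \<in> {0..1}" for t
    using s(4)[OF that] uu(2) by (metis mult.assoc mult.left_neutral)
  then show "\<exists>s. continuous_on {0..1} s \<and> mono_on {0..1} s \<and> s ` {0..1} = {0..1} \<and> (\<forall>t\<in>{0..1}. \<gamma> t = u * expi z (s t))"
    using s by blast
qed

end

theorem corollary5p8:
  fixes N :: "'h::separable_infinite_hilbert bop \<Rightarrow> ennreal"
    and u z :: "'h bop"
  assumes "symmetric_norm N"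
    and "given_by_gauge N"
    and "\<not> equivalent_to_uniform N"
    and "rotund N"
    and "u \<in> unitaries N"
    and "hermitian z" and "z \<in> norm_ideal N" and "norm z < pi"
  shows "let \<delta> = (\<lambda>t::real. u * exp ((\<i> * complex_of_real t) *\<^sub>C z));
             v = u * exp (\<i> *\<^sub>C z)
         in \<delta> \<in> piecewise_C1_curves N u v \<and>
            curve_length N \<delta> = curve_dist N u v \<and>
            curve_dist N u v = N z \<and>
            (\<forall>\<gamma>\<in>piecewise_C1_curves N u v. curve_length N \<gamma> = N z \<longrightarrow>
               (\<exists>s. continuous_on {0..1} s \<and> mono_on {0..1} s \<and> s ` {0..1} = {0..1} \<and>
                    (\<forall>t\<in>{0..1}. \<gamma> t = \<delta> (s t))))"
proof -
  obtain \<phi> where \<phi>: "symmetric_gauge \<phi>"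
    "\<And>x. compact_op x \<Longrightarrow> N x = (SUP n. ennreal (\<phi> (\<lambda>j. if j < n then singular_values x j else 0)))"
    using assms(2) unfolding given_by_gauge_def by blast
  interpret gauge_norm N \<phi>
    using assms(1,3) \<phi> by (auto simp: gauge_norm_def gauge_norm_axioms_def trunc_def)
  note g = geodesic_in_curves[OF assms(5-7)] geodesic_minimal_unique[OF assms(5-8)]
  have e1: "expi z 1 = exp (\<i> *\<^sub>C z)" by (simp add: expi_def)
  show ?thesis
    unfolding Let_def e1[symmetric] unfolding expi_def[symmetric]
    using g(1,3,4) g(5)[OF assms(4)] by simp
qed

end
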